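(* Let $n\ge2$ and $l,m\in\mathbb Z_{\ge0}$. The space of $\mathcal U_q(n-1)$-invariant elements of $\widetilde{\mathcal H}_n(l,m)$ is one-dimensional and is spanned by $$R^{(n-2)}_{l,m}(z_n,w_n;q^2)=\begin{cases} z_n^{\,l-m}\,P^{(n-2,l-m)}_m(Q_{n-1};q^2), & l\ge m,\\ P^{(n-2,m-l)}_l(Q_{n-1};q^2)\,w_n^{\,m-l}, & l\le m,\end{cases}$$ (images in $\widetilde{\mathcal Z}_n$).
   Context: Fix $0<q<1$, $n\ge2$. $\mathcal Z_n$ is the unital complex $*$-algebra generated by $z_1,\dots,z_n,w_1,\dots,w_n$ subject to $z_iz_j=qz_jz_i$ $(i<j)$, $w_jw_i=qw_iw_j$ $(i<j)$, $w_iz_j=qz_jw_i$ $(i\ne j)$, $w_iz_i=z_iw_i+(1-q^2)\sum_{k<i}z_kw_k$, with involution $z_i^*=w_i$. For $\lambda,\mu\in\mathbb Z_{\ge0}^n$ put $z^\lambda w^\mu=z_1^{\lambda_1}\cdots z_n^{\lambda_n}w_n^{\mu_n}\cdots w_1^{\mu_1}$ (these form a basis of $\mathcal Z_n$), $|\lambda|=\sum_i\lambda_i$, and $Q_i=\sum_{k=1}^iz_kw_k$. $\mathcal Z_n(l,m)$ is the span of the $z^\lambda w^\mu$ with $|\lambda|=l,|\mu|=m$. Operators (the action of generators of $\mathcal U_q(\mathfrak{gl}(n))$ induced by the natural coaction of the quantum unitary group): for $h\in\mathbb Z^n$, $1\le k\le n-1$, with $\epsilon_i$ the unit vectors, $\langle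 h,\lambda\rangle=\sum h_i\lambda_i$, $[a]_{q^{-2}}=(1-q^{-2a})/(1-q^{-2})$, and terms with a negative exponent understood as $0$: $q^h.z^\lambda w^\mu=q^{\langle h,\lambda-\mu\rangle}z^\lambda w^\mu$; $f_k.z^\lambda w^\mu=-q^{\mu_k+1}[\mu_{k+1}]_{q^{-2}}z^\lambda w^{\mu-\epsilon_{k+1}+\epsilon_k}+q^{\lambda_{k+1}+\mu_k-\mu_{k+1}}[\lambda_k]_{q^{-2}}z^{\lambda-\epsilon_k+\epsilon_{k+1}}w^\mu$; $e_k.z^\lambda w^\mu=-q^{-1}q^{\mu_{k+1}+\lambda_k-\lambda_{k+1}}[\mu_k]_{q^{-2}}z^\lambda w^{\mu+\epsilon_{k+1}-\epsilon_k}+q^{\lambda_k}[\lambda_{k+1}]_{q^{-2}}z^{\lambda+\epsilon_k-\epsilon_{k+1}}w^\mu$. An element $\phi$ is $\mathcal U_q(n-p)$-invariant if $q^{\epsilon_i}.\phi=\phi$ for $1\le i\le n-p$ and $e_k.\phi=f_k.\phi=0$ for $1\le k\le n-p-1$. $Q_n$ is central and $\widetilde{\mathcal Z}_n=\mathcal Z_n/(Q_n-1)$; the operators above descend to $\widetilde{\mathcal Z}_n$. $\widetilde{\mathcal Z}_n(l,m)$ is the image of $\mathcal Z_n(l,m)$ (so $\widetilde{\mathcal Z}_n(l-1,m-1)\subset\widetilde{\mathcal Z}_n(l,m)$). $h_n$ is the linear functional on $\widetilde{\mathcal Z}_n$ with $h_n(z^\lambda w^\mu)=\delta_{\lambda\mu}q^{-2((n-1)\lambda_1+(n-2)\lambda_2+\cdots+\lambda_{n-1})}\frac{(q^{-2};q^{-2})_{\lambda_1}\cdots(q^{-2};q^{-2})_{\lambda_n}(q^{-2};q^{-2})_{n-1}}{(q^{-2};q^{-2})_{|\lambda|+n-1}}$,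 where $(a;p)_k=\prod_{j=0}^{k-1}(1-ap^j)$; $\langle\phi,\psi\rangle=h_n(\psi^*\phi)$ is a positive definite inner product. $\widetilde{\mathcal H}_n(l,m)$ is the orthogonal complement of $\widetilde{\mathcal Z}_n(l-1,m-1)$ in $\widetilde{\mathcal Z}_n(l,m)$ (with $\widetilde{\mathcal Z}_n(l-1,m-1)=0$ if $l=0$ or $m=0$). Little $q$-Jacobi polynomials: $P^{(\alpha,\beta)}_m(x;p)=\sum_{k=0}^m\frac{(p^{-m};p)_k(p^{\alpha+\beta+m+1};p)_k}{(p^{\alpha+1};p)_k(p;p)_k}(px)^k$. *)

theory Defs
  imports Complex_Main
begin

datatype gen = Zg nat | Wg nat

type_synonym fa = "gen list \<Rightarrow> complex"

definition letters :: "nat \<Rightarrow> gen set" where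
  "letters n = {Zg i | i. 1 \<le> i \<and> i \<le> n} \<union> {Wg i | i. 1 \<le> i \<and> i \<le> n}"

definition felem :: "nat \<Rightarrow> fa set" where
  "felem n = {f. finite {w. f w \<noteq> 0} \<and> (\<forall>w. f w \<noteq> 0 \<longrightarrow> set w \<subseteq> letters n)}"

definition fzero :: fa where "fzero = (\<lambda>w. 0)"
definition fone :: fa where "fone = (\<lambda>w. if w = [] then 1 else 0)"
definition fadd :: "fa \<Rightarrow> fa \<Rightarrow> fa" where "fadd f g = (\<lambda>w. f w + g w)"
definition fsub :: "fa \<Rightarrow> fa \<Rightarrow> fa" where "fsub f g = (\<lambda>w. f w - g w)"
definition fsc :: "complex \<Rightarrow> fa \<Rightarrow> fa" where "fsc c f = (\<lambda>w. c * f w)"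
definition fmul :: "fa \<Rightarrow> fa \<Rightarrow> fa" where
  "fmul f g = (\<lambda>w. \<Sum>i\<le>length w. f (take i w) * g (drop i w))"
definition fgen :: "gen \<Rightarrow> fa" where "fgen a = (\<lambda>w. if w = [a] then 1 else 0)"

primrec fpow :: "fa \<Rightarrow> nat \<Rightarrow> fa" where
  "fpow x 0 = fone"
| "fpow x (Suc k) = fmul x (fpow x k)"

fun swapg :: "gen \<Rightarrow> gen" where
  "swapg (Zg i) = Wg i"
| "swapg (Wg i) = Zg i"

definition fstar :: "fa \<Rightarrow> fa" where
  "fstar f = (\<lambda>w. cnj (f (rev (map swapg w))))"

definition Qel :: "nat \<Rightarrow> fa" where
  "Qel i = (\<lambda>w. \<Sum>k\<in>{1..i}. fmul (fgen (Zg k)) (fgen (Wg k)) w)"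

definition rels :: "nat \<Rightarrow> real \<Rightarrow> fa set" where
  "rels n q =
     {fsub (fmul (fgen (Zg i)) (fgen (Zg j))) (fsc (of_real q) (fmul (fgen (Zg j)) (fgen (Zg i))))
        | i j. 1 \<le> i \<and> i < j \<and> j \<le> n}
   \<union> {fsub (fmul (fgen (Wg j)) (fgen (Wg i))) (fsc (of_real q) (fmul (fgen (Wg i)) (fgen (Wg j))))
        | i j. 1 \<le> i \<and> i < j \<and> j \<le> n}
   \<union> {fsub (fmul (fgen (Wg i)) (fgen (Zg j))) (fsc (of_real q) (fmul (fgen (Zg j)) (fgen (Wg i))))
        | i j. 1 \<le> i \<and> i \<le> n \<and> 1 \<le> j \<and> j \<le> n \<and> i \<noteq> j}
   \<union> {fsub (fsub (fmul (fgen (Wg i)) (fgen (Zg i))) (fmul (fgen (Zg i)) (fgen (Wg i))))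
           (fsc (of_real (1 - q^2)) (Qel (i - 1)))
        | i. 1 \<le> i \<and> i \<le> n}"

inductive_set gideal :: "nat \<Rightarrow> fa set \<Rightarrow> fa set" for n :: nat and R :: "fa set" where
  gi_zero: "fzero \<in> gideal n R"
| gi_gen: "r \<in> R \<Longrightarrow> a \<in> felem n \<Longrightarrow> b \<in> felem n \<Longrightarrow> fmul (fmul a r) b \<in> gideal n R"
| gi_add: "x \<in> gideal n R \<Longrightarrow> y \<in> gideal n R \<Longrightarrow> fadd x y \<in> gideal n R"
| gi_smult: "x \<in> gideal n R \<Longrightarrow> fsc c x \<in> gideal n R"

text \<open>Kernel of free algebra -> Z_n\<close>
definition Iz :: "nat \<Rightarrow> real \<Rightarrow> fa set" where
  "Iz n q = gideal n (rels n q)"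

text \<open>Kernel of free algebra -> tilde Z_n = Z_n / (Q_n - 1)\<close>
definition Jz :: "nat \<Rightarrow> real \<Rightarrow> fa set" where
  "Jz n q = gideal n (insert (fsub (Qel n) fone) (rels n q))"

definition adm :: "nat \<Rightarrow> (nat \<Rightarrow> nat) set" where
  "adm n = {lam. \<forall>i. (i < 1 \<or> n < i) \<longrightarrow> lam i = 0}"

definition absl :: "nat \<Rightarrow> (nat \<Rightarrow> nat) \<Rightarrow> nat" where
  "absl n lam = (\<Sum>i\<in>{1..n}. lam i)"

definition monow :: "nat \<Rightarrow> (nat \<Rightarrow> nat) \<Rightarrow> (nat \<Rightarrow> nat) \<Rightarrow> gen list" where
  "monow n lam mu =
     concat (map (\<lambda>i. replicate (lam i) (Zg i)) [1..<n+1])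
   @ concat (map (\<lambda>i. replicate (mu i) (Wg i)) (rev [1..<n+1]))"

definition mono :: "nat \<Rightarrow> (nat \<Rightarrow> nat) \<Rightarrow> (nat \<Rightarrow> nat) \<Rightarrow> fa" where
  "mono n lam mu = (\<lambda>w. if w = monow n lam mu then 1 else 0)"

type_synonym cfam = "(nat \<Rightarrow> nat) \<times> (nat \<Rightarrow> nat) \<Rightarrow> complex"

definition csupp :: "cfam \<Rightarrow> ((nat \<Rightarrow> nat) \<times> (nat \<Rightarrow> nat)) set" where
  "csupp c = {p. c p \<noteq> 0}"

definition cfams :: "nat \<Rightarrow> cfam set" where
  "cfams n = {c. finite (csupp c) \<and> csupp c \<subseteq> adm n \<times> adm n}"

definition lin :: "nat \<Rightarrow> cfam \<Rightarrow> fa" where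
  "lin n c = (\<lambda>w. \<Sum>p\<in>csupp c. c p * mono n (fst p) (snd p) w)"

text \<open>Coordinates of (the image in Z_n of) a free-algebra element in the basis z^lambda w^mu
  (well defined since these monomials form a basis of Z_n).\<close>
definition coords :: "nat \<Rightarrow> real \<Rightarrow> fa \<Rightarrow> cfam" where
  "coords n q x = (THE c. c \<in> cfams n \<and> fsub x (lin n c) \<in> Iz n q)"

definition opapp :: "nat \<Rightarrow> real \<Rightarrow> ((nat \<Rightarrow> nat) \<Rightarrow> (nat \<Rightarrow> nat) \<Rightarrow> fa) \<Rightarrow> fa \<Rightarrow> fa" where
  "opapp n q T x = (\<lambda>w. \<Sum>p\<in>csupp (coords n q x). coords n q x p * T (fst p) (snd p) w)"

definition qpoch :: "real \<Rightarrow> real \<Rightarrow> nat \<Rightarrow> real" where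
  "qpoch a p k = (\<Prod>j<k. 1 - a * p ^ j)"

definition qnum :: "real \<Rightarrow> nat \<Rightarrow> real" where
  "qnum q a = (1 - (1 / q^2) ^ a) / (1 - 1 / q^2)"

definition qeps_b :: "nat \<Rightarrow> real \<Rightarrow> nat \<Rightarrow> (nat \<Rightarrow> nat) \<Rightarrow> (nat \<Rightarrow> nat) \<Rightarrow> fa" where
  "qeps_b n q i lam mu = fsc (of_real (q powi (int (lam i) - int (mu i)))) (mono n lam mu)"

definition f_b :: "nat \<Rightarrow> real \<Rightarrow> nat \<Rightarrow> (nat \<Rightarrow> nat) \<Rightarrow> (nat \<Rightarrow> nat) \<Rightarrow> fa" where
  "f_b n q k lam mu =
     fadd
      (if 1 \<le> mu (k+1) then
         fsc (of_real (- (q ^ (mu k + 1)) * qnum q (mu (k+1))))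
             (mono n lam (mu(k+1 := mu (k+1) - 1, k := mu k + 1)))
       else fzero)
      (if 1 \<le> lam k then
         fsc (of_real (q powi (int (lam (k+1)) + int (mu k) - int (mu (k+1))) * qnum q (lam k)))
             (mono n (lam(k := lam k - 1, k+1 := lam (k+1) + 1)) mu)
       else fzero)"

definition e_b :: "nat \<Rightarrow> real \<Rightarrow> nat \<Rightarrow> (nat \<Rightarrow> nat) \<Rightarrow> (nat \<Rightarrow> nat) \<Rightarrow> fa" where
  "e_b n q k lam mu =
     fadd
      (if 1 \<le> mu k then
         fsc (of_real (- (1 / q) * q powi (int (mu (k+1)) + int (lam k) - int (lam (k+1))) * qnum q (mu k)))
             (mono n lam (mu(k := mu k - 1, k+1 := mu (k+1) + 1)))
       else fzero)
      (if 1 \<le> lam (k+1) then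
         fsc (of_real (q ^ (lam k) * qnum q (lam (k+1))))
             (mono n (lam(k := lam k + 1, k+1 := lam (k+1) - 1)) mu)
       else fzero)"

text \<open>x (representing its image in tilde Z_n) is U_q(n-p)-invariant.\<close>
definition invariant :: "nat \<Rightarrow> real \<Rightarrow> nat \<Rightarrow> fa \<Rightarrow> bool" where
  "invariant n q p x \<longleftrightarrow>
     (\<forall>i. 1 \<le> i \<and> i \<le> n - p \<longrightarrow> fsub (opapp n q (qeps_b n q i) x) x \<in> Jz n q)
   \<and> (\<forall>k. 1 \<le> k \<and> k \<le> n - p - 1 \<longrightarrow>
        opapp n q (e_b n q k) x \<in> Jz n q \<and> opapp n q (f_b n q k) x \<in> Jz n q)"

definition hweight :: "nat \<Rightarrow> real \<Rightarrow> (nat \<Rightarrow> nat) \<Rightarrow> real" where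
  "hweight n q lam =
     (1 / q^2) ^ (\<Sum>i\<in>{1..n-1}. (n - i) * lam i)
     * (\<Prod>i\<in>{1..n}. qpoch (1/q^2) (1/q^2) (lam i)) * qpoch (1/q^2) (1/q^2) (n - 1)
     / qpoch (1/q^2) (1/q^2) (absl n lam + n - 1)"

definition hn :: "nat \<Rightarrow> real \<Rightarrow> fa \<Rightarrow> complex" where
  "hn n q x = (\<Sum>p\<in>csupp (coords n q x).
                 if fst p = snd p then coords n q x p * of_real (hweight n q (fst p)) else 0)"

definition ip :: "nat \<Rightarrow> real \<Rightarrow> fa \<Rightarrow> fa \<Rightarrow> complex" where
  "ip n q x y = hn n q (fmul (fstar y) x)"

definition inZt :: "nat \<Rightarrow> real \<Rightarrow> nat \<Rightarrow> nat \<Rightarrow> fa \<Rightarrow> bool" where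
  "inZt n q l m x \<longleftrightarrow>
     (\<exists>c\<in>cfams n. (\<forall>p\<in>csupp c. absl n (fst p) = l \<and> absl n (snd p) = m)
                  \<and> fsub x (lin n c) \<in> Jz n q)"

definition inHt :: "nat \<Rightarrow> real \<Rightarrow> nat \<Rightarrow> nat \<Rightarrow> fa \<Rightarrow> bool" where
  "inHt n q l m x \<longleftrightarrow>
     inZt n q l m x \<and>
     (1 \<le> l \<and> 1 \<le> m \<longrightarrow> (\<forall>y. inZt n q (l - 1) (m - 1) y \<longrightarrow> ip n q x y = 0))"

definition ljac_coeff :: "nat \<Rightarrow> nat \<Rightarrow> nat \<Rightarrow> real \<Rightarrow> nat \<Rightarrow> real" where
  "ljac_coeff \<alpha> \<beta> m p k =
     qpoch ((1/p) ^ m) p k * qpoch (p ^ (\<alpha> + \<beta> + m + 1)) p k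
     / (qpoch (p ^ (\<alpha> + 1)) p k * qpoch p p k) * p ^ k"

definition ljacP :: "nat \<Rightarrow> nat \<Rightarrow> nat \<Rightarrow> fa \<Rightarrow> real \<Rightarrow> fa" where
  "ljacP \<alpha> \<beta> m x p = (\<lambda>w. \<Sum>k\<le>m. of_real (ljac_coeff \<alpha> \<beta> m p k) * fpow x k w)"

definition Rel :: "nat \<Rightarrow> real \<Rightarrow> nat \<Rightarrow> nat \<Rightarrow> fa" where
  "Rel n q l m =
    (if m \<le> l then fmul (fpow (fgen (Zg n)) (l - m)) (ljacP (n - 2) (l - m) m (Qel (n - 1)) (q^2))
     else fmul (ljacP (n - 2) (m - l) l (Qel (n - 1)) (q^2)) (fpow (fgen (Wg n)) (m - l)))"

end

theory Submission
  imports Defs "HOL-Library.Multiset" "HOL-Computational_Algebra.Polynomial"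
begin

text \<open>The algebra \<open>Z_n\<close> embeds into the algebra generated by \<open>q\<close>-commuting invertible shifts \<open>S_i\<close>
  and commuting variables \<open>X_i\<close> via \<open>z_i = S_i\<close>, \<open>w_i = S_i^{-1} (X_i - X_{i-1})\<close>, so that
  \<open>Q_i = X_i\<close>. Under this embedding \<open>z^\<lambda> w^\<mu>\<close> becomes a power of \<open>q\<close> times \<open>S^{\<lambda>-\<mu>} B_\<mu>(X)\<close> with
  \<open>B_\<mu> = \<Prod>_i \<Prod>_{r<\<mu>_i} (X_i - q^{-2r} X_{i-1})\<close>, which gives the basis theorem for \<open>Z_n\<close> and
  describes the quotient by \<open>Q_n - 1\<close> as the specialization \<open>X_n = 1\<close>. The operators \<open>e_k\<close> and \<open>f_k\<close>
  become \<open>q\<close>-difference operators in \<open>X_k\<close>, so an element is invariant iff its coefficient function has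
  weight concentrated in the last coordinate and depends on \<open>X_{n-1}\<close> only. On such elements the
  functional \<open>h_n\<close> reduces to the Jackson integral of the little \<open>q\<close>-Jacobi polynomials, and
  orthogonality to the lower component is orthogonality to all polynomials of smaller degree.\<close>


section \<open>The free algebra\<close>

text \<open>The operators and \<open>hn\<close> are defined through \<open>coords\<close>, a
  definite description, so they say nothing until the ordered monomials are known to be independent.
  The representation supplies this: the values of the X_i stand to the right of S^h, hence act as
  constants under left multiplication. Modulo Q_n - 1 the monomials are dependent, and
  \<open>hn\<close> is not visibly well defined there. What saves it is a raising rule: x_N B_mu is
  a combination of the B_nu with nu = mu + epsilon_k, and the weights of h_n obey the same rule for
  N = n. For N = n - 1 the rule produces the moments 1/(1 - q^{2(i+n-1)}) of a Jackson integral.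
  Constancy in X_1, ..., X_{n-2} comes from e_k: on weight 0 it says that a polynomial is unchanged
  when x_k is scaled by q^{-2}, which is no root of unity. The monomials of the lower component do
  not test against the powers x^t directly but against x^t (x; q^{-2})_{d-1-t} with d = min(l, m);
  these are triangular and so span all polynomials of degree below d. Positivity of the weight at
  the nodes q^{2k} then makes the orthogonal polynomial unique up to a scalar.\<close>

definition wd :: "gen list \<Rightarrow> fa" where
  "wd u = (\<lambda>w. if w = u then 1 else 0)"

definition ffin :: "fa set" where
  "ffin = {f. finite {w. f w \<noteq> 0}}"

lemma fgen_wd: "fgen a = wd [a]" and fone_wd: "fone = wd []"
  and mono_wd: "mono n lam mu = wd (monow n lam mu)"
  by (simp_all add: fgen_def fone_def mono_def wd_def)

lemma fmul_Nil: "fmul f g [] = f [] * g []"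
  by (simp add: fmul_def)

lemma fmul_Cons: "fmul f g (a # w) = f [] * g (a # w) + fmul (\<lambda>u. f (a # u)) g w"
  by (simp add: fmul_def sum.atMost_Suc_shift del: sum.atMost_Suc)

lemma fmul_add_left: "fmul (\<lambda>w. f w + g w) h w = fmul f h w + fmul g h w"
  and fmul_scale_left: "fmul (\<lambda>w. c * f w) h w = c * fmul f h w"
  by (simp_all add: fmul_def distrib_right sum.distrib sum_distrib_left mult.assoc)

lemma fmul_assoc: "fmul (fmul f g) h = fmul f (fmul g h)"
proof
  show "fmul (fmul f g) h w = fmul f (fmul g h) w" for w
    by (induction w arbitrary: f g)
      (simp_all add: fmul_Nil fmul_Cons fmul_add_left fmul_scale_left algebra_simps)
qed

lemma fmul_fsub_left: "fmul (fsub f g) h = fsub (fmul f h) (fmul g h)"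
  and fmul_fsub_right: "fmul h (fsub f g) = fsub (fmul h f) (fmul h g)"
  and fmul_fadd_left: "fmul (fadd f g) h = fadd (fmul f h) (fmul g h)"
  and fmul_fadd_right: "fmul h (fadd f g) = fadd (fmul h f) (fmul h g)"
  and fmul_fsc_left: "fmul (fsc c f) h = fsc c (fmul f h)"
  and fmul_fsc_right: "fmul h (fsc c f) = fsc c (fmul h f)"
  and fmul_fzero_left: "fmul fzero h = fzero"
  and fmul_fzero_right: "fmul h fzero = fzero"
  by (auto simp: fmul_def fsub_def fadd_def fsc_def fzero_def algebra_simps sum.distrib
      sum_subtractf sum_distrib_left)

lemma fmul_sum_left: "fmul (\<lambda>w. \<Sum>i\<in>S. c i * f i w) g = (\<lambda>w. \<Sum>i\<in>S. c i * fmul (f i) g w)"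
  and fmul_sum_right: "fmul g (\<lambda>w. \<Sum>i\<in>S. c i * f i w) = (\<lambda>w. \<Sum>i\<in>S. c i * fmul g (f i) w)"
  by (auto simp: fmul_def sum_distrib_left sum_distrib_right intro: sum.swap[THEN trans]
      intro!: sum.cong simp: algebra_simps)

lemma fmul_wd: "fmul (wd u) (wd v) = wd (u @ v)"
proof
  fix w
  show "fmul (wd u) (wd v) w = wd (u @ v) w"
  proof (induction w arbitrary: u)
    case Nil
    then show ?case by (auto simp: fmul_Nil wd_def)
  next
    case (Cons a w)
    show ?case
    proof (cases u)
      case Nil
      have "fmul (\<lambda>u. 0) (wd v) w = 0" by (simp add: fmul_def)
      then show ?thesis using Nil by (simp add: fmul_Cons wd_def)
    next
      case (Cons b u')
      have "(\<lambda>x. wd u (a # x)) = (\<lambda>x. (if a = b then 1 else 0) * wd u' x)"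
        using Cons by (auto simp: wd_def)
      then have "fmul (wd u) (wd v) (a # w) =
          wd u [] * wd v (a # w) + (if a = b then 1 else 0) * fmul (wd u') (wd v) w"
        by (simp only: fmul_Cons fmul_scale_left)
      then show ?thesis unfolding Cons.IH by (simp add: wd_def Cons)
    qed
  qed
qed

text \<open>The splittings of \<open>w\<close> are exactly the pairs (u, v) with u @ v = w. Summing
  over the product of two finite supports instead turns the product into a finite combination of
  words, the form in which linear extensions are computed.\<close>

lemma fmul_conv_pairs:
  assumes "finite U" "finite V" "{w. f w \<noteq> 0} \<subseteq> U" "{w. g w \<noteq> 0} \<subseteq> V"
  shows "fmul f g w = (\<Sum>(u, v)\<in>U \<times> V. f u * g v * wd (u @ v) w)"
proof -
  define T where "T = (\<lambda>i. (take i w, drop i w)) ` {..length w}"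
  have inj: "inj_on (\<lambda>i. (take i w, drop i w)) {..length w}"
    by (rule inj_onI) (metis Pair_inject atMost_iff length_take min.absorb2)
  have T: "(u, v) \<in> T \<longleftrightarrow> u @ v = w" for u v
    unfolding T_def by (auto simp: image_iff intro!: bexI[of _ "length u"])
  have finT: "finite T" by (simp add: T_def)
  have "fmul f g w = (\<Sum>(u, v)\<in>T. f u * g v)"
    unfolding T_def fmul_def by (subst sum.reindex[OF inj]) simp
  also have "\<dots> = (\<Sum>(u, v)\<in>T. f u * g v * wd (u @ v) w)"
    by (rule sum.cong) (auto simp: T wd_def)
  also have "\<dots> = (\<Sum>(u, v)\<in>T \<union> U \<times> V. f u * g v * wd (u @ v) w)"
    by (rule sum.mono_neutral_left) (auto simp: T wd_def assms finT)
  also have "\<dots> = (\<Sum>(u, v)\<in>U \<times> V. f u * g v * wd (u @ v) w)"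
    using assms by (intro sum.mono_neutral_right) (auto simp: T_def[symmetric] T wd_def finT)
  finally show ?thesis .
qed

lemma wd_ffin: "wd u \<in> ffin"
  by (simp add: ffin_def wd_def)

lemma felem_ffin: "f \<in> felem n \<Longrightarrow> f \<in> ffin"
  by (simp add: felem_def ffin_def)

lemma felem_letters: "f \<in> felem n \<Longrightarrow> f w \<noteq> 0 \<Longrightarrow> set w \<subseteq> letters n"
  by (simp add: felem_def)

lemma felem_wd: "set w \<subseteq> letters n \<Longrightarrow> wd w \<in> felem n"
  by (simp add: felem_def wd_def)

lemma sum_support:
  fixes c :: "'a \<Rightarrow> complex"
  shows "{w. (\<Sum>i\<in>S. c i * f i w) \<noteq> 0} \<subseteq> (\<Union>i\<in>S. {w. f i w \<noteq> 0})"
proof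
  fix w assume "w \<in> {w. (\<Sum>i\<in>S. c i * f i w) \<noteq> 0}"
  then obtain i where "i \<in> S" "c i * f i w \<noteq> 0"
    using sum.not_neutral_contains_not_neutral[of "\<lambda>i. c i * f i w" S] by auto
  then show "w \<in> (\<Union>i\<in>S. {w. f i w \<noteq> 0})" by auto
qed

lemma felem_sum:
  assumes "finite S" "\<And>i. i \<in> S \<Longrightarrow> f i \<in> felem n"
  shows "(\<lambda>w. \<Sum>i\<in>S. c i * f i w) \<in> felem n"
proof -
  have "{w. (\<Sum>i\<in>S. c i * f i w) \<noteq> 0} \<subseteq> (\<Union>i\<in>S. {w. f i w \<noteq> 0})"
    by (rule sum_support)
  moreover have "finite (\<Union>i\<in>S. {w. f i w \<noteq> 0})"
    using assms by (auto simp: felem_def)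
  ultimately have "finite {w. (\<Sum>i\<in>S. c i * f i w) \<noteq> 0}" by (rule finite_subset)
  moreover have "set w \<subseteq> letters n" if "(\<Sum>i\<in>S. c i * f i w) \<noteq> 0" for w
    proof -
    have "w \<in> (\<Union>i\<in>S. {w. f i w \<noteq> 0})" using that sum_support[of c f S] by blast
    then show ?thesis using assms(2) by (auto simp: felem_def)
  qed
  ultimately show ?thesis by (auto simp: felem_def)
qed

lemma felem_fadd:
  assumes "f \<in> felem n" "g \<in> felem n"
  shows "fadd f g \<in> felem n"
proof -
  have "{w. f w + g w \<noteq> 0} \<subseteq> {w. f w \<noteq> 0} \<union> {w. g w \<noteq> 0}" by auto
  moreover have "finite ({w. f w \<noteq> 0} \<union> {w. g w \<noteq> 0})" using assms by (simp add: felem_def)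
  ultimately have "finite {w. f w + g w \<noteq> 0}" by (rule finite_subset)
  moreover have "set w \<subseteq> letters n" if "f w + g w \<noteq> 0" for w
    using assms that by (cases "f w = 0") (auto simp: felem_def)
  ultimately show ?thesis by (auto simp: felem_def fadd_def)
qed

lemma felem_fsc: "f \<in> felem n \<Longrightarrow> fsc c f \<in> felem n"
  by (auto simp: felem_def fsc_def)

lemma fsub_conv: "fsub f g = fadd f (fsc (-1) g)"
  by (simp add: fsub_def fadd_def fsc_def)

lemma felem_fsub: "f \<in> felem n \<Longrightarrow> g \<in> felem n \<Longrightarrow> fsub f g \<in> felem n"
  unfolding fsub_conv by (intro felem_fadd felem_fsc)

lemma felem_fzero: "fzero \<in> felem n"
  by (simp add: felem_def fzero_def)

lemma felem_fone: "fone \<in> felem n"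
  unfolding fone_wd by (simp add: felem_wd)

lemma felem_fmul:
  assumes "f \<in> felem n" "g \<in> felem n"
  shows "fmul f g \<in> felem n"
proof -
  define U V where "U = {w. f w \<noteq> 0}" and "V = {w. g w \<noteq> 0}"
  have "finite U" "finite V" using assms by (auto simp: U_def V_def felem_def)
  then have "fmul f g = (\<lambda>w. \<Sum>p\<in>U \<times> V. (f (fst p) * g (snd p)) * wd (fst p @ snd p) w)"
    by (intro ext, subst fmul_conv_pairs[of U V]) (auto simp: U_def V_def case_prod_beta)
  also have "\<dots> \<in> felem n"
    using assms \<open>finite U\<close> \<open>finite V\<close>
    by (intro felem_sum felem_wd) (auto simp: U_def V_def dest!: felem_letters)
  finally show ?thesis .
qed

lemma felem_fpow: "f \<in> felem n \<Longrightarrow> fpow f k \<in> felem n"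
  by (induction k) (simp_all add: felem_fone felem_fmul)

lemma felem_fgen: "a \<in> letters n \<Longrightarrow> fgen a \<in> felem n"
  unfolding fgen_wd by (simp add: felem_wd)

lemma letters_iff [simp]: "Zg i \<in> letters n \<longleftrightarrow> 1 \<le> i \<and> i \<le> n" "Wg i \<in> letters n \<longleftrightarrow> 1 \<le> i \<and> i \<le> n"
  by (auto simp: letters_def)

lemma Qel_wd: "Qel i = (\<lambda>w. \<Sum>k\<in>{1..i}. 1 * wd [Zg k, Wg k] w)"
  by (simp add: Qel_def fgen_wd fmul_wd)

lemma felem_Qel: "i \<le> n \<Longrightarrow> Qel i \<in> felem n"
  unfolding Qel_wd by (intro felem_sum felem_wd) auto

lemma swapg_swapg [simp]: "swapg (swapg a) = a"
  by (cases a) auto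

lemma rev_swap_inj: "rev (map swapg w) = v \<longleftrightarrow> w = rev (map swapg v)"
  by (metis (no_types) list.map_comp list.map_ident_strong comp_apply rev_map rev_rev_ident swapg_swapg)

lemma felem_fstar:
  assumes "f \<in> felem n"
  shows "fstar f \<in> felem n"
proof -
  have "{w. fstar f w \<noteq> 0} \<subseteq> (\<lambda>w. rev (map swapg w)) ` {w. f w \<noteq> 0}"
  proof
    fix w assume "w \<in> {w. fstar f w \<noteq> 0}"
    moreover have "w = rev (map swapg (rev (map swapg w)))" by (metis rev_swap_inj)
    ultimately show "w \<in> (\<lambda>w. rev (map swapg w)) ` {w. f w \<noteq> 0}"
      by (intro image_eqI[of w _ "rev (map swapg w)"]) (auto simp: fstar_def)
  qed
  then have "finite {w. fstar f w \<noteq> 0}"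
    by (rule finite_subset) (use assms in \<open>simp add: felem_def\<close>)
  moreover have "set w \<subseteq> letters n" if "set (rev (map swapg w)) \<subseteq> letters n" for w
  proof
    fix a assume "a \<in> set w"
    then have "swapg a \<in> letters n" using that by auto
    then show "a \<in> letters n" by (cases a) auto
  qed
  moreover have "f (rev (map swapg w)) \<noteq> 0" if "fstar f w \<noteq> 0" for w
    using that by (simp add: fstar_def)
  ultimately show ?thesis
    using felem_letters[OF assms] unfolding felem_def by blast
qed

lemma fstar_wd: "fstar (wd u) = wd (rev (map swapg u))"
  by (auto simp: fstar_def wd_def rev_swap_inj)

lemma fstar_fmul: "fstar (fmul f g) = fmul (fstar g) (fstar f)"
proof
  fix w
  let ?n = "length w" and ?w = "rev (map swapg w)"
  have "fstar (fmul f g) w = (\<Sum>i\<le>?n. cnj (f (take i ?w)) * cnj (g (drop i ?w)))"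
    by (simp add: fstar_def fmul_def)
  also have "\<dots> = (\<Sum>i\<le>?n. cnj (f (take (?n - i) ?w)) * cnj (g (drop (?n - i) ?w)))"
    by (rule sum.reindex_bij_witness[of _ "\<lambda>i. ?n - i" "\<lambda>i. ?n - i"]) auto
  also have "\<dots> = fmul (fstar g) (fstar f) w"
    unfolding fmul_def fstar_def
    by (rule sum.cong) (auto simp: take_rev drop_rev take_map drop_map)
  finally show "fstar (fmul f g) w = fmul (fstar g) (fstar f) w" .
qed

lemma fstar_lin: "fstar (fadd f g) = fadd (fstar f) (fstar g)"
  "fstar (fsub f g) = fsub (fstar f) (fstar g)"
  "fstar (fsc c f) = fsc (cnj c) (fstar f)" "fstar fzero = fzero"
  by (auto simp: fstar_def fadd_def fsub_def fsc_def fzero_def)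

lemma fstar_sum: "fstar (\<lambda>w. \<Sum>i\<in>S. c i * f i w) = (\<lambda>w. \<Sum>i\<in>S. cnj (c i) * fstar (f i) w)"
  by (auto simp: fstar_def)

section \<open>Linear extension of functions on words\<close>

text \<open>Linear extension of a function on words. A sum over an infinite support would be the
  default 0, so the linearity rules ask for \<open>ffin\<close>.\<close>

definition lc :: "fa \<Rightarrow> (gen list \<Rightarrow> complex) \<Rightarrow> complex" where
  "lc f \<phi> = (\<Sum>w\<in>{w. f w \<noteq> 0}. f w * \<phi> w)"

lemma lc_superset:
  assumes "finite U" "{w. f w \<noteq> 0} \<subseteq> U"
  shows "lc f \<phi> = (\<Sum>w\<in>U. f w * \<phi> w)"
  unfolding lc_def using assms by (intro sum.mono_neutral_left) auto

lemma lc_wd [simp]: "lc (wd u) \<phi> = \<phi> u"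
  by (subst lc_superset[of "{u}"]) (auto simp: wd_def)

lemma lc_fzero [simp]: "lc fzero \<phi> = 0"
  by (simp add: lc_def fzero_def)

lemma lc_fadd:
  assumes "f \<in> ffin" "g \<in> ffin"
  shows "lc (fadd f g) \<phi> = lc f \<phi> + lc g \<phi>"
proof -
  let ?U = "{w. f w \<noteq> 0} \<union> {w. g w \<noteq> 0}"
  have "finite ?U" using assms by (simp add: ffin_def)
  then show ?thesis
    by (subst (1 2 3) lc_superset[of ?U]) (auto simp: fadd_def algebra_simps sum.distrib)
qed

lemma lc_fsc: "lc (fsc c f) \<phi> = c * lc f \<phi>"
  by (cases "c = 0") (auto simp: lc_def fsc_def sum_distrib_left algebra_simps)

lemma lc_fsub:
  assumes "f \<in> ffin" "g \<in> ffin"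
  shows "lc (fsub f g) \<phi> = lc f \<phi> - lc g \<phi>"
proof -
  have "fsc (-1) g \<in> ffin" using assms by (simp add: ffin_def fsc_def)
  then show ?thesis using assms by (simp add: fsub_conv lc_fadd lc_fsc)
qed

lemma lc_scale: "lc f (\<lambda>w. c * \<phi> w) = c * lc f \<phi>"
  by (simp add: lc_def sum_distrib_left algebra_simps)

lemma lc_sum:
  assumes "finite S" "\<And>i. i \<in> S \<Longrightarrow> f i \<in> ffin"
  shows "lc (\<lambda>w. \<Sum>i\<in>S. c i * f i w) \<phi> = (\<Sum>i\<in>S. c i * lc (f i) \<phi>)"
proof -
  let ?U = "\<Union>i\<in>S. {w. f i w \<noteq> 0}"
  have fin: "finite ?U" using assms by (auto simp: ffin_def)
  have sub: "{w. (\<Sum>i\<in>S. c i * f i w) \<noteq> 0} \<subseteq> ?U"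
    by (rule sum_support)
  have "lc (\<lambda>w. \<Sum>i\<in>S. c i * f i w) \<phi> = (\<Sum>w\<in>?U. \<Sum>i\<in>S. c i * f i w * \<phi> w)"
    by (subst lc_superset[OF fin sub]) (simp add: sum_distrib_right)
  also have "\<dots> = (\<Sum>i\<in>S. \<Sum>w\<in>?U. c i * f i w * \<phi> w)" by (rule sum.swap)
  also have "\<dots> = (\<Sum>i\<in>S. c i * lc (f i) \<phi>)"
    by (rule sum.cong, rule refl, subst lc_superset[OF fin])
      (auto simp: sum_distrib_left algebra_simps)
  finally show ?thesis .
qed

lemma lc_fmul:
  assumes "f \<in> ffin" "g \<in> ffin"
  shows "lc (fmul f g) \<phi> = lc f (\<lambda>u. lc g (\<lambda>v. \<phi> (u @ v)))"
proof -
  define U V where "U = {w. f w \<noteq> 0}" and "V = {w. g w \<noteq> 0}"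
  have fin: "finite U" "finite V" using assms by (auto simp: U_def V_def ffin_def)
  then have "fmul f g = (\<lambda>w. \<Sum>p\<in>U \<times> V. (f (fst p) * g (snd p)) * wd (fst p @ snd p) w)"
    by (intro ext, subst fmul_conv_pairs[of U V]) (auto simp: U_def V_def case_prod_beta)
  then have "lc (fmul f g) \<phi> = (\<Sum>p\<in>U \<times> V. (f (fst p) * g (snd p)) * \<phi> (fst p @ snd p))"
    using fin by (simp add: lc_sum wd_ffin)
  also have "\<dots> = lc f (\<lambda>u. lc g (\<lambda>v. \<phi> (u @ v)))"
    by (simp add: lc_def U_def V_def sum.cartesian_product case_prod_beta sum_distrib_left mult.assoc)
  finally show ?thesis .
qed

section \<open>Ideals\<close>

lemma gideal_sum:
  assumes "finite S" "\<And>i. i \<in> S \<Longrightarrow> f i \<in> gideal n R"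
  shows "(\<lambda>w. \<Sum>i\<in>S. c i * f i w) \<in> gideal n R"
  using assms
proof (induction S rule: finite_induct)
  case empty
  then show ?case using gi_zero by (simp add: fzero_def)
next
  case (insert i S)
  then have "fadd (fsc (c i) (f i)) (\<lambda>w. \<Sum>i\<in>S. c i * f i w) \<in> gideal n R"
    by (intro gi_add gi_smult) auto
  then show ?case using insert.hyps by (simp add: fadd_def fsc_def)
qed

lemma gideal_fmul_left: "x \<in> gideal n R \<Longrightarrow> a \<in> felem n \<Longrightarrow> fmul a x \<in> gideal n R"
proof (induction rule: gideal.induct)
  case (gi_gen r a' b)
  then show ?case using gideal.gi_gen[of r R "fmul a a'" n b] by (simp add: fmul_assoc felem_fmul)
qed (simp_all add: fmul_fzero_right fmul_fadd_right fmul_fsc_right gideal.intros)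

lemma gideal_fmul_right: "x \<in> gideal n R \<Longrightarrow> b \<in> felem n \<Longrightarrow> fmul x b \<in> gideal n R"
proof (induction rule: gideal.induct)
  case (gi_gen r a b')
  then show ?case using gideal.gi_gen[of r R a n "fmul b' b"] by (simp add: fmul_assoc felem_fmul)
qed (simp_all add: fmul_fzero_left fmul_fadd_left fmul_fsc_left gideal.intros)

lemma gideal_mono:
  assumes "R \<subseteq> R'" "x \<in> gideal n R"
  shows "x \<in> gideal n R'"
  using assms(2,1) by (induction rule: gideal.induct) (auto intro: gideal.intros)

lemma gideal_subset_felem:
  assumes "R \<subseteq> felem n" "x \<in> gideal n R"
  shows "x \<in> felem n"
  using assms(2,1)
  by (induction rule: gideal.induct) (auto intro: felem_fzero felem_fadd felem_fsc felem_fmul)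

lemma gideal_fstar:
  assumes "\<And>r. r \<in> R \<Longrightarrow> fstar r \<in> R" "x \<in> gideal n R"
  shows "fstar x \<in> gideal n R"
  using assms(2)
proof (induction rule: gideal.induct)
  case (gi_gen r a b)
  then show ?case
    using gideal.gi_gen[of "fstar r" R "fstar b" n "fstar a"] assms(1)
    by (simp add: fstar_fmul fmul_assoc felem_fstar)
qed (simp_all add: fstar_lin gideal.intros)

lemma gideal_trans:
  assumes "fsub x y \<in> gideal n R" "fsub y z \<in> gideal n R"
  shows "fsub x z \<in> gideal n R"
proof -
  have "fadd (fsub x y) (fsub y z) \<in> gideal n R" using assms by (rule gi_add)
  then show ?thesis by (simp add: fadd_def fsub_def)
qed

lemma gideal_sym:
  assumes "fsub x y \<in> gideal n R"
  shows "fsub y x \<in> gideal n R"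
  using gi_smult[OF assms, of "-1"] by (simp add: fsc_def fsub_def)

lemma gideal_refl: "fsub x x \<in> gideal n R"
  using gi_zero by (simp add: fsub_def fzero_def)

lemma rels_intros:
  "1 \<le> i \<Longrightarrow> i < j \<Longrightarrow> j \<le> n \<Longrightarrow>
    fsub (fmul (fgen (Zg i)) (fgen (Zg j))) (fsc (of_real q) (fmul (fgen (Zg j)) (fgen (Zg i)))) \<in> rels n q"
  "1 \<le> i \<Longrightarrow> i < j \<Longrightarrow> j \<le> n \<Longrightarrow>
    fsub (fmul (fgen (Wg j)) (fgen (Wg i))) (fsc (of_real q) (fmul (fgen (Wg i)) (fgen (Wg j)))) \<in> rels n q"
  "1 \<le> i \<Longrightarrow> i \<le> n \<Longrightarrow> 1 \<le> j \<Longrightarrow> j \<le> n \<Longrightarrow> i \<noteq> j \<Longrightarrow>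
    fsub (fmul (fgen (Wg i)) (fgen (Zg j))) (fsc (of_real q) (fmul (fgen (Zg j)) (fgen (Wg i)))) \<in> rels n q"
  "1 \<le> i \<Longrightarrow> i \<le> n \<Longrightarrow>
    fsub (fsub (fmul (fgen (Wg i)) (fgen (Zg i))) (fmul (fgen (Zg i)) (fgen (Wg i))))
      (fsc (of_real (1 - q^2)) (Qel (i - 1))) \<in> rels n q"
  unfolding rels_def by blast+

lemma rels_cases [consumes 1, case_names zz ww wz ww_zz]:
  assumes "r \<in> rels n q"
  obtains
    i j where "1 \<le> i" "i < j" "j \<le> n"
      "r = fsub (fmul (fgen (Zg i)) (fgen (Zg j))) (fsc (of_real q) (fmul (fgen (Zg j)) (fgen (Zg i))))"
  | i j where "1 \<le> i" "i < j" "j \<le> n"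
      "r = fsub (fmul (fgen (Wg j)) (fgen (Wg i))) (fsc (of_real q) (fmul (fgen (Wg i)) (fgen (Wg j))))"
  | i j where "1 \<le> i" "i \<le> n" "1 \<le> j" "j \<le> n" "i \<noteq> j"
      "r = fsub (fmul (fgen (Wg i)) (fgen (Zg j))) (fsc (of_real q) (fmul (fgen (Zg j)) (fgen (Wg i))))"
  | i where "1 \<le> i" "i \<le> n"
      "r = fsub (fsub (fmul (fgen (Wg i)) (fgen (Zg i))) (fmul (fgen (Zg i)) (fgen (Wg i))))
        (fsc (of_real (1 - q^2)) (Qel (i - 1)))"
  using assms unfolding rels_def by blast

lemma rels_felem: "rels n q \<subseteq> felem n"
  unfolding rels_def
  by (auto intro!: felem_fsub felem_fmul felem_fsc felem_fgen felem_Qel)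

lemma Qel_rel_felem: "insert (fsub (Qel n) fone) (rels n q) \<subseteq> felem n"
  using rels_felem by (auto intro!: felem_fsub felem_Qel felem_fone)

lemma Jz_felem: "x \<in> Jz n q \<Longrightarrow> x \<in> felem n"
  unfolding Jz_def by (rule gideal_subset_felem[OF Qel_rel_felem])

lemma Iz_Jz: "x \<in> Iz n q \<Longrightarrow> x \<in> Jz n q"
  unfolding Iz_def Jz_def by (rule gideal_mono[OF subset_insertI])

lemma fstar_Qel: "fstar (Qel i) = Qel i"
  unfolding Qel_wd fstar_sum by (simp add: fstar_wd)

text \<open>The involution permutes the relations: it exchanges the zz and the ww family, sends the
  mixed relation for (i, j) to the one for (j, i), and fixes the diagonal relations and Q_n - 1, all
  because q is real.\<close>

lemma fstar_Jz: "x \<in> Jz n q \<Longrightarrow> fstar x \<in> Jz n q"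
  unfolding Jz_def
proof (rule gideal_fstar)
  fix r assume "r \<in> insert (fsub (Qel n) fone) (rels n q)"
  moreover have "fstar (fsub (Qel n) fone) = fsub (Qel n) fone"
    by (simp add: fstar_lin fstar_Qel fone_wd fstar_wd)
  moreover have "fstar r \<in> rels n q" if "r \<in> rels n q"
    using that
    by (cases rule: rels_cases)
      (use rels_intros[where q = q, unfolded fgen_wd] in
        \<open>force simp: fstar_lin fstar_fmul fgen_wd fstar_wd fstar_Qel\<close>)+
  ultimately show "fstar r \<in> insert (fsub (Qel n) fone) (rels n q)" by auto
qed

section \<open>A representation of the algebra\<close>

text \<open>With S^h the ordered product of the S_i^(h_i), this is up to sign the exponent of q that
  S_i collects while passing the factors of smaller index.\<close>

definition lo :: "nat \<Rightarrow> (nat \<Rightarrow> int) \<Rightarrow> int" where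
  "lo i h = (\<Sum>j\<in>{1..<i}. h j)"

lemma lo_upd: "lo i (h(k := v)) = (if 1 \<le> k \<and> k < i then lo i h + v - h k else lo i h)"
proof (cases "1 \<le> k \<and> k < i")
  case True
  then have "{1..<i} = insert k ({1..<i} - {k})" by auto
  then show ?thesis using True
    unfolding lo_def by (subst (1 2) sum.remove[of _ k]) (auto intro!: sum.cong)
qed (auto simp: lo_def intro!: sum.cong)

locale qsphere =
  fixes n :: nat and q :: real
  assumes q_pos: "0 < q" and q_less_1: "q < 1" and n_ge_2: "2 \<le> n"
begin

text \<open>X_i commutes with S_j for j \<le> i and collects q^2 from each S_j with j > i; moving
  X_i to the right of S^h therefore costs \<open>qp (2 * hi i h)\<close>.\<close>

definition hi :: "nat \<Rightarrow> (nat \<Rightarrow> int) \<Rightarrow> int" where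
  "hi i h = (\<Sum>j\<in>{i<..n}. h j)"

lemma hi_upd: "hi i (h(k := v)) = (if i < k \<and> k \<le> n then hi i h + v - h k else hi i h)"
proof (cases "i < k \<and> k \<le> n")
  case True
  then show ?thesis
    unfolding hi_def by (subst (1 2) sum.remove[of _ k]) (auto intro!: sum.cong)
qed (auto simp: hi_def intro!: sum.cong)

lemma hi_Suc: "1 \<le> i \<Longrightarrow> i \<le> n \<Longrightarrow> hi (i - Suc 0) h = h i + hi i h"
proof -
  assume "1 \<le> i" "i \<le> n"
  then have "{i - 1<..n} = insert i {i<..n}" by auto
  then show ?thesis by (simp add: hi_def)
qed

definition qp :: "int \<Rightarrow> complex" where
  "qp k = of_real q powi k"

lemma qp_nz [simp]: "qp k \<noteq> 0"
  using q_pos by (simp add: qp_def)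

lemma qp_0 [simp]: "qp 0 = 1" and qp_1: "qp 1 = of_real q"
  by (simp_all add: qp_def)

lemma qp_add: "qp (a + b) = qp a * qp b"
  using q_pos by (simp add: qp_def power_int_add)

lemma qp_2: "qp 2 = qp 1 * qp 1"
  using qp_add[of 1 1] by simp

lemma qp_of_nat: "qp (int k) = of_real q ^ k"
  by (simp add: qp_def)

lemma qp_minus: "qp (- a) = inverse (qp a)"
  by (simp add: qp_def power_int_minus)

lemma qp_diff: "qp (a - b) = qp a / qp b"
  using qp_add[of a "- b"] by (simp add: qp_minus divide_inverse)

lemma qp_real: "qp k = complex_of_real (q powi k)"
  by (simp add: qp_def)

text \<open>Powers of q are pairwise distinct. Nonvanishing denominators, the separation of weights
  and the infinitude of scaling orbits all go back to this.\<close>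

lemma qp_eq_1_iff [simp]: "qp k = 1 \<longleftrightarrow> k = 0"
proof
  assume "qp k = 1"
  then have *: "q powi k = 1" unfolding qp_real using of_real_eq_1_iff by blast
  show "k = 0"
  proof (rule ccontr)
    assume "k \<noteq> 0"
    then consider m where "m > 0" "k = int m" | m where "m > 0" "k = - int m"
      by (metis int_cases2 linorder_neq_iff neg_0_less_iff_less of_nat_0_less_iff of_nat_less_0_iff
          zero_less_iff_neq_zero of_nat_0 minus_zero)
    then show False
    proof cases
      case 1
      then have "q ^ m < 1" using q_pos q_less_1 by (simp add: power_less_one_iff)
      then show False using * 1 by simp
    next
      case 2
      then have "q ^ m < 1" using q_pos q_less_1 by (simp add: power_less_one_iff)
      then show False using * 2 by (simp add: power_int_minus)
    qed
  qed
qed simp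

lemma qp_inj [simp]: "qp a = qp b \<longleftrightarrow> a = b"
  using qp_eq_1_iff[of "a - b"] by (simp add: qp_diff)

text \<open>On the span of \<open>S^h f(X)\<close>, where \<open>S_i\<close> are \<open>q\<close>-commuting shifts and \<open>X_i\<close> stands for \<open>Q_i\<close>,
  the generators act as \<open>z_i = S_i\<close> and \<open>w_i = S_i^{-1} (X_i - X_{i-1})\<close>. Left multiplication leaves
  the argument of \<open>f\<close> alone, so the values \<open>x\<close> of the \<open>X_i\<close> can be frozen.\<close>

fun act1 :: "(nat \<Rightarrow> complex) \<Rightarrow> gen \<Rightarrow> ((nat \<Rightarrow> int) \<Rightarrow> complex) \<Rightarrow> (nat \<Rightarrow> int) \<Rightarrow> complex" where
  "act1 x (Zg i) F h = qp (- lo i h) * F (h(i := h i - 1))"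
| "act1 x (Wg i) F h =
    qp (lo i h + 2 * hi i h) * (x i - qp (2 * (h i + 1)) * x (i - 1)) * F (h(i := h i + 1))"

definition act :: "(nat \<Rightarrow> complex) \<Rightarrow> gen list \<Rightarrow> ((nat \<Rightarrow> int) \<Rightarrow> complex) \<Rightarrow> (nat \<Rightarrow> int) \<Rightarrow> complex" where
  "act x w = foldr (act1 x) w"

lemma act_simps [simp]: "act x [] F = F" "act x (a # w) F = act1 x a (act x w F)"
  "act x (u @ v) F = act x u (act x v F)"
  by (simp_all add: act_def)

text \<open>Each generator is a weighted shift, so a word reads \<open>F\<close> at a single point.
  The action of a word therefore commutes with finite linear combinations, which makes
  \<open>aop\<close> multiplicative.\<close>

lemma act_scalar: "\<exists>\<kappa> h'. \<forall>F. act x w F h = \<kappa> * F h'"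
proof (induction w arbitrary: h)
  case Nil
  show ?case by (rule exI[of _ 1]) auto
next
  case (Cons a w)
  obtain \<kappa>1 h1 where 1: "\<forall>F. act1 x a F h = \<kappa>1 * F h1"
    by (cases a) auto
  obtain \<kappa>2 h2 where "\<forall>F. act x w F h1 = \<kappa>2 * F h2" using Cons by blast
  with 1 have "\<forall>F. act x (a # w) F h = (\<kappa>1 * \<kappa>2) * F h2" by simp
  then show ?case by blast
qed

definition aop :: "(nat \<Rightarrow> complex) \<Rightarrow> fa \<Rightarrow> ((nat \<Rightarrow> int) \<Rightarrow> complex) \<Rightarrow> (nat \<Rightarrow> int) \<Rightarrow> complex" where
  "aop x f F h = lc f (\<lambda>w. act x w F h)"

lemma aop_wd [simp]: "aop x (wd w) F h = act x w F h"
  by (simp add: aop_def)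

lemma aop_fadd: "f \<in> ffin \<Longrightarrow> g \<in> ffin \<Longrightarrow> aop x (fadd f g) F h = aop x f F h + aop x g F h"
  and aop_fsub: "f \<in> ffin \<Longrightarrow> g \<in> ffin \<Longrightarrow> aop x (fsub f g) F h = aop x f F h - aop x g F h"
  and aop_fsc: "aop x (fsc c f) F h = c * aop x f F h"
  and aop_fzero [simp]: "aop x fzero F h = 0"
  by (simp_all add: aop_def lc_fadd lc_fsub lc_fsc)

lemma aop_sum: "finite S \<Longrightarrow> (\<And>i. i \<in> S \<Longrightarrow> f i \<in> ffin) \<Longrightarrow>
    aop x (\<lambda>w. \<Sum>i\<in>S. c i * f i w) F h = (\<Sum>i\<in>S. c i * aop x (f i) F h)"
  by (simp add: aop_def lc_sum)

lemma aop_fmul: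
  assumes "f \<in> ffin" "g \<in> ffin"
  shows "aop x (fmul f g) F = aop x f (aop x g F)"
proof
  fix h
  have *: "lc g (\<lambda>v. act x u (act x v F) h) = act x u (aop x g F) h" for u
  proof -
    obtain \<kappa> h' where "\<forall>G. act x u G h = \<kappa> * G h'" using act_scalar by blast
    then show ?thesis by (simp add: lc_scale aop_def)
  qed
  show "aop x (fmul f g) F h = aop x f (aop x g F) h"
    unfolding aop_def[of x "fmul f g"] lc_fmul[OF assms] aop_def[of x f] by (simp add: *)
qed

lemma aop_zero: "aop x f (\<lambda>h. 0) h = 0"
proof -
  have "act x w (\<lambda>h. 0) h = 0" for w using act_scalar[of x w h] by auto
  then show ?thesis by (simp add: aop_def lc_def)
qed

lemma act_Zg_Wg:
  assumes "1 \<le> k" "k \<le> n"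
  shows "act x [Zg k, Wg k] F h = (qp (2 * hi k h) * x k - qp (2 * hi (k - 1) h) * x (k - 1)) * F h"
  using assms by (simp add: lo_upd hi_upd hi_Suc qp_add qp_minus field_simps)

text \<open>z_k w_k acts by a difference of consecutive terms, so the sum telescopes down to x_0 =
  0. In this sense X_i is Q_i.\<close>

lemma aop_Qel:
  assumes "i \<le> n" "x 0 = 0"
  shows "aop x (Qel i) F h = qp (2 * hi i h) * x i * F h"
proof -
  have "aop x (Qel i) F h =
      (\<Sum>k\<in>{1..i}. (qp (2 * hi k h) * x k - qp (2 * hi (k - 1) h) * x (k - 1)) * F h)"
    unfolding Qel_wd using assms
    by (subst aop_sum) (auto simp: wd_ffin act_Zg_Wg simp del: act_simps intro!: sum.cong)
  also have "\<dots> = (\<Sum>k\<in>{1..i}. qp (2 * hi k h) * x k - qp (2 * hi (k - 1) h) * x (k - 1)) * F h"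
    by (simp add: sum_distrib_right)
  also have "(\<Sum>k\<in>{1..i}. qp (2 * hi k h) * x k - qp (2 * hi (k - 1) h) * x (k - 1)) = qp (2 * hi i h) * x i"
    by (induction i) (simp_all add: assms)
  finally show ?thesis .
qed

lemma ffin_intros:
  "fgen a \<in> ffin" "f \<in> ffin \<Longrightarrow> fsc c f \<in> ffin" "f \<in> ffin \<Longrightarrow> g \<in> ffin \<Longrightarrow> fsub f g \<in> ffin"
  "fmul (fgen a) (fgen b) \<in> ffin" "i \<le> n \<Longrightarrow> Qel i \<in> ffin" "fone \<in> ffin"
proof -
  show "f \<in> ffin \<Longrightarrow> fsc c f \<in> ffin" by (auto simp: ffin_def fsc_def intro: finite_subset)
  show "fsub f g \<in> ffin" if "f \<in> ffin" "g \<in> ffin"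
  proof -
    have "{w. fsub f g w \<noteq> 0} \<subseteq> {w. f w \<noteq> 0} \<union> {w. g w \<noteq> 0}" by (auto simp: fsub_def)
    then show ?thesis using that by (auto simp: ffin_def intro: finite_subset)
  qed
  show "Qel i \<in> ffin" if "i \<le> n" using that felem_Qel felem_ffin by blast
qed (simp_all add: fgen_wd fone_wd fmul_wd wd_ffin)

lemma aop_rels:
  assumes "r \<in> rels n q" "x 0 = 0"
  shows "aop x r F h = 0"
  using assms(1)
proof (cases rule: rels_cases)
  case (zz i j)
  then show ?thesis
    by (simp add: aop_fsub aop_fsc ffin_intros)
      (simp add: fgen_wd fmul_wd lo_upd fun_upd_twist[of i j] qp_add qp_diff qp_minus qp_1 field_simps)
next
  case (ww i j)
  show ?thesis
  proof (cases "j - 1 = i")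
    case True
    then show ?thesis using ww
      by (simp add: aop_fsub aop_fsc ffin_intros)
        (simp add: fgen_wd fmul_wd lo_upd hi_upd fun_upd_twist[of i j] qp_add qp_diff qp_minus qp_1[symmetric] qp_2 field_simps)
  next
    case False
    then show ?thesis using ww
      by (simp add: aop_fsub aop_fsc ffin_intros)
        (simp add: fgen_wd fmul_wd lo_upd hi_upd fun_upd_twist[of i j] qp_add qp_diff qp_minus qp_1[symmetric] qp_2 field_simps)
  qed
next
  case (wz i j)
  then show ?thesis
    by (simp add: aop_fsub aop_fsc ffin_intros)
      (simp add: fgen_wd fmul_wd lo_upd hi_upd fun_upd_twist[of i j] qp_add qp_diff qp_minus qp_1[symmetric] qp_2 field_simps)
next
  case (ww_zz i)
  have "act x [Wg i, Zg i] F h - act x [Zg i, Wg i] F h = (1 - qp 2) * (qp (2 * hi (i - 1) h) * x (i - 1) * F h)"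
    using ww_zz by (simp add: lo_upd hi_upd hi_Suc qp_add qp_minus field_simps)
  moreover have "qp 2 = (of_real q)\<^sup>2" using qp_of_nat[of 2] by simp
  ultimately show ?thesis using ww_zz assms
    by (simp add: aop_fsub aop_fsc ffin_intros aop_Qel) (simp add: fgen_wd fmul_wd)
qed

lemma aop_gideal:
  assumes "R \<subseteq> felem n" "\<And>r F h. r \<in> R \<Longrightarrow> aop x r F h = 0" "f \<in> gideal n R"
  shows "aop x f F h = 0"
  using assms(3)
proof (induction arbitrary: h rule: gideal.induct)
  case (gi_gen r a b)
  then have *: "r \<in> felem n" using assms(1) by blast
  then have "aop x (fmul (fmul a r) b) F h = aop x a (aop x r (aop x b F)) h"
    using gi_gen by (simp add: aop_fmul felem_ffin[of _ n] felem_fmul)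
  moreover have "aop x r (aop x b F) = (\<lambda>h. 0)" using assms(2) gi_gen by blast
  ultimately show ?case by (simp add: aop_zero)
next
  case (gi_add f g)
  then show ?case using gideal_subset_felem[OF assms(1)] by (simp add: aop_fadd felem_ffin[of _ n])
qed (simp_all add: aop_fsc)

lemma aop_Iz: "f \<in> Iz n q \<Longrightarrow> x 0 = 0 \<Longrightarrow> aop x f F h = 0"
  unfolding Iz_def by (rule aop_gideal[OF rels_felem]) (auto simp: aop_rels)

text \<open>\<open>hi n h\<close> is an empty sum, so Q_n acts on every weight as the scalar x_n;
  the point x_n = 1 kills the additional generator of the ideal.\<close>

lemma aop_Jz:
  assumes "f \<in> Jz n q" "x 0 = 0" "x n = 1"
  shows "aop x f F h = 0"
  using assms(1) unfolding Jz_def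
proof (rule aop_gideal[OF Qel_rel_felem, rotated])
  fix r F h assume "r \<in> insert (fsub (Qel n) fone) (rels n q)"
  moreover have "aop x (fsub (Qel n) fone) F h = 0"
    using assms by (simp add: aop_fsub ffin_intros aop_Qel) (simp add: fone_wd hi_def)
  ultimately show "aop x r F h = 0" using aop_rels assms(2) by auto
qed

text \<open>The coefficient family of the unit, so that \<open>ev x f h\<close> is the coefficient
  of S^h in \<open>f\<close>, evaluated at X = x.\<close>

definition vac :: "(nat \<Rightarrow> int) \<Rightarrow> complex" where
  "vac h = (if h = (\<lambda>_. 0) then 1 else 0)"

definition ev :: "(nat \<Rightarrow> complex) \<Rightarrow> fa \<Rightarrow> (nat \<Rightarrow> int) \<Rightarrow> complex" where
  "ev x f = aop x f vac"

end

section \<open>Spanning by the ordered monomials\<close>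

definition sorted_exps :: "nat \<Rightarrow> (nat \<Rightarrow> nat) \<Rightarrow> nat list" where
  "sorted_exps n f = concat (map (\<lambda>i. replicate (f i) i) [1..<n+1])"

lemma sorted_exps_Suc: "sorted_exps (Suc n) f = sorted_exps n f @ replicate (f (Suc n)) (Suc n)"
  by (simp add: sorted_exps_def)

lemma set_sorted_exps: "set (sorted_exps n f) \<subseteq> {1..n}"
  by (auto simp: sorted_exps_def)

lemma sorted_sorted_exps: "sorted (sorted_exps n f)"
proof (induction n)
  case (Suc n)
  then show ?case using set_sorted_exps[of n f] by (force simp: sorted_exps_Suc sorted_append)
qed (simp add: sorted_exps_def)

lemma length_sorted_exps: "length (sorted_exps n f) = absl n f"
  by (induction n) (simp_all add: sorted_exps_Suc absl_def, simp add: sorted_exps_def)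

lemma count_sorted_exps: "count (mset (sorted_exps n f)) i = (if 1 \<le> i \<and> i \<le> n then f i else 0)"
  by (induction n) (auto simp: sorted_exps_Suc, auto simp: sorted_exps_def)

lemma sort_eq_sorted_exps:
  assumes "set is \<subseteq> {1..n}"
  shows "sort is = sorted_exps n (count (mset is))"
proof (rule properties_for_sort[OF _ sorted_sorted_exps])
  show "mset (sorted_exps n (count (mset is))) = mset is"
    using assms by (intro multiset_eqI) (auto simp: count_sorted_exps count_eq_zero_iff simp del: count_mset)
qed

lemma monow_conv: "monow n lam mu = map Zg (sorted_exps n lam) @ map Wg (rev (sorted_exps n mu))"
  by (simp add: monow_def sorted_exps_def map_concat rev_concat rev_map comp_def)

lemma count_in_adm: "set is \<subseteq> {1..n} \<Longrightarrow> count (mset is) \<in> adm n"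
  by (force simp: adm_def count_eq_zero_iff simp del: count_mset)

lemma absl_count:
  assumes "set is \<subseteq> {1..n}"
  shows "absl n (count (mset is)) = length is"
  using arg_cong[OF sort_eq_sorted_exps[OF assms], of length] by (simp add: length_sorted_exps)

lemma monow_letters: "set (monow n lam mu) \<subseteq> letters n"
  using set_sorted_exps by (force simp: monow_conv)

lemma felem_mono: "mono n lam mu \<in> felem n"
  unfolding mono_wd by (intro felem_wd monow_letters)

section \<open>Linear combinations of ordered monomials\<close>

lemma lin_superset:
  assumes "finite U" "csupp c \<subseteq> U"
  shows "lin n c = (\<lambda>w. \<Sum>p\<in>U. c p * mono n (fst p) (snd p) w)"
  unfolding lin_def using assms
  by (intro ext sum.mono_neutral_left) (auto simp: csupp_def)

lemma felem_lin: "c \<in> cfams n \<Longrightarrow> lin n c \<in> felem n"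
  unfolding lin_def by (intro felem_sum felem_mono) (simp add: cfams_def)

lemma
  assumes "finite S" "\<And>i. i \<in> S \<Longrightarrow> c i \<in> cfams n"
  shows csupp_sum: "csupp (\<lambda>p. \<Sum>i\<in>S. a i * c i p) \<subseteq> (\<Union>i\<in>S. csupp (c i))"
    and cfams_sum: "(\<lambda>p. \<Sum>i\<in>S. a i * c i p) \<in> cfams n"
    and lin_sum: "lin n (\<lambda>p. \<Sum>i\<in>S. a i * c i p) = (\<lambda>w. \<Sum>i\<in>S. a i * lin n (c i) w)"
proof -
  let ?U = "\<Union>i\<in>S. csupp (c i)"
  have fin: "finite ?U" using assms by (auto simp: cfams_def)
  show sub: "csupp (\<lambda>p. \<Sum>i\<in>S. a i * c i p) \<subseteq> ?U"
    using sum_support[of a c S] by (simp add: csupp_def)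
  show "(\<lambda>p. \<Sum>i\<in>S. a i * c i p) \<in> cfams n"
    using finite_subset[OF sub fin] sub assms(2) unfolding cfams_def by blast
  show "lin n (\<lambda>p. \<Sum>i\<in>S. a i * c i p) = (\<lambda>w. \<Sum>i\<in>S. a i * lin n (c i) w)"
  proof
    fix w
    have "lin n (\<lambda>p. \<Sum>i\<in>S. a i * c i p) w = (\<Sum>p\<in>?U. \<Sum>i\<in>S. a i * c i p * mono n (fst p) (snd p) w)"
      by (simp add: lin_superset[OF fin sub] sum_distrib_right)
    also have "\<dots> = (\<Sum>i\<in>S. \<Sum>p\<in>?U. a i * c i p * mono n (fst p) (snd p) w)" by (rule sum.swap)
    also have "\<dots> = (\<Sum>i\<in>S. a i * lin n (c i) w)"
    proof (rule sum.cong[OF refl])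
      fix i assume "i \<in> S"
      then have "csupp (c i) \<subseteq> ?U" by blast
      then show "(\<Sum>p\<in>?U. a i * c i p * mono n (fst p) (snd p) w) = a i * lin n (c i) w"
        by (simp add: lin_superset[OF fin] sum_distrib_left mult.assoc)
    qed
    finally show "lin n (\<lambda>p. \<Sum>i\<in>S. a i * c i p) w = (\<Sum>i\<in>S. a i * lin n (c i) w)" .
  qed
qed

definition delta :: "(nat \<Rightarrow> nat) \<Rightarrow> (nat \<Rightarrow> nat) \<Rightarrow> cfam" where
  "delta lam mu = (\<lambda>p. if p = (lam, mu) then 1 else 0)"

lemma csupp_delta: "csupp (delta lam mu) = {(lam, mu)}"
  by (auto simp: csupp_def delta_def)

lemma cfams_delta: "lam \<in> adm n \<Longrightarrow> mu \<in> adm n \<Longrightarrow> delta lam mu \<in> cfams n"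
  by (simp add: cfams_def csupp_delta)

lemma lin_delta: "lin n (delta lam mu) = mono n lam mu"
  unfolding lin_def csupp_delta by (simp add: delta_def)

primrec isZ :: "gen \<Rightarrow> bool" where
  "isZ (Zg i) = True"
| "isZ (Wg i) = False"

definition zdeg :: "gen list \<Rightarrow> nat" where "zdeg w = length (filter isZ w)"
definition wdeg :: "gen list \<Rightarrow> nat" where "wdeg w = length (filter (\<lambda>a. \<not> isZ a) w)"

lemma deg_simps [simp]:
  "zdeg [] = 0" "wdeg [] = 0"
  "zdeg (Zg i # w) = Suc (zdeg w)" "wdeg (Zg i # w) = wdeg w"
  "zdeg (Wg i # w) = zdeg w" "wdeg (Wg i # w) = Suc (wdeg w)"
  "zdeg (u @ v) = zdeg u + zdeg v" "wdeg (u @ v) = wdeg u + wdeg v"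
  by (simp_all add: zdeg_def wdeg_def)

context qsphere
begin

text \<open>The congruence is modulo \<open>Iz\<close>, whose relations are bihomogeneous, so a
  predicate on the exponents can carry the bidegree through the rewriting.\<close>

definition spanned :: "((nat \<Rightarrow> nat) \<times> (nat \<Rightarrow> nat) \<Rightarrow> bool) \<Rightarrow> fa \<Rightarrow> bool" where
  "spanned P x \<longleftrightarrow> (\<exists>c\<in>cfams n. (\<forall>p\<in>csupp c. P p) \<and> fsub x (lin n c) \<in> Iz n q)"

abbreviation bideg :: "nat \<Rightarrow> nat \<Rightarrow> (nat \<Rightarrow> nat) \<times> (nat \<Rightarrow> nat) \<Rightarrow> bool" where
  "bideg l m \<equiv> (\<lambda>p. absl n (fst p) = l \<and> absl n (snd p) = m)"

lemma spanned_cong: "fsub x y \<in> Iz n q \<Longrightarrow> spanned P y \<Longrightarrow> spanned P x"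
  unfolding spanned_def Iz_def using gideal_trans by blast

lemma spanned_weaken: "spanned P x \<Longrightarrow> (\<And>p. P p \<Longrightarrow> Q p) \<Longrightarrow> spanned Q x"
  unfolding spanned_def by blast

lemma spanned_sum:
  assumes "finite S" "\<And>i. i \<in> S \<Longrightarrow> spanned P (f i)"
  shows "spanned P (\<lambda>w. \<Sum>i\<in>S. a i * f i w)"
proof -
  have "\<forall>i\<in>S. \<exists>c. c \<in> cfams n \<and> (\<forall>p\<in>csupp c. P p) \<and> fsub (f i) (lin n c) \<in> Iz n q"
    using assms(2) unfolding spanned_def by blast
  then obtain c where c: "\<forall>i\<in>S. c i \<in> cfams n \<and> (\<forall>p\<in>csupp (c i). P p) \<and> fsub (f i) (lin n (c i)) \<in> Iz n q"
    by (rule bchoice[THEN exE])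
  let ?d = "\<lambda>p. \<Sum>i\<in>S. a i * c i p"
  have "(\<lambda>w. \<Sum>i\<in>S. a i * fsub (f i) (lin n (c i)) w) \<in> Iz n q"
    unfolding Iz_def using assms(1) c by (intro gideal_sum) (auto simp: Iz_def)
  moreover have "(\<lambda>w. \<Sum>i\<in>S. a i * fsub (f i) (lin n (c i)) w) =
      fsub (\<lambda>w. \<Sum>i\<in>S. a i * f i w) (lin n ?d)"
    using assms(1) c by (subst lin_sum) (auto simp: fsub_def algebra_simps sum_subtractf)
  moreover have "?d \<in> cfams n" using assms(1) c by (intro cfams_sum) auto
  moreover have "\<forall>p\<in>csupp ?d. P p" using csupp_sum[of S c n a] assms(1) c by blast
  ultimately show ?thesis unfolding spanned_def by auto
qed

lemma spanned_fsc: "spanned P x \<Longrightarrow> spanned P (fsc a x)"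
  using spanned_sum[of "{()}" P "\<lambda>_. x" "\<lambda>_. a"] by (simp add: fsc_def)

lemma spanned_fadd: "spanned P x \<Longrightarrow> spanned P y \<Longrightarrow> spanned P (fadd x y)"
  using spanned_sum[of "UNIV :: bool set" P "\<lambda>b. if b then x else y" "\<lambda>_. 1"]
  by (simp add: fadd_def UNIV_bool add.commute)

lemma spanned_mono:
  assumes "lam \<in> adm n" "mu \<in> adm n" "P (lam, mu)"
  shows "spanned P (mono n lam mu)"
  unfolding spanned_def
  by (rule bexI[of _ "delta lam mu"])
    (simp_all add: assms csupp_delta lin_delta cfams_delta Iz_def gideal_refl)

section \<open>Reordering words modulo the relations\<close>

lemma Iz_context:
  assumes "r \<in> rels n q" "set u \<subseteq> letters n" "set v \<subseteq> letters n"
  shows "fmul (fmul (wd u) r) (wd v) \<in> Iz n q"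
  unfolding Iz_def using assms by (intro gi_gen felem_wd)

text \<open>For spanning it is enough that sorting costs some scalar; leaving it existential avoids
  tracking powers of q through the sort.\<close>

definition prop_words :: "gen list \<Rightarrow> gen list \<Rightarrow> bool" where
  "prop_words u v \<longleftrightarrow> (\<exists>s. fsub (wd u) (fsc s (wd v)) \<in> Iz n q)"

lemma prop_words_refl: "prop_words u u"
  unfolding prop_words_def
  by (rule exI[of _ 1]) (use gi_zero in \<open>simp add: fsub_def fsc_def Iz_def fzero_def\<close>)

lemma prop_words_trans:
  assumes "prop_words u v" "prop_words v w"
  shows "prop_words u w"
proof -
  obtain s t where "fsub (wd u) (fsc s (wd v)) \<in> Iz n q" "fsub (wd v) (fsc t (wd w)) \<in> Iz n q"
    using assms by (auto simp: prop_words_def)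
  then have "fadd (fsub (wd u) (fsc s (wd v))) (fsc s (fsub (wd v) (fsc t (wd w)))) \<in> Iz n q"
    unfolding Iz_def by (intro gi_add gi_smult)
  then have "fsub (wd u) (fsc (s * t) (wd w)) \<in> Iz n q"
    by (simp add: fadd_def fsub_def fsc_def algebra_simps)
  then show ?thesis unfolding prop_words_def by blast
qed

lemma prop_words_context:
  assumes "prop_words u v" "set a \<subseteq> letters n" "set b \<subseteq> letters n"
  shows "prop_words (a @ u @ b) (a @ v @ b)"
proof -
  obtain s where "fsub (wd u) (fsc s (wd v)) \<in> Iz n q"
    using assms by (auto simp: prop_words_def)
  then have "fmul (fmul (wd a) (fsub (wd u) (fsc s (wd v)))) (wd b) \<in> Iz n q"
    unfolding Iz_def using assms by (intro gideal_fmul_left gideal_fmul_right felem_wd)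
  then show ?thesis
    unfolding prop_words_def
    by (auto simp: fmul_fsub_left fmul_fsub_right fmul_fsc_left fmul_fsc_right fmul_wd)
qed

lemma prop_words_spanned: "prop_words u v \<Longrightarrow> spanned P (wd v) \<Longrightarrow> spanned P (wd u)"
  unfolding prop_words_def using spanned_cong spanned_fsc by blast

text \<open>The relations express the sorted product through the unsorted one; division by q turns
  them into the direction that sorting needs. Sorted means increasing for \<open>Zg\<close> and
  decreasing for \<open>Wg\<close>.\<close>

lemma prop_words_swap:
  assumes "1 \<le> i" "i < j" "j \<le> n"
  shows "prop_words [Zg j, Zg i] [Zg i, Zg j]" "prop_words [Wg i, Wg j] [Wg j, Wg i]"
proof -
  have q: "q \<noteq> 0" using q_pos by simp
  have *: "prop_words u v" if "fsub (wd v) (fsc (of_real q) (wd u)) \<in> rels n q" for u v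
  proof -
    have "fsub (wd v) (fsc (of_real q) (wd u)) \<in> Iz n q"
      using Iz_context[OF that, of "[]" "[]"] by (simp add: fmul_fsub_left fmul_fsub_right
          fmul_fsc_left fmul_fsc_right fmul_wd)
    then have "fsc (- 1 / of_real q) (fsub (wd v) (fsc (of_real q) (wd u))) \<in> Iz n q"
      unfolding Iz_def by (rule gi_smult)
    then have "fsub (wd u) (fsc (1 / of_real q) (wd v)) \<in> Iz n q"
      using q by (simp add: fsub_def fsc_def algebra_simps)
    then show ?thesis unfolding prop_words_def by blast
  qed
  show "prop_words [Zg j, Zg i] [Zg i, Zg j]" "prop_words [Wg i, Wg j] [Wg j, Wg i]"
    using rels_intros(1,2)[OF assms, of q] by (auto intro: * simp: fgen_wd fmul_wd)
qed

lemma prop_words_insort_Zg: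
  assumes "1 \<le> i" "i \<le> n" "set js \<subseteq> {1..n}"
  shows "prop_words (map Zg (i # js)) (map Zg (insort i js))"
  using assms(3)
proof (induction js)
  case (Cons j js)
  show ?case
  proof (cases "i \<le> j")
    case False
    have "prop_words ([] @ [Zg i, Zg j] @ map Zg js) ([] @ [Zg j, Zg i] @ map Zg js)"
      using False Cons.prems assms by (intro prop_words_context prop_words_swap) auto
    moreover have "prop_words ([Zg j] @ map Zg (i # js) @ []) ([Zg j] @ map Zg (insort i js) @ [])"
      using Cons by (intro prop_words_context) auto
    ultimately show ?thesis using False by (auto intro: prop_words_trans)
  qed (simp add: prop_words_refl)
qed (simp add: prop_words_refl)

lemma prop_words_insort_Wg:
  assumes "1 \<le> i" "i \<le> n" "set js \<subseteq> {1..n}"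
  shows "prop_words (map Wg (rev js @ [i])) (map Wg (rev (insort i js)))"
  using assms(3)
proof (induction js)
  case (Cons j js)
  show ?case
  proof (cases "i \<le> j")
    case False
    have "prop_words (map Wg (rev js) @ [Wg j, Wg i] @ []) (map Wg (rev js) @ [Wg i, Wg j] @ [])"
      using False Cons.prems assms by (intro prop_words_context prop_words_swap) auto
    moreover have "prop_words ([] @ map Wg (rev js @ [i]) @ [Wg j]) ([] @ map Wg (rev (insort i js)) @ [Wg j])"
      using Cons by (intro prop_words_context) auto
    ultimately show ?thesis using False by (auto intro: prop_words_trans)
  qed (simp add: prop_words_refl)
qed (simp add: prop_words_refl)

lemma prop_words_sort_Zg:
  "set is \<subseteq> {1..n} \<Longrightarrow> prop_words (map Zg is) (map Zg (sort is))"
proof (induction "is")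
  case (Cons i "is")
  have "prop_words ([Zg i] @ map Zg is @ []) ([Zg i] @ map Zg (sort is) @ [])"
    using Cons by (intro prop_words_context) auto
  moreover have "prop_words (map Zg (i # sort is)) (map Zg (insort i (sort is)))"
    using Cons.prems by (intro prop_words_insort_Zg) auto
  ultimately show ?case by (auto intro: prop_words_trans)
qed (simp add: prop_words_refl)

lemma prop_words_sort_Wg:
  "set js \<subseteq> {1..n} \<Longrightarrow> prop_words (map Wg (rev js)) (map Wg (rev (sort js)))"
proof (induction js)
  case (Cons j js)
  have "prop_words ([] @ map Wg (rev js) @ [Wg j]) ([] @ map Wg (rev (sort js)) @ [Wg j])"
    using Cons by (intro prop_words_context) auto
  moreover have "prop_words (map Wg (rev (sort js) @ [j])) (map Wg (rev (insort j (sort js))))"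
    using Cons.prems by (intro prop_words_insort_Wg) auto
  ultimately show ?case by (auto intro: prop_words_trans)
qed (simp add: prop_words_refl)

lemma spanned_ZW:
  assumes "set is \<subseteq> {1..n}" "set js \<subseteq> {1..n}"
  shows "spanned (bideg (length is) (length js)) (wd (map Zg is @ map Wg js))"
proof -
  let ?l = "count (mset is)" and ?m = "count (mset js)"
  have "prop_words ([] @ map Zg is @ map Wg js) ([] @ map Zg (sort is) @ map Wg js)"
    using assms by (intro prop_words_context prop_words_sort_Zg) auto
  moreover have "prop_words (map Zg (sort is) @ map Wg (rev (rev js)) @ [])
      (map Zg (sort is) @ map Wg (rev (sort (rev js))) @ [])"
    using assms by (intro prop_words_context prop_words_sort_Wg) auto
  moreover have "sort (rev js) = sort js"
    by (rule properties_for_sort) auto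
  ultimately have "prop_words (map Zg is @ map Wg js) (map Zg (sort is) @ map Wg (rev (sort js)))"
    by (auto intro: prop_words_trans)
  moreover have "wd (map Zg (sort is) @ map Wg (rev (sort js))) = mono n ?l ?m"
    using assms by (simp add: mono_wd monow_conv sort_eq_sorted_exps)
  moreover have "spanned (bideg (length is) (length js)) (mono n ?l ?m)"
    using assms by (intro spanned_mono count_in_adm) (simp_all add: absl_count del: count_mset)
  ultimately show ?thesis using prop_words_spanned[of "map Zg is @ map Wg js"] by simp
qed

text \<open>One w is pushed to the right through the remaining z's. The relation for w_i z_i creates
  terms z_k w_k with k < i, in which the w is again one place further right; this is why the
  induction leaves both the index \<open>i\<close> and the prefix \<open>ks\<close>
  arbitrary.\<close>

lemma spanned_ZWZW:
  assumes "1 \<le> i" "i \<le> n" "set ks \<subseteq> {1..n}" "set is \<subseteq> {1..n}" "set js \<subseteq> {1..n}"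
  shows "spanned (bideg (length ks + length is) (Suc (length js)))
    (wd (map Zg ks @ Wg i # map Zg is @ map Wg js))"
  using assms
proof (induction "is" arbitrary: i ks)
  case Nil
  then show ?case using spanned_ZW[of ks "i # js"] by simp
next
  case (Cons j "is")
  let ?u = "map Zg ks" and ?v = "map Zg is @ map Wg js"
  let ?P = "bideg (length ks + length (j # is)) (Suc (length js))"
  have *: "spanned ?P (wd (?u @ Zg j # Wg k # ?v))" if "1 \<le> k" "k \<le> n" "1 \<le> j" "j \<le> n" for k j
    using Cons.IH[of k "ks @ [j]"] Cons.prems that by auto
  have j: "1 \<le> j" "j \<le> n" and uv: "set ?u \<subseteq> letters n" "set ?v \<subseteq> letters n"
    using Cons.prems by auto
  show ?case
  proof (cases "i = j")
    case False
    have "fsub (wd (?u @ Wg i # Zg j # ?v)) (fsc (of_real q) (wd (?u @ Zg j # Wg i # ?v))) \<in> Iz n q"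
      using Iz_context[OF rels_intros(3)[OF Cons.prems(1,2) j False] uv]
      by (simp add: fmul_fsub_left fmul_fsub_right fmul_fsc_left fmul_fsc_right fgen_wd fmul_wd)
    then have "spanned ?P (wd (?u @ Wg i # Zg j # ?v))"
      using spanned_cong spanned_fsc *[OF Cons.prems(1,2) j] by blast
    then show ?thesis by simp
  next
    case True
    let ?s = "\<lambda>w. \<Sum>k\<in>{1..i-1}. 1 * wd (?u @ Zg k # Wg k # ?v) w"
    let ?y = "fadd (wd (?u @ Zg i # Wg i # ?v)) (fsc (of_real (1 - q^2)) ?s)"
    have "fsub (fsub (wd (?u @ Wg i # Zg i # ?v)) (wd (?u @ Zg i # Wg i # ?v)))
        (fsc (of_real (1 - q^2)) ?s) \<in> Iz n q"
      using Iz_context[OF rels_intros(4)[OF Cons.prems(1,2)] uv]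
      by (simp add: fmul_fsub_left fmul_fsub_right fmul_fsc_left fmul_fsc_right fgen_wd fmul_wd
          Qel_wd fmul_sum_left fmul_sum_right del: mult_1 mult_1_left)
    then have "fsub (wd (?u @ Wg i # Zg i # ?v)) ?y \<in> Iz n q"
      by (simp add: fsub_def fadd_def algebra_simps)
    moreover have "spanned ?P ?y"
    proof (intro spanned_fadd spanned_fsc spanned_sum)
      show "spanned ?P (wd (?u @ Zg i # Wg i # ?v))" using * Cons.prems(1,2) by blast
      show "spanned ?P (wd (?u @ Zg k # Wg k # ?v))" if "k \<in> {1..i-1}" for k
        using *[of k k] that Cons.prems(1,2) by auto
    qed auto
    ultimately have "spanned ?P (wd (?u @ Wg i # Zg i # ?v))" by (rule spanned_cong)
    then show ?thesis using True by simp
  qed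
qed

lemma spanned_word:
  assumes "set w \<subseteq> letters n"
  shows "spanned (bideg (zdeg w) (wdeg w)) (wd w)"
  using assms
proof (induction w)
  case Nil
  show ?case using spanned_ZW[of "[]" "[]"] by simp
next
  case (Cons a w)
  let ?P = "bideg (zdeg (a # w)) (wdeg (a # w))"
  from Cons obtain c where c: "c \<in> cfams n" "\<forall>p\<in>csupp c. bideg (zdeg w) (wdeg w) p"
    "fsub (wd w) (lin n c) \<in> Iz n q"
    by (auto simp: spanned_def)
  have "fmul (wd [a]) (fsub (wd w) (lin n c)) \<in> Iz n q"
    using c Cons.prems unfolding Iz_def by (intro gideal_fmul_left felem_wd) auto
  then have eq: "fsub (wd (a # w)) (\<lambda>v. \<Sum>p\<in>csupp c. c p * wd (a # monow n (fst p) (snd p)) v) \<in> Iz n q"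
    by (simp add: fmul_fsub_right fmul_wd lin_def mono_wd fmul_sum_right)
  have "spanned ?P (wd (a # monow n (fst p) (snd p)))" if "p \<in> csupp c" for p
  proof -
    have sub: "set (sorted_exps n (fst p)) \<subseteq> {1..n}" "set (rev (sorted_exps n (snd p))) \<subseteq> {1..n}"
      using set_sorted_exps by auto
    show ?thesis
    proof (cases a)
      case (Zg i)
      have "spanned (bideg (Suc (absl n (fst p))) (absl n (snd p)))
          (wd (map Zg (i # sorted_exps n (fst p)) @ map Wg (rev (sorted_exps n (snd p)))))"
        using spanned_ZW[of "i # sorted_exps n (fst p)" "rev (sorted_exps n (snd p))"] sub Cons.prems Zg
        by (auto simp: length_sorted_exps)
      then show ?thesis using c(2) that Zg by (simp add: monow_conv)
    next
      case (Wg i)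
      have "spanned (bideg (absl n (fst p)) (Suc (absl n (snd p))))
          (wd (Wg i # map Zg (sorted_exps n (fst p)) @ map Wg (rev (sorted_exps n (snd p)))))"
        using spanned_ZWZW[of i "[]" "sorted_exps n (fst p)" "rev (sorted_exps n (snd p))"] sub Cons.prems Wg
        by (auto simp: length_sorted_exps)
      then show ?thesis using c(2) that Wg by (simp add: monow_conv)
    qed
  qed
  moreover have "finite (csupp c)" using c(1) by (simp add: cfams_def)
  ultimately have "spanned ?P (\<lambda>v. \<Sum>p\<in>csupp c. c p * wd (a # monow n (fst p) (snd p)) v)"
    by (intro spanned_sum)
  with eq show ?case by (rule spanned_cong)
qed

lemma felem_expand: "f = (\<lambda>w. \<Sum>u\<in>{u. f u \<noteq> 0}. f u * wd u w)" if "f \<in> felem n"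
  using that by (intro ext) (auto simp: wd_def felem_def if_distrib sum.delta' cong: if_cong)

lemma spanned_homogeneous:
  assumes "f \<in> felem n" "\<And>w. f w \<noteq> 0 \<Longrightarrow> zdeg w = l \<and> wdeg w = m"
  shows "spanned (bideg l m) f"
proof -
  have "spanned (bideg l m) (\<lambda>w. \<Sum>u\<in>{u. f u \<noteq> 0}. f u * wd u w)"
  proof (rule spanned_sum)
    show "spanned (bideg l m) (wd u)" if "u \<in> {u. f u \<noteq> 0}" for u
      using spanned_word[OF felem_letters[OF assms(1)], of u] assms(2)[of u] that by simp
  qed (use assms in \<open>simp add: felem_def\<close>)
  then show ?thesis by (subst felem_expand[OF assms(1)])
qed

lemma spanned_felem:
  assumes "f \<in> felem n"
  shows "spanned (\<lambda>_. True) f"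
proof -
  have "spanned (\<lambda>_. True) (\<lambda>w. \<Sum>u\<in>{u. f u \<noteq> 0}. f u * wd u w)"
  proof (rule spanned_sum)
    show "spanned (\<lambda>_. True) (wd u)" if "u \<in> {u. f u \<noteq> 0}" for u
      using spanned_weaken[OF spanned_word[OF felem_letters[OF assms(1)], of u]] that by simp
  qed (use assms in \<open>simp add: felem_def\<close>)
  then show ?thesis by (subst felem_expand[OF assms])
qed

end

definition good0 :: "nat \<Rightarrow> (nat \<Rightarrow> complex) \<Rightarrow> bool" where
  "good0 n x \<longleftrightarrow> x 0 = 0 \<and> (\<forall>i\<in>{1..n}. x i \<noteq> 0)"

definition wt :: "(nat \<Rightarrow> nat) \<Rightarrow> (nat \<Rightarrow> nat) \<Rightarrow> nat \<Rightarrow> int" where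
  "wt lam mu = (\<lambda>i. int (lam i) - int (mu i))"

context qsphere
begin

section \<open>Evaluation of the ordered monomials\<close>

text \<open>The X-part of w_i^k applied to a term in which S_i has exponent \<open>g\<close>. For g
  = 0 it is the i-th factor of B_mu.\<close>

definition wfac :: "(nat \<Rightarrow> complex) \<Rightarrow> nat \<Rightarrow> int \<Rightarrow> nat \<Rightarrow> complex" where
  "wfac x i g k = (\<Prod>r<k. x i - qp (2 * (g - int r)) * x (i - 1))"

lemma act_replicate_Wg:
  "act x (replicate k (Wg i)) F h =
    qp (int k * (lo i h + 2 * hi i h)) * wfac x i (h i + int k) k * F (h(i := h i + int k))"
proof (induction k arbitrary: h)
  case 0
  then show ?case by (simp add: wfac_def)
next
  case (Suc k)
  let ?h = "h(i := h i + 1)"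
  have h: "lo i ?h = lo i h" "hi i ?h = hi i h" "?h i = h i + 1"
    "?h(i := h i + 1 + int k) = h(i := h i + int (Suc k))"
    by (simp_all add: lo_upd hi_upd add.assoc)
  have fac: "wfac x i (h i + int (Suc k)) (Suc k) =
      wfac x i (h i + 1 + int k) k * (x i - qp (2 * (h i + 1)) * x (i - 1))"
    by (simp add: wfac_def add_ac)
  have "act x (replicate (Suc k) (Wg i)) F h =
      qp (lo i h + 2 * hi i h) * (x i - qp (2 * (h i + 1)) * x (i - 1)) * act x (replicate k (Wg i)) F ?h"
    by simp
  also have "\<dots> = qp (int (Suc k) * (lo i h + 2 * hi i h)) *
      wfac x i (h i + int (Suc k)) (Suc k) * F (h(i := h i + int (Suc k)))"
    unfolding Suc.IH h fac by (simp add: qp_add distrib_right)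
  finally show ?case .
qed

lemma act_replicate_Zg:
  "act x (replicate k (Zg i)) F h = qp (- (int k * lo i h)) * F (h(i := h i - int k))"
proof (induction k arbitrary: h)
  case (Suc k)
  let ?h = "h(i := h i - 1)"
  have h: "lo i ?h = lo i h" "?h i = h i - 1" "?h(i := h i - 1 - int k) = h(i := h i - int (Suc k))"
    by (simp_all add: lo_upd algebra_simps)
  have "act x (replicate (Suc k) (Zg i)) F h = qp (- lo i h) * act x (replicate k (Zg i)) F ?h"
    by simp
  also have "\<dots> = qp (- (int (Suc k) * lo i h)) * F (h(i := h i - int (Suc k)))"
    unfolding Suc.IH h by (simp add: qp_minus qp_add distrib_right qp_diff divide_inverse)
  finally show ?case .
qed simp

lemma act_W_part:
  assumes "N \<le> n"
  shows "act x (map Wg (rev (sorted_exps N mu))) F h =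
    (let g = (\<lambda>i. if 0 < i \<and> i \<le> N then h i + int (mu i) else h i) in
      qp (\<Sum>i\<in>{1..N}. int (mu i) * (lo i h + 2 * hi i g)) * (\<Prod>i\<in>{1..N}. wfac x i (g i) (mu i)) * F g)"
  using assms
proof (induction N arbitrary: h)
  case 0
  then show ?case by (simp add: sorted_exps_def Let_def cong: conj_cong)
next
  case (Suc N)
  let ?h = "h(Suc N := h (Suc N) + int (mu (Suc N)))"
  have g: "(\<lambda>i. if 0 < i \<and> i \<le> N then ?h i + int (mu i) else ?h i) =
      (\<lambda>i. if 0 < i \<and> i \<le> Suc N then h i + int (mu i) else h i)" (is "_ = ?g")
    by (auto simp: fun_eq_iff le_Suc_eq)
  have hi: "hi (Suc N) ?g = hi (Suc N) h"
    unfolding hi_def by (rule sum.cong) auto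
  have "(\<Sum>i\<in>{1..N}. int (mu i) * (lo i ?h + 2 * hi i ?g)) = (\<Sum>i\<in>{1..N}. int (mu i) * (lo i h + 2 * hi i ?g))"
    by (rule sum.cong) (auto simp: lo_upd)
  moreover have "act x (map Wg (rev (sorted_exps (Suc N) mu))) F h =
      qp (int (mu (Suc N)) * (lo (Suc N) h + 2 * hi (Suc N) h)) *
      wfac x (Suc N) (h (Suc N) + int (mu (Suc N))) (mu (Suc N)) *
      act x (map Wg (rev (sorted_exps N mu))) F ?h"
    by (simp add: sorted_exps_Suc act_replicate_Wg del: fun_upd_apply)
  ultimately show ?case
    using Suc.prems by (simp add: Suc.IH[unfolded Let_def g] Let_def g hi qp_add mult_ac)
qed

lemma act_Z_part:
  "act x (map Zg (sorted_exps N lam)) F h =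
    (let k = (\<lambda>i. if 0 < i \<and> i \<le> N then h i - int (lam i) else h i) in
      qp (- (\<Sum>i\<in>{1..N}. int (lam i) * lo i k)) * F k)"
proof (induction N arbitrary: F)
  case 0
  then show ?case by (simp add: sorted_exps_def Let_def cong: conj_cong)
next
  case (Suc N)
  let ?k = "\<lambda>i. if 0 < i \<and> i \<le> N then h i - int (lam i) else h i"
  let ?l = "\<lambda>i. if 0 < i \<and> i \<le> Suc N then h i - int (lam i) else h i"
  have k: "?k(Suc N := ?k (Suc N) - int (lam (Suc N))) = ?l"
    by (auto simp: fun_eq_iff)
  have lo: "lo i ?k = lo i ?l" if "i \<le> Suc N" for i
    unfolding lo_def using that by (intro sum.cong) auto
  have "act x (map Zg (sorted_exps (Suc N) lam)) F h =
      qp (- (\<Sum>i\<in>{1..N}. int (lam i) * lo i ?k)) * (qp (- (int (lam (Suc N)) * lo (Suc N) ?k)) * F ?l)"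
    unfolding k[symmetric] by (simp add: sorted_exps_Suc Suc[unfolded Let_def] act_replicate_Zg)
  moreover have "(\<Sum>i\<in>{1..N}. int (lam i) * lo i ?k) = (\<Sum>i\<in>{1..N}. int (lam i) * lo i ?l)"
    by (intro sum.cong) (auto simp: lo)
  ultimately show ?case
    by (simp add: Let_def lo qp_diff qp_minus divide_inverse mult_ac)
qed

lemma act_monow:
  assumes "lam \<in> adm n" "mu \<in> adm n"
  shows "act x (monow n lam mu) F h =
    (let k = (\<lambda>i. h i - int (lam i)); g = (\<lambda>i. k i + int (mu i)) in
      qp (- (\<Sum>i\<in>{1..n}. int (lam i) * lo i k) + (\<Sum>i\<in>{1..n}. int (mu i) * (lo i k + 2 * hi i g))) *
      (\<Prod>i\<in>{1..n}. wfac x i (g i) (mu i)) * F g)"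
proof -
  have *: "(\<lambda>i. if 0 < i \<and> i \<le> n then h i - int (lam i) else h i) = (\<lambda>i. h i - int (lam i))"
    using assms(1) by (auto simp: adm_def fun_eq_iff)
  have **: "(\<lambda>i. if 0 < i \<and> i \<le> n then k i + int (mu i) else k i) = (\<lambda>i. k i + int (mu i))" for k
    using assms(2) by (auto simp: adm_def fun_eq_iff)
  show ?thesis
    unfolding monow_conv act_simps act_Z_part act_W_part[OF order_refl] * ** Let_def
    by (simp add: qp_add mult_ac qp_diff qp_minus divide_inverse)
qed

definition bm :: "(nat \<Rightarrow> nat) \<Rightarrow> (nat \<Rightarrow> complex) \<Rightarrow> complex" where
  "bm mu x = (\<Prod>i\<in>{1..n}. wfac x i 0 (mu i))"

text \<open>The exponent of q left over when z^\<lambda> w^\<mu> with h = \<lambda> - \<mu> is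
  brought to normal order: after the w's the weight is -\<mu>, and the exponents collected by the
  z's and the w's combine to this form.\<close>

definition bil :: "(nat \<Rightarrow> int) \<Rightarrow> (nat \<Rightarrow> nat) \<Rightarrow> int" where
  "bil h m = (\<Sum>i\<in>{1..n}. h i * lo i (\<lambda>j. int (m j)))"

lemma lo_uminus: "lo i (\<lambda>j. - f j) = - lo i f"
  by (simp add: lo_def sum_negf)

lemma ev_mono:
  assumes "lam \<in> adm n" "mu \<in> adm n"
  shows "ev x (mono n lam mu) h = (if h = wt lam mu then qp (bil h mu) * bm mu x else 0)"
proof (cases "h = wt lam mu")
  case True
  have "hi i (\<lambda>_. 0) = 0" for i by (simp add: hi_def)
  then show ?thesis using True
    by (simp add: ev_def mono_wd act_monow[OF assms] Let_def wt_def vac_def bm_def bil_def lo_uminus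
        sum_negf sum_subtractf algebra_simps)
next
  case False
  then have "(\<lambda>i. h i - int (lam i) + int (mu i)) \<noteq> (\<lambda>_. 0)"
    by (auto simp: wt_def fun_eq_iff) (metis add_diff_cancel_left' diff_add_eq diff_diff_eq2 eq_iff_diff_eq_0)
  then show ?thesis using False
    by (simp add: ev_def mono_wd act_monow[OF assms] Let_def vac_def)
qed

lemma ev_lin:
  assumes "c \<in> cfams n"
  shows "ev x (lin n c) h =
    (\<Sum>p\<in>csupp c. c p * (if h = wt (fst p) (snd p) then qp (bil h (snd p)) * bm (snd p) x else 0))"
proof -
  have "ev x (lin n c) h = (\<Sum>p\<in>csupp c. c p * ev x (mono n (fst p) (snd p)) h)"
    using assms unfolding ev_def lin_def by (subst aop_sum) (auto simp: cfams_def mono_wd wd_ffin)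
  also have "\<dots> = (\<Sum>p\<in>csupp c. c p * (if h = wt (fst p) (snd p) then qp (bil h (snd p)) * bm (snd p) x else 0))"
    using assms by (intro sum.cong refl arg_cong2[where f = "(*)"] ev_mono) (auto simp: cfams_def)
  finally show ?thesis .
qed

lemma wfac_scale: "wfac (\<lambda>i. c * x i) i g k = c ^ k * wfac x i g k"
proof -
  have "wfac (\<lambda>i. c * x i) i g k = (\<Prod>r<k. c * (x i - qp (2 * (g - int r)) * x (i - 1)))"
    unfolding wfac_def by (simp add: algebra_simps)
  also have "\<dots> = c ^ k * wfac x i g k" by (subst prod.distrib) (simp add: wfac_def)
  finally show ?thesis .
qed

lemma bm_scale: "bm mu (\<lambda>i. c * x i) = c ^ absl n mu * bm mu x"
  by (simp add: bm_def wfac_scale prod.distrib power_sum absl_def)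

section \<open>Linear independence\<close>

lemma adm_eqI:
  assumes "f \<in> adm n" "g \<in> adm n" "\<And>i. 2 \<le> i \<Longrightarrow> i \<le> n \<Longrightarrow> f i = g i" "absl n f = absl n g"
  shows "f = g"
proof
  fix i
  have "{1..n} = insert 1 {2..n}" using n_ge_2 by auto
  then have "f 1 = g 1" using assms(3,4) by (simp add: absl_def)
  then show "f i = g i" using assms(1,2) assms(3)[of i] unfolding adm_def
    by (cases "i = 0"; cases "i = 1"; cases "i \<le> n") auto
qed

text \<open>At the point \<open>x_i = q^{2(s_{i+1} + ... + s_n)}\<close> the factor belonging to \<open>i \<ge> 2\<close> vanishes as soon
  as \<open>\<mu>_i > s_i\<close>, so the \<open>B_\<mu>\<close> are triangular with respect to these points.\<close>

lemma bm_independent: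
  assumes "finite D" "D \<subseteq> {mu \<in> adm n. absl n mu = N}"
    and zero: "\<And>x. good0 n x \<Longrightarrow> x n = 1 \<Longrightarrow> (\<Sum>mu\<in>D. d mu * bm mu x) = 0"
    and "mu \<in> D"
  shows "d mu = 0"
proof (rule ccontr)
  assume nz: "d mu \<noteq> 0"
  \<comment> \<open>Among the indices with nonzero coefficient take \<open>s\<close> with the least
    sum of entries from 2 on. At its point only indices bounded by \<open>s\<close> in these entries
    survive; minimality makes them equal there, and entry 1 is recovered from the common size
    N.\<close>
  define sz where "sz mu = (\<Sum>i\<in>{2..n}. mu i)" for mu :: "nat \<Rightarrow> nat"
  define D' where "D' = {mu \<in> D. d mu \<noteq> 0}"
  have "D' \<noteq> {}" "finite D'" using nz assms by (auto simp: D'_def)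
  then obtain s where s: "s \<in> D'" and min: "\<And>mu. mu \<in> D' \<Longrightarrow> sz s \<le> sz mu"
    using arg_min_if_finite[of D' sz] by (metis leI)
  define x where "x i = (if i = 0 then 0 else qp (2 * (\<Sum>j\<in>{i<..n}. int (s j))))" for i
  have x: "good0 n x" "x n = 1" using n_ge_2 by (auto simp: good0_def x_def)
  have fac: "wfac x i 0 k = x i ^ k * (\<Prod>r<k. 1 - qp (2 * (int (s i) - int r)))" if "2 \<le> i" "i \<le> n" for i k
  proof -
    have "{i - 1<..n} = insert i {i<..n}" using that by auto
    then have "x (i - 1) = qp (2 * int (s i)) * x i"
      using that by (simp add: x_def qp_add distrib_left)
    then have "wfac x i 0 k = (\<Prod>r<k. x i * (1 - qp (2 * (int (s i) - int r))))"
      unfolding wfac_def by (simp add: right_diff_distrib qp_diff qp_minus field_simps)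
    then show ?thesis by (simp add: prod.distrib)
  qed
  have fac0: "wfac x i 0 k = 0 \<longleftrightarrow> s i < k" if "2 \<le> i" "i \<le> n" for i k
    using x(1) that by (auto simp: fac good0_def)
  have fac1: "wfac x 1 0 k \<noteq> 0" for k using x(1) n_ge_2 by (auto simp: wfac_def good0_def)
  have bm0: "bm mu x = 0 \<longleftrightarrow> (\<exists>i\<in>{2..n}. s i < mu i)" for mu
  proof -
    have "{1..n} = insert 1 {2..n}" using n_ge_2 by auto
    then have "bm mu x = wfac x 1 0 (mu 1) * (\<Prod>i\<in>{2..n}. wfac x i 0 (mu i))"
      by (simp add: bm_def)
    then show ?thesis using fac0 fac1 by auto
  qed
  have other: "d mu * bm mu x = 0" if "mu \<in> D - {s}" for mu
  proof (rule ccontr)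
    assume "d mu * bm mu x \<noteq> 0"
    then have mu: "mu \<in> D'" "\<forall>i\<in>{2..n}. mu i \<le> s i" using that bm0 by (auto simp: D'_def not_less)
    then have "sz mu = sz s"
      using min[of mu] sum_mono[of "{2..n}" mu s] by (simp add: sz_def)
    then have "mu i = s i" if "i \<in> {2..n}" for i
      using mu(2) that by (intro sum_mono_inv[of mu "{2..n}" s]) (auto simp: sz_def)
    moreover have "mu \<in> adm n" "s \<in> adm n" "absl n mu = absl n s"
      using that s assms(2) by (auto simp: D'_def)
    ultimately have "mu = s" by (intro adm_eqI[of mu s]) simp_all
    then show False using that by simp
  qed
  have "0 = (\<Sum>mu\<in>D. d mu * bm mu x)" using zero x by simp
  also have "\<dots> = d s * bm s x + (\<Sum>mu\<in>D - {s}. d mu * bm mu x)"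
    using s assms(1) by (subst sum.remove[of _ s]) (auto simp: D'_def)
  also have "(\<Sum>mu\<in>D - {s}. d mu * bm mu x) = 0" using other by (intro sum.neutral) auto
  finally show False using s bm0[of s] by (auto simp: D'_def)
qed

lemma sum_homogeneous_components:
  fixes f :: "'a \<Rightarrow> complex"
  assumes "finite D" "\<And>t. (\<Sum>i\<in>D. f i * t ^ e i) = 0"
  shows "(\<Sum>i\<in>{i\<in>D. e i = N}. f i) = 0"
proof -
  let ?p = "\<Sum>i\<in>D. monom (f i) (e i)"
  have "poly ?p t = 0" for t using assms(2) by (simp add: poly_sum poly_monom)
  then have "?p = 0" using poly_all_0_iff_0 by blast
  then have "coeff ?p N = 0" by simp
  then show ?thesis using assms(1)
    by (simp add: coeff_sum sum.If_cases Int_def if_distrib cong: if_cong)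
qed

lemma wt_inject:
  assumes "wt lam mu = wt lam' mu"
  shows "lam = lam'"
  using assms by (auto simp: wt_def fun_eq_iff)

text \<open>The weight h separates the differences \<lambda> - \<mu>, and for fixed h the index
  \<mu> determines \<lambda>. Since all B_mu involved have the same degree, restricting to x_n = 1
  loses nothing.\<close>

lemma cfam_eq_0:
  assumes "c \<in> cfams n" "\<And>p. p \<in> csupp c \<Longrightarrow> absl n (snd p) = N"
    and zero: "\<And>x h. good0 n x \<Longrightarrow> x n = 1 \<Longrightarrow> ev x (lin n c) h = 0"
  shows "csupp c = {}"
proof (rule ccontr)
  assume "csupp c \<noteq> {}"
  then obtain p where p: "p \<in> csupp c" by blast
  define h where "h = wt (fst p) (snd p)"
  define S where "S = {p \<in> csupp c. wt (fst p) (snd p) = h}"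
  have S: "finite S" "p \<in> S" using assms(1) p by (auto simp: S_def cfams_def h_def)
  have inj: "inj_on snd S"
    by (rule inj_onI) (use wt_inject in \<open>force simp: S_def\<close>)
  define f where "f = inv_into S snd"
  have f: "f (snd r) = r" if "r \<in> S" for r using that inj by (simp add: f_def)
  have "c (f (snd p)) * qp (bil h (snd p)) = 0"
  proof (rule bm_independent[of "snd ` S" N "\<lambda>mu. c (f mu) * qp (bil h mu)"])
    show "snd ` S \<subseteq> {mu \<in> adm n. absl n mu = N}" using assms(1,2) by (auto simp: S_def cfams_def)
    show "(\<Sum>mu\<in>snd ` S. c (f mu) * qp (bil h mu) * bm mu x) = 0" if "good0 n x" "x n = 1" for x
    proof -
      have "(\<Sum>mu\<in>snd ` S. c (f mu) * qp (bil h mu) * bm mu x) =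
          (\<Sum>p\<in>S. c p * (qp (bil h (snd p)) * bm (snd p) x))"
        by (subst sum.reindex[OF inj]) (simp add: f mult.assoc)
      also have "\<dots> = ev x (lin n c) h"
        unfolding ev_lin[OF assms(1)] S_def using assms(1)
        by (intro sum.mono_neutral_cong_left) (auto simp: cfams_def)
      finally show ?thesis using zero that by simp
    qed
  qed (use S in auto)
  then show False using p S f by (simp add: csupp_def)
qed

text \<open>B_mu is homogeneous of degree |\<mu>|, so scaling the point by t separates the sizes of
  \<mu> as coefficients of a polynomial in t. Here x_n has to be free.\<close>

lemma cfam_eq_0_all:
  assumes "c \<in> cfams n" and zero: "\<And>x h. x 0 = 0 \<Longrightarrow> ev x (lin n c) h = 0"
  shows "csupp c = {}"
proof (rule ccontr)
  assume "csupp c \<noteq> {}"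
  then obtain p where p: "p \<in> csupp c" by blast
  define N where "N = absl n (snd p)"
  define c' where "c' = (\<lambda>p. if absl n (snd p) = N then c p else 0)"
  have supp: "csupp c' = {p \<in> csupp c. absl n (snd p) = N}" by (auto simp: csupp_def c'_def)
  have c': "c' \<in> cfams n" using assms(1) by (auto simp: cfams_def supp)
  have "csupp c' = {}"
  proof (rule cfam_eq_0[OF c'])
    fix x h assume x: "good0 n x" "x n = 1"
    define f where "f p = c p * (if h = wt (fst p) (snd p) then qp (bil h (snd p)) * bm (snd p) x else 0)" for p
    have "(\<Sum>p\<in>csupp c. f p * t ^ absl n (snd p)) = 0" for t
    proof -
      have "(\<Sum>p\<in>csupp c. f p * t ^ absl n (snd p)) = ev (\<lambda>i. t * x i) (lin n c) h"
        unfolding ev_lin[OF assms(1)] by (rule sum.cong) (auto simp: f_def bm_scale)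
      then show ?thesis using zero[of "\<lambda>i. t * x i"] x by (simp add: good0_def)
    qed
    then have "(\<Sum>p\<in>{p \<in> csupp c. absl n (snd p) = N}. f p) = 0"
      using assms(1) by (intro sum_homogeneous_components) (auto simp: cfams_def)
    then show "ev x (lin n c') h = 0"
      unfolding ev_lin[OF c'] supp by (simp add: f_def c'_def)
  qed (auto simp: supp)
  moreover have "p \<in> csupp c'" using p by (simp add: supp N_def)
  ultimately show False by blast
qed

lemma ev_cong_Iz:
  assumes "fsub f g \<in> Iz n q" "f \<in> felem n" "g \<in> felem n" "x 0 = 0"
  shows "aop x f F h = aop x g F h"
  using aop_Iz[of "fsub f g" x F h] assms by (simp add: aop_fsub felem_ffin[of _ n])

lemma ev_cong_Jz:
  assumes "fsub f g \<in> Jz n q" "f \<in> felem n" "g \<in> felem n" "x 0 = 0" "x n = 1"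
  shows "aop x f F h = aop x g F h"
  using aop_Jz[of "fsub f g" x F h] assms by (simp add: aop_fsub felem_ffin[of _ n])

text \<open>The basis theorem for the ordered monomials: a combination in the ideal evaluates to 0
  everywhere.\<close>

lemma cfams_unique:
  assumes "c \<in> cfams n" "d \<in> cfams n" "fsub (lin n c) (lin n d) \<in> Iz n q"
  shows "c = d"
proof -
  \<comment> \<open>The difference is written as a sum over the booleans so that the closure rules
    for finite sums apply.\<close>
  let ?e = "\<lambda>p. \<Sum>b\<in>UNIV. (if b then 1 else -1) * (if b then c else d) p"
  have e: "?e \<in> cfams n" using assms by (intro cfams_sum) auto
  have "lin n ?e = fsub (lin n c) (lin n d)"
    using assms by (subst lin_sum) (auto simp: UNIV_bool fsub_def)
  then have "csupp ?e = {}"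
    using assms(3) by (intro cfam_eq_0_all[OF e]) (simp add: ev_def aop_Iz)
  then show ?thesis by (auto simp: csupp_def UNIV_bool fun_eq_iff)
qed

lemma coords_eq:
  assumes "c \<in> cfams n" "fsub f (lin n c) \<in> Iz n q"
  shows "coords n q f = c"
  unfolding coords_def
proof (rule the_equality)
  fix d assume "d \<in> cfams n \<and> fsub f (lin n d) \<in> Iz n q"
  then show "d = c"
    using assms gideal_trans[OF gideal_sym, of f "lin n d" n "rels n q" "lin n c"]
    by (intro cfams_unique) (simp_all add: Iz_def)
qed (use assms in auto)

lemma coords:
  assumes "f \<in> felem n"
  shows "coords n q f \<in> cfams n" "fsub f (lin n (coords n q f)) \<in> Iz n q"
  using spanned_felem[OF assms] coords_eq unfolding spanned_def by blast+

lemma ev_coords: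
  assumes "f \<in> felem n" "x 0 = 0"
  shows "ev x (lin n (coords n q f)) h = ev x f h"
  unfolding ev_def using coords[OF assms(1)] assms by (intro ev_cong_Iz[symmetric] felem_lin)

section \<open>Characterization of the ideal by evaluation\<close>

definition fhom :: "nat \<Rightarrow> nat \<Rightarrow> fa set" where
  "fhom l m = {f \<in> felem n. \<forall>w. f w \<noteq> 0 \<longrightarrow> zdeg w = l \<and> wdeg w = m}"

lemma fhom_fmul:
  assumes "f \<in> fhom l m" "g \<in> fhom l' m'"
  shows "fmul f g \<in> fhom (l + l') (m + m')"
proof -
  have "zdeg w = l + l' \<and> wdeg w = m + m'" if "fmul f g w \<noteq> 0" for w
  proof -
    have "\<exists>i. f (take i w) * g (drop i w) \<noteq> 0"
    proof (rule ccontr)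
      assume "\<nexists>i. f (take i w) * g (drop i w) \<noteq> 0"
      then have "fmul f g w = 0" unfolding fmul_def by (intro sum.neutral) blast
      then show False using that by simp
    qed
    then obtain i where i: "f (take i w) * g (drop i w) \<noteq> 0" by blast
    have "zdeg w = zdeg (take i w) + zdeg (drop i w)" "wdeg w = wdeg (take i w) + wdeg (drop i w)"
      using deg_simps(7,8)[of "take i w" "drop i w"] by simp_all
    then show ?thesis using assms i by (simp add: fhom_def)
  qed
  then show ?thesis using assms by (auto simp: fhom_def felem_fmul)
qed

lemma fhom_sum:
  assumes "finite S" "\<And>i. i \<in> S \<Longrightarrow> f i \<in> fhom l m"
  shows "(\<lambda>w. \<Sum>i\<in>S. c i * f i w) \<in> fhom l m"
proof -
  have "zdeg w = l \<and> wdeg w = m" if "(\<Sum>i\<in>S. c i * f i w) \<noteq> 0" for w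
    using that sum_support[of c f S] assms(2) unfolding fhom_def by blast
  then show ?thesis using assms by (auto simp: fhom_def felem_sum)
qed

lemma fhom_wd: "set w \<subseteq> letters n \<Longrightarrow> zdeg w = l \<Longrightarrow> wdeg w = m \<Longrightarrow> wd w \<in> fhom l m"
  using felem_wd by (simp add: fhom_def wd_def)

lemma fhom_fpow: "f \<in> fhom l m \<Longrightarrow> fpow f k \<in> fhom (k * l) (k * m)"
proof (induction k)
  case 0
  then show ?case using fhom_wd[of "[]"] by (simp add: fone_wd)
next
  case (Suc k)
  then show ?case using fhom_fmul by simp
qed

lemma fhom_Qel: "i \<le> n \<Longrightarrow> Qel i \<in> fhom 1 1"
  unfolding Qel_wd by (intro fhom_sum fhom_wd) auto

lemma fhom_mono:
  "mono n lam mu \<in> fhom (absl n lam) (absl n mu)"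
proof -
  have Z: "zdeg (map Zg is) = length is" "wdeg (map Zg is) = 0"
    and W: "zdeg (map Wg is) = 0" "wdeg (map Wg is) = length is" for "is"
    by (induction "is") auto
  show ?thesis unfolding mono_wd
    by (rule fhom_wd[OF monow_letters]) (simp_all add: monow_conv Z W length_sorted_exps)
qed

lemma fhom_spanned: "f \<in> fhom l m \<Longrightarrow> spanned (bideg l m) f"
  by (rule spanned_homogeneous) (auto simp: fhom_def)

lemma fhom_felem: "f \<in> fhom l m \<Longrightarrow> f \<in> felem n"
  by (simp add: fhom_def)

lemma fmul_fone: "fmul f fone = f"
proof
  fix w
  show "fmul f fone w = f w"
    by (induction w arbitrary: f) (simp_all add: fmul_Nil fmul_Cons fone_def)
qed

lemma Jz_fpow_Qel:
  assumes "f \<in> felem n"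
  shows "fsub (fmul f (fpow (Qel n) k)) f \<in> Jz n q"
  using assms
proof (induction k arbitrary: f)
  case 0
  then show ?case using gi_zero by (simp add: fmul_fone Jz_def fsub_def fzero_def)
next
  case (Suc k)
  have "fmul (fmul f (fsub (Qel n) fone)) fone \<in> Jz n q"
    unfolding Jz_def using Suc by (intro gi_gen) (auto intro: felem_fone)
  then have "fsub (fmul f (Qel n)) f \<in> Jz n q"
    by (simp add: fmul_fone fmul_fsub_right)
  moreover have "fsub (fmul (fmul f (Qel n)) (fpow (Qel n) k)) (fmul f (Qel n)) \<in> Jz n q"
    using Suc by (intro Suc.IH felem_fmul felem_Qel) auto
  ultimately show ?case
    using gideal_trans unfolding Jz_def by (auto simp: fmul_assoc)
qed

text \<open>For the converse, every ordered monomial is padded with a power of Q_n up to a common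
  w-degree N. This changes nothing modulo Q_n - 1, and the homogeneous case over x_n = 1 then gives
  vanishing already in Z_n.\<close>

lemma Jz_iff:
  assumes "f \<in> felem n"
  shows "f \<in> Jz n q \<longleftrightarrow> (\<forall>x h. good0 n x \<longrightarrow> x n = 1 \<longrightarrow> ev x f h = 0)"
proof (intro iffI allI impI)
  fix x h assume "f \<in> Jz n q" "good0 n x" "x n = 1"
  then show "ev x f h = 0" by (simp add: ev_def aop_Jz good0_def)
next
  assume zero: "\<forall>x h. good0 n x \<longrightarrow> x n = 1 \<longrightarrow> ev x f h = 0"
  define c where "c = coords n q f"
  have c: "c \<in> cfams n" "fsub f (lin n c) \<in> Iz n q" using coords[OF assms] by (auto simp: c_def)
  then have fin: "finite (csupp c)" by (simp add: cfams_def)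
  define N where "N = Max ((\<lambda>p. absl n (snd p)) ` csupp c)"
  have N: "absl n (snd p) \<le> N" if "p \<in> csupp c" for p
    using that fin unfolding N_def by (intro Max_ge) auto
  \<comment> \<open>The padding raises the degree in w to exactly N; N is the maximum, so the
    subtraction does not truncate.\<close>
  define g where "g p = fmul (mono n (fst p) (snd p)) (fpow (Qel n) (N - absl n (snd p)))" for p
  define G where "G = (\<lambda>w. \<Sum>p\<in>csupp c. c p * g p w)"
  have gfe: "g p \<in> felem n" for p
    unfolding g_def by (intro felem_fmul felem_fpow felem_mono felem_Qel) auto
  then have Gfe: "G \<in> felem n" unfolding G_def using fin by (intro felem_sum) auto
  have "(\<lambda>w. \<Sum>p\<in>csupp c. c p * fsub (g p) (mono n (fst p) (snd p)) w) \<in> Jz n q"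
    unfolding Jz_def using fin
  proof (rule gideal_sum)
    show "fsub (g p) (mono n (fst p) (snd p)) \<in> gideal n (insert (fsub (Qel n) fone) (rels n q))" for p
      using Jz_fpow_Qel[OF felem_mono] by (simp add: g_def Jz_def)
  qed
  then have G_lin: "fsub G (lin n c) \<in> Jz n q"
    by (simp add: G_def lin_def fsub_def algebra_simps sum_subtractf)
  have f_G: "fsub f G \<in> Jz n q"
    using Iz_Jz[OF c(2)] gideal_sym[OF G_lin[unfolded Jz_def]] gideal_trans unfolding Jz_def by blast
  have "spanned (\<lambda>p. absl n (snd p) = N) G"
    unfolding G_def using fin
  proof (rule spanned_sum)
    fix p assume p: "p \<in> csupp c"
    have "g p \<in> fhom (absl n (fst p) + (N - absl n (snd p)) * 1) (absl n (snd p) + (N - absl n (snd p)) * 1)"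
      unfolding g_def by (intro fhom_fmul fhom_mono fhom_fpow fhom_Qel order_refl)
    from fhom_spanned[OF this] show "spanned (\<lambda>p. absl n (snd p) = N) (g p)"
      by (rule spanned_weaken) (use N[OF p] in auto)
  qed
  then obtain d where d: "d \<in> cfams n" "\<And>p. p \<in> csupp d \<Longrightarrow> absl n (snd p) = N"
    "fsub G (lin n d) \<in> Iz n q" by (auto simp: spanned_def)
  have "csupp d = {}"
  proof (rule cfam_eq_0[OF d(1,2)])
    fix x h assume x: "good0 n x" "x n = 1"
    have "ev x (lin n d) h = ev x G h"
      unfolding ev_def using d x Gfe by (intro ev_cong_Iz[symmetric] felem_lin) (auto simp: good0_def)
    also have "\<dots> = ev x f h"
      unfolding ev_def using f_G x Gfe assms by (intro ev_cong_Jz[symmetric]) (auto simp: good0_def)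
    finally show "ev x (lin n d) h = 0" using zero x by simp
  qed
  then have "lin n d = fzero" by (simp add: lin_def fzero_def)
  then have "G \<in> Jz n q" using d(3) Iz_Jz by (simp add: fsub_def fzero_def)
  then have "fadd (fsub f G) G \<in> Jz n q" using f_G unfolding Jz_def by (intro gi_add)
  then show "f \<in> Jz n q" by (simp add: fadd_def fsub_def)
qed

section \<open>The operators \<open>e_k\<close> and \<open>f_k\<close> as \<open>q\<close>-difference operators\<close>

definition P :: complex where "P = qp (-2)"

lemma P_nz [simp]: "P \<noteq> 0" and P_ne_1 [simp]: "P \<noteq> 1"
  unfolding P_def using qp_eq_1_iff[of "-2"] by simp_all

lemma P_power: "P ^ k = qp (- (2 * int k))"
  by (induction k) (simp_all add: P_def flip: qp_add)

lemma P_eq: "P = 1 / (of_real q)\<^sup>2"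
  using qp_of_nat[of 2] by (simp add: P_def qp_minus divide_inverse)

definition fac :: "complex \<Rightarrow> complex \<Rightarrow> nat \<Rightarrow> complex" where
  "fac u y a = (\<Prod>r<a. u - P ^ r * y)"

lemma wfac_fac: "wfac x i 0 a = fac (x i) (x (i - 1)) a"
  by (simp add: wfac_def fac_def P_power)

lemma fac_Suc: "fac u y (Suc a) = fac u y a * (u - P ^ a * y)"
  and fac_0 [simp]: "fac u y 0 = 1"
  by (simp_all add: fac_def)

text \<open>Scaling the second argument by P moves the product by one factor; multiplication by v -
  u puts the lost first factor back.\<close>

lemma fac_shift: "(v - u) * fac v (P * u) b = fac v u (Suc b)"
  by (simp add: fac_def prod.lessThan_Suc_shift mult_ac del: prod.lessThan_Suc)

lemma fac_scale: "fac (P * u) y a = P ^ a * fac u (y / P) a"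
proof -
  have "fac (P * u) y a = (\<Prod>r<a. P * (u - P ^ r * (y / P)))"
    unfolding fac_def by (simp add: algebra_simps)
  then show ?thesis by (simp add: prod.distrib fac_def)
qed

lemma fac_shift_up: "fac (P * u) y (Suc a) = P ^ a * (P * u - y) * fac u y a"
proof -
  have "(u - y / P) * fac u y a = fac u (y / P) (Suc a)"
    using fac_shift[of u "y / P" a] by simp
  moreover have "fac (P * u) y (Suc a) = P ^ a * P * fac u (y / P) (Suc a)"
    by (simp add: fac_scale)
  ultimately have "fac (P * u) y (Suc a) = P ^ a * (P * (u - y / P)) * fac u y a"
    by (simp only: mult_ac)
  moreover have "P * (u - y / P) = P * u - y" by (simp add: right_diff_distrib)
  ultimately show ?thesis by (simp only:)
qed

lemma fac_shift_down: "P ^ a * (u - y) * fac (u / P) y a = fac u y (Suc a)"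
proof -
  have "fac u (P * y) a = P ^ a * fac (u / P) y a"
    using fac_scale[of "u / P" "P * y" a] by simp
  then show ?thesis using fac_shift[of u y a] by (simp add: mult_ac)
qed

text \<open>Here u, y, v stand for x_k, x_(k-1), x_(k+1) and a, b for mu_k, mu_(k+1). The left side
  is the w-term of e_k, multiplied by u to clear the denominator of a q-difference quotient in
  u.\<close>

lemma e_identity:
  "u * (if a = 0 then 0 else (1 - P ^ a) * fac u y (a - 1) * fac v u (b + 1)) =
    (v - P ^ b * u) * (fac u y a * fac v u b) - (v - u) * (fac (P * u) y a * fac v (P * u) b)"
proof (cases a)
  case 0
  then show ?thesis using fac_shift[of v u b] by (simp add: fac_Suc mult_ac)
next
  case (Suc a')
  have eq: "(v - u) * (fac (P * u) y a * fac v (P * u) b) = fac (P * u) y a * fac v u (Suc b)"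
    unfolding fac_shift[symmetric] by (simp only: mult_ac)
  show ?thesis unfolding eq unfolding Suc fac_shift_up by (simp add: fac_Suc algebra_simps)
qed

text \<open>Same roles of the variables. Neither term of f_k is a q-difference expression by itself:
  the part of the z-term that does not depend on the weight has to be joined with the w-term, and
  the scaling goes the other way.\<close>

lemma f_identity:
  "u * (fac u y a * fac v u b - (if b = 0 then 0 else (1 - P ^ b) / P * fac u y (a + 1) * fac v u (b - 1))) =
    P ^ a * (y * (fac u y a * fac v u b) + (u - y) * (fac (u / P) y a * fac v (u / P) b))"
proof (cases b)
  case 0
  then show ?thesis using fac_shift_down[of a u y] by (simp add: fac_Suc algebra_simps)
next
  case (Suc b')
  have "fac v (u / P) b = (v - u / P) * fac v u b'"
    using fac_shift[of v "u / P" b'] Suc by simp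
  then have eq: "P ^ a * ((u - y) * (fac (u / P) y a * fac v (u / P) b)) =
      fac u y (Suc a) * ((v - u / P) * fac v u b')"
    unfolding fac_shift_down[symmetric] by (simp only: mult_ac)
  show ?thesis unfolding distrib_left eq unfolding Suc by (simp add: fac_Suc field_simps)
qed

section \<open>The operators on ordered monomials\<close>

definition bm_rest :: "nat \<Rightarrow> (nat \<Rightarrow> nat) \<Rightarrow> (nat \<Rightarrow> complex) \<Rightarrow> complex" where
  "bm_rest k mu x = (\<Prod>i\<in>{1..n} - {k, Suc k}. wfac x i 0 (mu i))"

lemma bm_split:
  assumes "1 \<le> k" "k < n"
  shows "bm mu x = fac (x k) (x (k - 1)) (mu k) * fac (x (Suc k)) (x k) (mu (Suc k)) * bm_rest k mu x"
proof -
  have "{1..n} = insert k (insert (Suc k) ({1..n} - {k, Suc k}))" using assms by auto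
  then have "bm mu x = (\<Prod>i\<in>insert k (insert (Suc k) ({1..n} - {k, Suc k})). wfac x i 0 (mu i))"
    by (simp add: bm_def)
  then show ?thesis by (simp add: bm_rest_def wfac_fac mult.assoc)
qed

lemma bm_rest_upd:
  "bm_rest k (mu(k := a, Suc k := b)) x = bm_rest k mu x"
  "bm_rest k (mu(Suc k := b, k := a)) x = bm_rest k mu x"
  "bm_rest k mu (x(k := u)) = bm_rest k mu x"
  unfolding bm_rest_def by (auto intro!: prod.cong simp: wfac_def)

lemma bil_upd1:
  assumes "1 \<le> k" "k \<le> n"
  shows "bil (h(k := v)) m = bil h m + (v - h k) * lo k (\<lambda>j. int (m j))"
  unfolding bil_def using assms
  by (subst (1 2) sum.remove[of _ k]) (auto simp: algebra_simps intro!: sum.cong)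

lemma bil_upd2:
  assumes "1 \<le> k" "k \<le> n"
  shows "bil h (m(k := v)) = bil h m + (int v - int (m k)) * hi k h"
proof -
  have "(\<lambda>j. int ((m(k := v)) j)) = (\<lambda>j. int (m j))(k := int v)" by auto
  then have "bil h (m(k := v)) =
      (\<Sum>i\<in>{1..n}. h i * lo i (\<lambda>j. int (m j)) + (if k < i then (int v - int (m k)) * h i else 0))"
    unfolding bil_def using assms by (auto simp: lo_upd algebra_simps intro!: sum.cong)
  also have "\<dots> = bil h m + (\<Sum>i\<in>{1..n} \<inter> {i. k < i}. (int v - int (m k)) * h i)"
    by (simp add: sum.distrib bil_def sum.inter_restrict)
  also have "{1..n} \<inter> {i. k < i} = {k<..n}" using assms by auto
  finally show ?thesis unfolding hi_def sum_distrib_left .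
qed

lemma lo_Suc: "1 \<le> k \<Longrightarrow> lo (Suc k) h = lo k h + h k"
  by (simp add: lo_def)

lemma qnum_conv: "complex_of_real (qnum q a) = (1 - P ^ a) / (1 - P)"
  by (simp add: qnum_def P_eq power_one_over)

lemma adm_upd: "f \<in> adm n \<Longrightarrow> 1 \<le> k \<Longrightarrow> k \<le> n \<Longrightarrow> f(k := v) \<in> adm n"
  by (auto simp: adm_def)

lemma ev_fadd: "f \<in> ffin \<Longrightarrow> g \<in> ffin \<Longrightarrow> ev x (fadd f g) h = ev x f h + ev x g h"
  and ev_fsc: "ev x (fsc c f) h = c * ev x f h"
  and ev_fzero: "ev x fzero h = 0"
  by (simp_all add: ev_def aop_fadd aop_fsc)

lemma e_b_felem: "e_b n q k lam mu \<in> felem n"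
  and f_b_felem: "f_b n q k lam mu \<in> felem n"
  and qeps_b_felem: "qeps_b n q k lam mu \<in> felem n"
  unfolding e_b_def f_b_def qeps_b_def
  by (auto intro!: felem_fadd felem_fsc felem_mono felem_fzero)

lemma ev_fadd_if:
  "ev x (fadd (if A then fsc a (mono n l1 m1) else fzero) (if B then fsc b (mono n l2 m2) else fzero)) h =
    (if A then a * ev x (mono n l1 m1) h else 0) + (if B then b * ev x (mono n l2 m2) h else 0)"
  by (subst ev_fadd) (auto simp: ev_fsc ev_fzero felem_ffin[of _ n] felem_fsc felem_mono felem_fzero)

text \<open>Read at the shifted weight h' = h + \<epsilon>_k - \<epsilon>_(k+1), both terms of e_k
  have a multiple of the same power of S. The factor (1 - P) x_k clears the q-number and the
  difference quotient. For h_(k+1) = 0 the right side is a multiple of (x_k - x_(k+1)) times the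
  difference of the values at x_k and P x_k.\<close>

lemma ev_e_b:
  assumes k: "1 \<le> k" "k < n" and adm: "lam \<in> adm n" "mu \<in> adm n"
    and h: "h = h'(k := h' k - 1, Suc k := h' (Suc k) + 1)"
  shows "(1 - P) * x k * ev x (e_b n q k lam mu) h' =
    qp (h k) * (x k - qp (- 2 * h (Suc k)) * x (Suc k)) * ev x (mono n lam mu) h +
    qp (h k) * qp (- 2 * h (Suc k)) * (x (Suc k) - x k) * ev (x(k := P * x k)) (mono n lam mu) h"
proof -
  let ?m = "mu(k := mu k - 1, Suc k := mu (Suc k) + 1)"
  let ?l = "lam(k := lam k + 1, Suc k := lam (Suc k) - 1)"
  have adm': "?m \<in> adm n" "?l \<in> adm n" using k adm by (auto intro!: adm_upd)
  have h': "h' = h(k := h k + 1, Suc k := h (Suc k) - 1)" using h by auto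
  have w1: "h' = wt lam ?m \<longleftrightarrow> h = wt lam mu" if "1 \<le> mu k"
    using that unfolding h' wt_def by (auto simp: fun_eq_iff)
  have w2: "h' = wt ?l mu \<longleftrightarrow> h = wt lam mu" if "1 \<le> lam (Suc k)"
    using that unfolding h' wt_def by (auto simp: fun_eq_iff)
  define m' l' where "m' = ?m" and "l' = ?l"
  have op: "e_b n q k lam mu = fadd
      (if 1 \<le> mu k then fsc (complex_of_real (- (1 / q) * q powi (int (mu (Suc k)) + int (lam k) - int (lam (Suc k))) * qnum q (mu k)))
        (mono n lam m') else fzero)
      (if 1 \<le> lam (Suc k) then fsc (complex_of_real (q ^ (lam k) * qnum q (lam (Suc k)))) (mono n l' mu) else fzero)"
    by (simp add: e_b_def m'_def l'_def)
  have m0: "ev y (mono n lam mu) h = (if h = wt lam mu then qp (bil h mu) * bm mu y else 0)" for y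
    by (rule ev_mono[OF adm])
  have m1: "ev x (mono n lam m') h' = (if h = wt lam mu then qp (bil h' m') * bm m' x else 0)"
    if "1 \<le> mu k" unfolding m'_def ev_mono[OF adm(1) adm'(1)] w1[OF that] ..
  have m2: "ev x (mono n l' mu) h' = (if h = wt lam mu then qp (bil h' mu) * bm mu x else 0)"
    if "1 \<le> lam (Suc k)" unfolding l'_def ev_mono[OF adm'(2) adm(2)] w2[OF that] ..
  show ?thesis
  proof (cases "h = wt lam mu")
    case False
    then show ?thesis
      unfolding op ev_fadd_if
      by (simp add: m0 m1 m2)
  next
    case True
    then have hk: "h k = int (lam k) - int (mu k)" "h (Suc k) = int (lam (Suc k)) - int (mu (Suc k))"
      by (simp_all add: wt_def)
    have kk: "k - Suc 0 \<noteq> k" using k by simp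
    let ?y = "x (k - 1)" and ?u = "x k" and ?v = "x (Suc k)"
    let ?a = "mu k" and ?b = "mu (Suc k)" and ?H = "qp (- 2 * h (Suc k))"
    let ?T = "qp (h k) * qp (bil h mu) * bm_rest k mu x"
    have b1: "bil h' mu = bil h mu - int ?a"
      unfolding h' using k by (simp add: bil_upd1 lo_Suc algebra_simps)
    have b2: "bil h' m' = bil h' mu + 1 - h (Suc k)" if "1 \<le> ?a"
      unfolding m'_def using k that by (simp add: bil_upd2 hi_Suc[of "Suc k", simplified] algebra_simps h' of_nat_diff)
    have t1: "(if 1 \<le> ?a then complex_of_real (- (1 / q) * q powi (int ?b + int (lam k) - int (lam (Suc k))) * qnum q ?a) *
        ev x (mono n lam m') h' else 0) * (1 - P) =
      - ?T * ?H * (if ?a = 0 then 0 else (1 - P ^ ?a) * fac ?u ?y (?a - 1) * fac ?v ?u (?b + 1))"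
    proof (cases "1 \<le> ?a")
      case a: True
      have e: "qp (- 1) * qp (int ?b + int (lam k) - int (lam (Suc k))) * qp (bil h' m') =
          qp (h k) * qp (bil h mu) * ?H"
        unfolding qp_add[symmetric] b1 b2[OF a] hk by (rule arg_cong[of _ _ qp]) simp
      have bm: "bm m' x = fac ?u ?y (?a - 1) * fac ?v ?u (?b + 1) * bm_rest k mu x"
        unfolding m'_def using k by (simp add: bm_split[of k] bm_rest_upd)
      have coef: "complex_of_real (- (1 / q) * q powi z * r) = - (qp (- 1) * qp z) * of_real r" for z r
        by (simp add: qp_minus qp_1 divide_inverse) (simp add: qp_def)
      have qn: "complex_of_real (qnum q ?a) * (1 - P) = 1 - P ^ ?a" by (simp add: qnum_conv)
      have "complex_of_real (- (1 / q) * q powi (int ?b + int (lam k) - int (lam (Suc k))) * qnum q ?a) *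
          ev x (mono n lam m') h' * (1 - P) =
          - (qp (- 1) * qp (int ?b + int (lam k) - int (lam (Suc k))) * qp (bil h' m')) * (1 - P ^ ?a) * bm m' x"
        unfolding coef m1[OF a] if_P[OF True] qn[symmetric] by (simp add: mult_ac)
      then show ?thesis using a unfolding e bm by simp
    qed simp
    have t2: "(if 1 \<le> lam (Suc k) then complex_of_real (q ^ (lam k) * qnum q (lam (Suc k))) *
        ev x (mono n l' mu) h' else 0) * (1 - P) = ?T * (1 - P ^ ?b * ?H) * (fac ?u ?y ?a * fac ?v ?u ?b)"
    proof -
      have e: "qp (int (lam k)) * qp (bil h' mu) = qp (h k) * qp (bil h mu)"
        unfolding qp_add[symmetric] b1 hk by (rule arg_cong[of _ _ qp]) simp
      \<comment> \<open>This lets \<lambda> enter through the weight only, so that the formula is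
        uniform in the monomial. If the exponent is 0, it makes 1 - P^0 = 0 match the omitted
        term.\<close>
      have PH: "P ^ lam (Suc k) = P ^ ?b * ?H"
        unfolding P_power hk qp_add[symmetric] by (rule arg_cong[of _ _ qp]) simp
      show ?thesis
      proof (cases "1 \<le> lam (Suc k)")
        case l: True
        then have "complex_of_real (q ^ (lam k) * qnum q (lam (Suc k))) * ev x (mono n l' mu) h' * (1 - P) =
            (qp (int (lam k)) * qp (bil h' mu)) * (1 - P ^ lam (Suc k)) * bm mu x"
          by (simp add: m2 True qnum_conv qp_of_nat)
        then show ?thesis using l k unfolding e by (simp add: PH bm_split[of k])
      next
        case False
        then have "lam (Suc k) = 0" by simp
        then show ?thesis using PH by simp
      qed
    qed
    have "(1 - P) * ?u * ev x (e_b n q k lam mu) h' =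
      ?u * (- ?T * ?H * (if ?a = 0 then 0 else (1 - P ^ ?a) * fac ?u ?y (?a - 1) * fac ?v ?u (?b + 1))
       + ?T * (1 - P ^ ?b * ?H) * (fac ?u ?y ?a * fac ?v ?u ?b))"
      unfolding t1[symmetric] t2[symmetric] op ev_fadd_if
      by (simp add: algebra_simps)
    also have "\<dots> = ?T * (- ?H * (?u * (if ?a = 0 then 0 else (1 - P ^ ?a) * fac ?u ?y (?a - 1) * fac ?v ?u (?b + 1)))
       + ?u * (1 - P ^ ?b * ?H) * (fac ?u ?y ?a * fac ?v ?u ?b))"
      by (simp add: algebra_simps)
    also have "\<dots> = ?T * ((?u - ?H * ?v) * (fac ?u ?y ?a * fac ?v ?u ?b) +
        ?H * (?v - ?u) * (fac (P * ?u) ?y ?a * fac ?v (P * ?u) ?b))"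
      unfolding e_identity by (simp add: algebra_simps)
    also have "\<dots> = qp (h k) * (x k - ?H * ?v) * ev x (mono n lam mu) h +
        qp (h k) * ?H * (?v - ?u) * ev (x(k := P * x k)) (mono n lam mu) h"
      unfolding m0 if_P[OF True] using k kk by (simp add: bm_split[of k] bm_rest_upd algebra_simps)
    finally show ?thesis .
  qed
qed

text \<open>The mirror image for f_k: the weight moves in the opposite direction, x_k is divided by
  P, and x_(k-1) takes over the role of x_(k+1).\<close>

lemma ev_f_b:
  assumes k: "1 \<le> k" "k < n" and adm: "lam \<in> adm n" "mu \<in> adm n"
    and h: "h = h'(k := h' k + 1, Suc k := h' (Suc k) - 1)"
  shows "(1 - P) * x k * ev x (f_b n q k lam mu) h' =
    qp (h (Suc k)) * (x (k - 1) - qp (- 2 * h k) * x k) * ev x (mono n lam mu) h +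
    qp (h (Suc k)) * (x k - x (k - 1)) * ev (x(k := x k / P)) (mono n lam mu) h"
proof -
  let ?m = "mu(Suc k := mu (Suc k) - 1, k := mu k + 1)"
  let ?l = "lam(k := lam k - 1, Suc k := lam (Suc k) + 1)"
  have adm': "?m \<in> adm n" "?l \<in> adm n" using k adm by (auto intro!: adm_upd)
  have h': "h' = h(k := h k - 1, Suc k := h (Suc k) + 1)" using h by auto
  have w1: "h' = wt lam ?m \<longleftrightarrow> h = wt lam mu" if "1 \<le> mu (Suc k)"
    using that unfolding h' wt_def by (auto simp: fun_eq_iff)
  have w2: "h' = wt ?l mu \<longleftrightarrow> h = wt lam mu" if "1 \<le> lam k"
    using that unfolding h' wt_def by (auto simp: fun_eq_iff)
  define m' l' where "m' = ?m" and "l' = ?l"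
  have op: "f_b n q k lam mu = fadd
      (if 1 \<le> mu (Suc k) then fsc (complex_of_real (- (q ^ (mu k + 1)) * qnum q (mu (Suc k)))) (mono n lam m') else fzero)
      (if 1 \<le> lam k then fsc (complex_of_real (q powi (int (lam (Suc k)) + int (mu k) - int (mu (Suc k))) * qnum q (lam k)))
        (mono n l' mu) else fzero)"
    by (simp add: f_b_def m'_def l'_def)
  have m0: "ev y (mono n lam mu) h = (if h = wt lam mu then qp (bil h mu) * bm mu y else 0)" for y
    by (rule ev_mono[OF adm])
  have m1: "ev x (mono n lam m') h' = (if h = wt lam mu then qp (bil h' m') * bm m' x else 0)"
    if "1 \<le> mu (Suc k)" unfolding m'_def ev_mono[OF adm(1) adm'(1)] w1[OF that] ..
  have m2: "ev x (mono n l' mu) h' = (if h = wt lam mu then qp (bil h' mu) * bm mu x else 0)"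
    if "1 \<le> lam k" unfolding l'_def ev_mono[OF adm'(2) adm(2)] w2[OF that] ..
  show ?thesis
  proof (cases "h = wt lam mu")
    case False
    then show ?thesis
      unfolding op ev_fadd_if
      by (simp add: m0 m1 m2)
  next
    case True
    then have hk: "h k = int (lam k) - int (mu k)" "h (Suc k) = int (lam (Suc k)) - int (mu (Suc k))"
      by (simp_all add: wt_def)
    have kk: "k - Suc 0 \<noteq> k" using k by simp
    let ?y = "x (k - 1)" and ?u = "x k" and ?v = "x (Suc k)"
    let ?a = "mu k" and ?b = "mu (Suc k)" and ?H = "qp (- 2 * h k)"
    let ?T = "qp (h (Suc k)) * qp (bil h mu) * bm_rest k mu x"
    have b1: "bil h' mu = bil h mu + int ?a"
      unfolding h' using k by (simp add: bil_upd1 lo_Suc algebra_simps)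
    have b2: "bil h' m' = bil h' mu + 1 + h (Suc k)" if "1 \<le> ?b"
      unfolding m'_def using k that by (simp add: bil_upd2 hi_Suc[of "Suc k", simplified] algebra_simps h' of_nat_diff)
    have Pa: "1 / P ^ ?a = qp (2 * int ?a)" "1 / P = qp 2"
      by (simp add: P_power qp_minus divide_inverse, simp add: P_def qp_minus divide_inverse)
    have t1: "(if 1 \<le> ?b then complex_of_real (- (q ^ (?a + 1)) * qnum q ?b) *
        ev x (mono n lam m') h' else 0) * (1 - P) =
      - ?T / P ^ ?a * (if ?b = 0 then 0 else (1 - P ^ ?b) / P * fac ?u ?y (?a + 1) * fac ?v ?u (?b - 1))"
    proof (cases "1 \<le> ?b")
      case b: True
      have e: "qp (int (?a + 1)) * qp (bil h' m') = qp (h (Suc k)) * qp (bil h mu) * (1 / P ^ ?a) * (1 / P)"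
        unfolding qp_add[symmetric] b1 b2[OF b] hk Pa by (rule arg_cong[of _ _ qp]) simp
      have bm: "bm m' x = fac ?u ?y (?a + 1) * fac ?v ?u (?b - 1) * bm_rest k mu x"
        unfolding m'_def using k by (simp add: bm_split[of k] bm_rest_upd)
      have coef: "complex_of_real (- (q ^ k) * r) = - (of_real q ^ k) * of_real r" for k r
        by simp
      have qn: "complex_of_real (qnum q ?b) * (1 - P) = 1 - P ^ ?b" by (simp add: qnum_conv)
      have "complex_of_real (- (q ^ (?a + 1)) * qnum q ?b) * ev x (mono n lam m') h' * (1 - P) =
          - (qp (int (?a + 1)) * qp (bil h' m')) * (1 - P ^ ?b) * bm m' x"
        unfolding coef m1[OF b] if_P[OF True] qn[symmetric] qp_of_nat by (simp add: mult_ac)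
      then show ?thesis using b unfolding e bm by simp
    qed simp
    have t2: "(if 1 \<le> lam k then complex_of_real (q powi (int (lam (Suc k)) + int ?a - int ?b) * qnum q (lam k)) *
        ev x (mono n l' mu) h' else 0) * (1 - P) = ?T / P ^ ?a * (1 - P ^ ?a * ?H) * (fac ?u ?y ?a * fac ?v ?u ?b)"
    proof -
      have e: "qp (int (lam (Suc k)) + int ?a - int ?b) * qp (bil h' mu) =
          qp (h (Suc k)) * qp (bil h mu) * (1 / P ^ ?a)"
        unfolding qp_add[symmetric] b1 hk Pa by (rule arg_cong[of _ _ qp]) simp
      have PH: "P ^ lam k = P ^ ?a * ?H"
        unfolding P_power hk qp_add[symmetric] by (rule arg_cong[of _ _ qp]) simp
      show ?thesis
      proof (cases "1 \<le> lam k")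
        case l: True
        then have "complex_of_real (q powi (int (lam (Suc k)) + int ?a - int ?b) * qnum q (lam k)) *
            ev x (mono n l' mu) h' * (1 - P) =
            (qp (int (lam (Suc k)) + int ?a - int ?b) * qp (bil h' mu)) * (1 - P ^ lam k) * bm mu x"
          by (simp add: m2 True qnum_conv qp_def)
        then show ?thesis using l k unfolding e by (simp add: PH bm_split[of k])
      next
        case False
        then have "lam k = 0" by simp
        then show ?thesis using PH by simp
      qed
    qed
    have "(1 - P) * ?u * ev x (f_b n q k lam mu) h' =
      ?u * (- ?T / P ^ ?a * (if ?b = 0 then 0 else (1 - P ^ ?b) / P * fac ?u ?y (?a + 1) * fac ?v ?u (?b - 1))
       + ?T / P ^ ?a * (1 - P ^ ?a * ?H) * (fac ?u ?y ?a * fac ?v ?u ?b))"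
      unfolding t1[symmetric] t2[symmetric] op ev_fadd_if
      by (simp add: algebra_simps)
    \<comment> \<open>The part of the z-term carrying the weight is split off; the rest is the left
      side of \<open>f_identity\<close>.\<close>
    also have "\<dots> = ?T / P ^ ?a * (?u * (fac ?u ?y ?a * fac ?v ?u ?b -
        (if ?b = 0 then 0 else (1 - P ^ ?b) / P * fac ?u ?y (?a + 1) * fac ?v ?u (?b - 1))))
       - ?T * ?u * ?H * (fac ?u ?y ?a * fac ?v ?u ?b)"
      by (simp add: field_simps)
    also have "\<dots> = ?T * ((?y - ?H * ?u) * (fac ?u ?y ?a * fac ?v ?u ?b) +
        (?u - ?y) * (fac (?u / P) ?y ?a * fac ?v (?u / P) ?b))"
      unfolding f_identity by (simp add: algebra_simps)
    also have "\<dots> = qp (h (Suc k)) * (?y - ?H * ?u) * ev x (mono n lam mu) h +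
        qp (h (Suc k)) * (?u - ?y) * ev (x(k := x k / P)) (mono n lam mu) h"
      unfolding m0 if_P[OF True] using k kk by (simp add: bm_split[of k] bm_rest_upd algebra_simps)
    finally show ?thesis .
  qed
qed

section \<open>The operators on arbitrary elements\<close>

lemma felem_opapp:
  assumes "\<And>lam mu. T lam mu \<in> felem n" "f \<in> felem n"
  shows "opapp n q T f \<in> felem n"
  unfolding opapp_def using coords(1)[OF assms(2)] assms(1) by (intro felem_sum) (auto simp: cfams_def)

text \<open>A formula known on ordered monomials extends linearly along \<open>coords\<close>. The
  second point x' accommodates the scaled argument of a q-difference operator.\<close>

lemma ev_opapp:
  assumes T: "\<And>lam mu. T lam mu \<in> felem n" and f: "f \<in> felem n" and x: "x 0 = 0" "x' 0 = 0"
    and rec: "\<And>lam mu. lam \<in> adm n \<Longrightarrow> mu \<in> adm n \<Longrightarrow>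
      \<alpha> * ev x (T lam mu) h' = \<beta> * ev x (mono n lam mu) h + \<gamma> * ev x' (mono n lam mu) h"
  shows "\<alpha> * ev x (opapp n q T f) h' = \<beta> * ev x f h + \<gamma> * ev x' f h"
proof -
  define c where "c = coords n q f"
  have c: "c \<in> cfams n" "finite (csupp c)" using coords[OF f] by (auto simp: c_def cfams_def)
  have lin: "ev y f h = (\<Sum>p\<in>csupp c. c p * ev y (mono n (fst p) (snd p)) h)" if "y 0 = 0" for y
    using ev_coords[OF f, of y h] c that unfolding c_def[symmetric]
    by (simp add: ev_def lin_def aop_sum mono_wd wd_ffin)
  have "\<alpha> * ev x (opapp n q T f) h' = (\<Sum>p\<in>csupp c. c p * (\<alpha> * ev x (T (fst p) (snd p)) h'))"
    using c T unfolding opapp_def c_def[symmetric] ev_def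
    by (subst aop_sum) (auto simp: felem_ffin[of _ n] sum_distrib_left algebra_simps)
  also have "\<dots> = (\<Sum>p\<in>csupp c. c p * (\<beta> * ev x (mono n (fst p) (snd p)) h + \<gamma> * ev x' (mono n (fst p) (snd p)) h))"
    using c(1) by (intro sum.cong refl arg_cong2[where f = "(*)"] rec) (auto simp: cfams_def)
  also have "\<dots> = \<beta> * ev x f h + \<gamma> * ev x' f h"
    by (simp add: lin x sum_distrib_left sum.distrib algebra_simps)
  finally show ?thesis .
qed

lemma ev_qeps:
  assumes "f \<in> felem n" "x 0 = 0"
  shows "ev x (opapp n q (qeps_b n q i) f) h = qp (h i) * ev x f h"
proof -
  have "1 * ev x (opapp n q (qeps_b n q i) f) h = qp (h i) * ev x f h + 0 * ev x f h"
  proof (rule ev_opapp[where T = "qeps_b n q i" and x = x and x' = x, OF _ assms(1,2,2)])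
    show "qeps_b n q i lam mu \<in> felem n" for lam mu by (rule qeps_b_felem)
  next
    fix lam mu assume "lam \<in> adm n" "mu \<in> adm n"
    then show "1 * ev x (qeps_b n q i lam mu) h =
        qp (h i) * ev x (mono n lam mu) h + 0 * ev x (mono n lam mu) h"
      by (simp add: qeps_b_def ev_fsc ev_mono qp_def wt_def)
  qed
  then show ?thesis by simp
qed

lemma ev_e:
  assumes "1 \<le> k" "k < n" "f \<in> felem n" "x 0 = 0"
    and "h = h'(k := h' k - 1, Suc k := h' (Suc k) + 1)"
  shows "(1 - P) * x k * ev x (opapp n q (e_b n q k) f) h' =
    qp (h k) * (x k - qp (- 2 * h (Suc k)) * x (Suc k)) * ev x f h +
    qp (h k) * qp (- 2 * h (Suc k)) * (x (Suc k) - x k) * ev (x(k := P * x k)) f h"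
proof (rule ev_opapp[where T = "e_b n q k" and x = x and x' = "x(k := P * x k)", OF _ assms(3,4)])
  show "e_b n q k lam mu \<in> felem n" for lam mu by (rule e_b_felem)
  show "(x(k := P * x k)) 0 = 0" using assms by simp
qed (rule ev_e_b[OF assms(1,2) _ _ assms(5)])

lemma ev_f:
  assumes "1 \<le> k" "k < n" "f \<in> felem n" "x 0 = 0"
    and "h = h'(k := h' k + 1, Suc k := h' (Suc k) - 1)"
  shows "(1 - P) * x k * ev x (opapp n q (f_b n q k) f) h' =
    qp (h (Suc k)) * (x (k - 1) - qp (- 2 * h k) * x k) * ev x f h +
    qp (h (Suc k)) * (x k - x (k - 1)) * ev (x(k := x k / P)) f h"
proof (rule ev_opapp[where T = "f_b n q k" and x = x and x' = "x(k := x k / P)", OF _ assms(3,4)])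
  show "f_b n q k lam mu \<in> felem n" for lam mu by (rule f_b_felem)
  show "(x(k := x k / P)) 0 = 0" using assms by simp
qed (rule ev_f_b[OF assms(1,2) _ _ assms(5)])

end

lemma linear_functional_eqI:
  fixes f g :: "complex poly \<Rightarrow> complex"
  assumes "\<And>p r. f (p + r) = f p + f r" "\<And>c p. f (smult c p) = c * f p"
    and "\<And>p r. g (p + r) = g p + g r" "\<And>c p. g (smult c p) = c * g p"
    and "\<And>i. f (monom 1 i) = g (monom 1 i)"
  shows "f p = g p"
proof -
  have 0: "f 0 = 0" "g 0 = 0" using assms(2,4)[of 0 0] by simp_all
  have m: "f (monom c i) = g (monom c i)" for c i
    using assms(2,4)[of c "monom 1 i"] assms(5) by (simp add: smult_monom)
  have "f (\<Sum>i\<in>S. monom (coeff p i) i) = g (\<Sum>i\<in>S. monom (coeff p i) i)" if "finite S" for S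
    using that by (induction S rule: finite_induct) (simp_all add: 0 assms(1,3) m)
  from this[of "{..degree p}"] show ?thesis by (simp add: poly_as_sum_of_monoms)
qed

context qsphere
begin

section \<open>Little \<open>q\<close>-Jacobi polynomials\<close>

definition T :: complex where "T = qp 2"

lemma T_real: "T = of_real (q\<^sup>2)"
  using qp_of_nat[of 2] by (simp add: T_def)

lemma T_nz [simp]: "T \<noteq> 0"
  by (simp add: T_def)

lemma P_T: "P = inverse T"
  by (simp add: P_def T_def qp_minus)

lemma T_power: "T ^ k = qp (2 * int k)"
  by (induction k) (simp_all add: T_def flip: qp_add)

lemma T_power_eq_1_iff [simp]: "T ^ k = 1 \<longleftrightarrow> k = 0" "1 = T ^ k \<longleftrightarrow> k = 0"
  unfolding T_power by auto

lemma P_T_power: "P ^ j * T ^ i = 1 \<longleftrightarrow> i = j"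
  unfolding P_power T_power qp_add[symmetric] by auto

lemma norm_T_less_1: "norm (T ^ Suc k) < 1"
proof -
  have "(q\<^sup>2) ^ Suc k < 1" using q_pos q_less_1 by (intro power_Suc_less_one) (auto simp: power_less_one_iff)
  then show ?thesis unfolding T_real of_real_power[symmetric] norm_of_real by simp
qed

text \<open>The Jackson integral of x^(n-2) p(x) over [0, 1] with base q^2, without its factor 1 -
  q^2.\<close>

definition Mp :: "complex poly \<Rightarrow> complex" where
  "Mp p = (\<Sum>r. T ^ (r * (n - 1)) * poly p (T ^ r))"

lemma Mp_monom_sums: "(\<lambda>r. T ^ (r * (n - 1)) * poly (monom c i) (T ^ r)) sums (c / (1 - T ^ (i + n - 1)))"
proof -
  obtain k where k: "i + n - 1 = Suc k" using n_ge_2 by (cases "i + n - 1") auto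
  have "(\<lambda>r. c * (T ^ Suc k) ^ r) sums (c * (1 / (1 - T ^ Suc k)))"
    by (intro sums_mult geometric_sums norm_T_less_1)
  moreover have "T ^ (r * (n - 1)) * poly (monom c i) (T ^ r) = c * (T ^ Suc k) ^ r" for r
  proof -
    have "r * (n - 1) + i * r = (i + n - 1) * r" using n_ge_2 by (simp add: algebra_simps)
    then have "T ^ (r * (n - 1)) * T ^ (i * r) = T ^ (Suc k * r)"
      unfolding k by (metis power_add)
    then show ?thesis
      by (simp add: poly_monom power_mult[symmetric] mult.commute mult.left_commute del: power_Suc)
  qed
  ultimately show ?thesis by (simp only: k mult_1_right times_divide_eq_right)
qed

lemma Mp_sums: "(\<lambda>r. T ^ (r * (n - 1)) * poly p (T ^ r)) sums Mp p"
proof -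
  have "(\<lambda>r. \<Sum>i\<le>degree p. T ^ (r * (n - 1)) * poly (monom (coeff p i) i) (T ^ r)) sums
      (\<Sum>i\<le>degree p. coeff p i / (1 - T ^ (i + n - 1)))"
    by (intro sums_sum Mp_monom_sums)
  moreover have "(\<Sum>i\<le>degree p. T ^ (r * (n - 1)) * poly (monom (coeff p i) i) (T ^ r)) =
      T ^ (r * (n - 1)) * poly p (T ^ r)" for r
    by (simp add: poly_monom poly_altdef[of p] sum_distrib_left)
  ultimately show ?thesis unfolding Mp_def by (simp add: sums_iff)
qed

lemma Mp_add: "Mp (p + r) = Mp p + Mp r"
proof (rule sums_unique2[OF Mp_sums])
  show "(\<lambda>k. T ^ (k * (n - 1)) * poly (p + r) (T ^ k)) sums (Mp p + Mp r)"
    using sums_add[OF Mp_sums[of p] Mp_sums[of r]] by (simp add: distrib_left)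
qed

lemma Mp_smult: "Mp (smult c p) = c * Mp p"
proof (rule sums_unique2[OF Mp_sums])
  show "(\<lambda>k. T ^ (k * (n - 1)) * poly (smult c p) (T ^ k)) sums (c * Mp p)"
    using sums_mult[OF Mp_sums[of p], of c] by (simp add: algebra_simps)
qed

lemma Mp_monom: "Mp (monom c i) = c / (1 - T ^ (i + n - 1))"
  by (rule sums_unique2[OF Mp_sums Mp_monom_sums])

lemma Mp_diff: "Mp (p - r) = Mp p - Mp r"
  using Mp_add[of p "smult (-1) r"] unfolding Mp_smult by simp

lemma Mp_sum: "Mp (\<Sum>i\<in>S. f i) = (\<Sum>i\<in>S. Mp (f i))"
  by (induction S rule: infinite_finite_induct) (use Mp_smult[of 0 0] in \<open>simp_all add: Mp_add\<close>)

text \<open>With base T = q^2 this is (T x; T)_b, the second factor of the little q-Jacobi weight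
  for the integer parameter b; the first factor x^(n-2) is built into \<open>Mp\<close>.\<close>

definition rho :: "nat \<Rightarrow> complex poly" where
  "rho b = (\<Prod>j<b. [:1, - (T ^ Suc j):])"

text \<open>The product (x; q^(-2))_c that w_n^c contributes at x_n = 1 with x = x_(n-1).\<close>

definition pip :: "nat \<Rightarrow> complex poly" where
  "pip c = (\<Prod>r<c. [:1, - (P ^ r):])"

lemma rho_Suc: "rho (Suc b) = rho b * [:1, - (T ^ Suc b):]"
  and pip_Suc: "pip (Suc b) = pip b * [:1, - (P ^ b):]"
  unfolding rho_def pip_def by (simp_all only: prod.lessThan_Suc)

section \<open>q-Pochhammer symbols and moments of the weights\<close>

definition qpc :: "complex \<Rightarrow> nat \<Rightarrow> complex" where
  "qpc a k = (\<Prod>j<k. 1 - a * T ^ j)"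

lemma qpc_Suc: "qpc a (Suc k) = qpc a k * (1 - a * T ^ k)"
  by (simp add: qpc_def)

lemma qpc_0 [simp]: "qpc a 0 = 1"
  by (simp add: qpc_def)

lemma qpc_add: "qpc a (m + k) = qpc a m * qpc (a * T ^ m) k"
  by (induction k) (simp_all add: qpc_Suc power_add mult.assoc)

lemma qpc_Suc_shift: "qpc a (Suc k) = (1 - a) * qpc (a * T) k"
  using qpc_add[of a 1 k] by (simp add: qpc_def)

lemma qpc_T_nz: "0 < i \<Longrightarrow> qpc (T ^ i) k \<noteq> 0"
  unfolding qpc_def by (simp add: power_add[symmetric])

lemma qpc_of_real: "complex_of_real (qpoch a (q\<^sup>2) k) = qpc (of_real a) k"
  by (simp add: qpoch_def qpc_def T_real)

lemma Mp_mult_linear: "Mp (p * [:1, - c:]) = Mp p - c * Mp (p * [:0, 1:])"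
proof -
  have "p * [:1, - c:] = p - smult c (p * [:0, 1:])" by simp
  then show ?thesis by (simp only: Mp_diff Mp_smult)
qed

lemma monom_mult_x: "monom 1 j * r * [:0, 1:] = monom (1 :: complex) (Suc j) * r"
  by (simp add: monom_Suc)

text \<open>The q-beta integral. Splitting off the last factor of \<open>rho\<close> relates b + 1
  to b at the exponents j and j + 1, hence the induction for all j at once.\<close>

lemma Mp_rho: "Mp (monom 1 j * rho b) = qpc T b / qpc (T ^ (j + n - 1)) (Suc b)"
proof (induction b arbitrary: j)
  case 0
  then show ?case by (simp add: rho_def Mp_monom qpc_Suc)
next
  case (Suc b)
  have "Mp (monom 1 j * rho (Suc b)) = Mp (monom 1 j * rho b * [:1, - (T ^ Suc b):])"
    unfolding rho_Suc by (simp only: mult.assoc)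
  also have "\<dots> = Mp (monom 1 j * rho b) - T ^ Suc b * Mp (monom 1 (Suc j) * rho b)"
    unfolding Mp_mult_linear monom_mult_x ..
  finally have *: "Mp (monom 1 j * rho (Suc b)) =
      qpc T b / qpc (T ^ (j + n - 1)) (Suc b) - T ^ Suc b * (qpc T b / qpc (T ^ (Suc j + n - 1)) (Suc b))"
    unfolding Suc .
  define s where "s = T ^ (j + n - 1)"
  have sT: "T ^ (Suc j + n - 1) = s * T"
  proof -
    have "Suc j + n - 1 = Suc (j + n - 1)" using n_ge_2 by simp
    then show ?thesis by (simp only: s_def power_Suc2)
  qed
  have nz: "qpc s (Suc b) \<noteq> 0" "qpc (s * T) (Suc b) \<noteq> 0" "qpc s (Suc (Suc b)) \<noteq> 0"
    unfolding sT[symmetric] by (unfold s_def, (rule qpc_T_nz, use n_ge_2 in simp)+)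
  have 1: "qpc s (Suc (Suc b)) = qpc s (Suc b) * (1 - s * T ^ Suc b)"
    and 2: "qpc s (Suc (Suc b)) = (1 - s) * qpc (s * T) (Suc b)"
    by (rule qpc_Suc, rule qpc_Suc_shift)
  have e1: "a / qpc s (Suc b) = a * (1 - s * T ^ Suc b) / qpc s (Suc (Suc b))" for a
    using nz unfolding 1 by simp
  have e2: "a / qpc (s * T) (Suc b) = a * (1 - s) / qpc s (Suc (Suc b))" for a
    using nz unfolding 2 by simp
  have "qpc T b / qpc s (Suc b) - T ^ Suc b * (qpc T b / qpc (s * T) (Suc b)) =
      qpc T b * (1 - T ^ Suc b) / qpc s (Suc (Suc b))"
    unfolding e1 e2 using nz(3) by (simp add: field_simps del: power_Suc)
  also have "qpc T b * (1 - T ^ Suc b) = qpc T (Suc b)" by (simp add: qpc_Suc)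
  finally show ?case unfolding * sT s_def[symmetric] .
qed

lemma Mp_pip: "Mp (monom 1 j * pip b) = (T ^ (j + n - 1)) ^ b * qpc T b / qpc (T ^ (j + n - 1)) (Suc b)"
proof (induction b arbitrary: j)
  case 0
  then show ?case by (simp add: pip_def Mp_monom qpc_Suc)
next
  case (Suc b)
  have "Mp (monom 1 j * pip (Suc b)) = Mp (monom 1 j * pip b * [:1, - (P ^ b):])"
    unfolding pip_Suc by (simp only: mult.assoc)
  also have "\<dots> = Mp (monom 1 j * pip b) - P ^ b * Mp (monom 1 (Suc j) * pip b)"
    unfolding Mp_mult_linear monom_mult_x ..
  finally have *: "Mp (monom 1 j * pip (Suc b)) =
      (T ^ (j + n - 1)) ^ b * qpc T b / qpc (T ^ (j + n - 1)) (Suc b) -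
      P ^ b * ((T ^ (Suc j + n - 1)) ^ b * qpc T b / qpc (T ^ (Suc j + n - 1)) (Suc b))"
    unfolding Suc .
  define s where "s = T ^ (j + n - 1)"
  have sT: "T ^ (Suc j + n - 1) = s * T"
  proof -
    have "Suc j + n - 1 = Suc (j + n - 1)" using n_ge_2 by simp
    then show ?thesis by (simp only: s_def power_Suc2)
  qed
  have nz: "qpc s (Suc b) \<noteq> 0" "qpc (s * T) (Suc b) \<noteq> 0" "qpc s (Suc (Suc b)) \<noteq> 0"
    unfolding sT[symmetric] by (unfold s_def, (rule qpc_T_nz, use n_ge_2 in simp)+)
  have 1: "qpc s (Suc (Suc b)) = qpc s (Suc b) * (1 - s * T ^ Suc b)"
    and 2: "qpc s (Suc (Suc b)) = (1 - s) * qpc (s * T) (Suc b)"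
    by (rule qpc_Suc, rule qpc_Suc_shift)
  have PT: "P ^ b * (s * T) ^ b = s ^ b"
    by (simp add: P_T power_mult_distrib power_inverse)
  have e1: "a / qpc s (Suc b) = a * (1 - s * T ^ Suc b) / qpc s (Suc (Suc b))" for a
    using nz unfolding 1 by simp
  have e2: "a / qpc (s * T) (Suc b) = a * (1 - s) / qpc s (Suc (Suc b))" for a
    using nz unfolding 2 by simp
  have "s ^ b * qpc T b / qpc s (Suc b) - P ^ b * ((s * T) ^ b * qpc T b / qpc (s * T) (Suc b)) =
      s ^ b * qpc T b / qpc s (Suc b) - (P ^ b * (s * T) ^ b) * (qpc T b / qpc (s * T) (Suc b))"
    by (simp add: mult.assoc)
  also have "\<dots> = s ^ Suc b * (qpc T b * (1 - T ^ Suc b)) / qpc s (Suc (Suc b))"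
    unfolding PT e1 e2 using nz(3) by (simp add: field_simps del: power_Suc) (simp add: algebra_simps)
  also have "qpc T b * (1 - T ^ Suc b) = qpc T (Suc b)" by (simp add: qpc_Suc)
  finally show ?case unfolding * sT s_def[symmetric] .
qed

lemma pcompose_monom_scale: "pcompose (monom 1 i) [:0, c:] = monom (c ^ i) i"
  by (induction i) (simp_all add: monom_Suc pcompose_pCons smult_monom monom_0)

text \<open>Rescaling of the Jackson integral: \<open>pip b\<close> is \<open>rho b\<close> taken at
  P^b x and vanishes at the first b nodes, so the sum may be shifted by b. The proof compares both
  sides on monomials, where the two moment formulas differ by a power of T only.\<close>

lemma Mp_pip_pcompose:
  "Mp (pip b * pcompose G [:0, P ^ b:]) = T ^ (b * (n - 1)) * Mp (rho b * G)"
proof (rule linear_functional_eqI[of "\<lambda>G. Mp (pip b * pcompose G [:0, P ^ b:])"])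
  fix i
  have PT: "P ^ (b * i) * T ^ (b * i) = 1"
    by (simp add: P_T power_inverse)
  have "(i + n - 1) * b = b * i + b * (n - 1)" using n_ge_2 by (simp add: algebra_simps)
  then have e: "(P ^ b) ^ i * (T ^ (i + n - 1)) ^ b = T ^ (b * (n - 1))"
    unfolding power_mult[symmetric] using PT by (simp add: power_add)
  have "pip b * pcompose (monom 1 i) [:0, P ^ b:] = smult ((P ^ b) ^ i) (monom 1 i * pip b)"
  proof -
    have "monom ((P ^ b) ^ i) i = smult ((P ^ b) ^ i) (monom 1 i)" by (simp add: smult_monom)
    then show ?thesis
      by (simp only: pcompose_monom_scale mult_smult_right mult.commute[of "pip b" "monom 1 i"])
  qed
  then have "Mp (pip b * pcompose (monom 1 i) [:0, P ^ b:]) =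
      (P ^ b) ^ i * ((T ^ (i + n - 1)) ^ b * qpc T b / qpc (T ^ (i + n - 1)) (Suc b))"
    by (simp only: Mp_smult Mp_pip)
  also have "\<dots> = T ^ (b * (n - 1)) * Mp (monom 1 i * rho b)"
    unfolding Mp_rho e[symmetric] by (simp only: times_divide_eq_right mult.assoc)
  finally show "Mp (pip b * pcompose (monom 1 i) [:0, P ^ b:]) = T ^ (b * (n - 1)) * Mp (rho b * monom 1 i)"
    by (simp only: mult.commute[of "monom 1 i" "rho b"])
next
  fix p r c
  show "Mp (pip b * pcompose (p + r) [:0, P ^ b:]) =
      Mp (pip b * pcompose p [:0, P ^ b:]) + Mp (pip b * pcompose r [:0, P ^ b:])"
    by (simp only: pcompose_add distrib_left Mp_add)
  show "Mp (pip b * pcompose (smult c p) [:0, P ^ b:]) = c * Mp (pip b * pcompose p [:0, P ^ b:])"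
    by (simp only: pcompose_smult mult_smult_right Mp_smult)
  show "T ^ (b * (n - 1)) * Mp (rho b * (p + r)) =
      T ^ (b * (n - 1)) * Mp (rho b * p) + T ^ (b * (n - 1)) * Mp (rho b * r)"
    by (simp only: distrib_left Mp_add)
  show "T ^ (b * (n - 1)) * Mp (rho b * smult c p) = c * (T ^ (b * (n - 1)) * Mp (rho b * p))"
    by (simp only: mult_smult_right Mp_smult mult.left_commute)
qed

text \<open>The quotient (q^(-2d); q^2)_k / (q^2; q^2)_k inside the Jacobi coefficients: up to sign
  and a power of q, a q-binomial coefficient.\<close>

definition qb :: "nat \<Rightarrow> nat \<Rightarrow> complex" where
  "qb d k = qpc (P ^ d) k / qpc T k"

lemma qb_eq_0: "d < k \<Longrightarrow> qb d k = 0"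
  unfolding qb_def qpc_def using P_T_power[of d d] by (auto simp: intro!: bexI[of _ d])

text \<open>The q-Pascal rule in this normalization.\<close>

lemma qb_Suc: "qb (Suc d) (Suc k) = qb d (Suc k) - P ^ Suc d * qb d k"
proof -
  have nz: "1 - T * T ^ k \<noteq> 0" "qpc T k \<noteq> 0"
    using T_power_eq_1_iff(2)[of "Suc k"] qpc_T_nz[of 1 k] by simp_all
  have PT: "P ^ Suc d * T = P ^ d" by (simp add: P_T)
  have 1: "qpc (P ^ Suc d) (Suc k) = (1 - P ^ Suc d) * qpc (P ^ d) k"
    unfolding qpc_Suc_shift PT ..
  have 2: "qpc (P ^ d) (Suc k) = (1 - P ^ d * T ^ k) * qpc (P ^ d) k"
    by (simp add: qpc_Suc)
  have 3: "P ^ d * T ^ k = P ^ Suc d * (T * T ^ k)"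
    unfolding PT[symmetric] by (simp only: mult.assoc)
  have "qpc (P ^ Suc d) (Suc k) = qpc (P ^ d) (Suc k) - P ^ Suc d * qpc (P ^ d) k * (1 - T * T ^ k)"
    unfolding 1 2 3 by (simp add: algebra_simps)
  then have "qb (Suc d) (Suc k) = qpc (P ^ d) (Suc k) / qpc T (Suc k) -
      P ^ Suc d * qpc (P ^ d) k * (1 - T * T ^ k) / (qpc T k * (1 - T * T ^ k))"
    by (simp only: qb_def qpc_Suc[of T] diff_divide_distrib)
  then show ?thesis unfolding qb_def using nz by simp
qed

lemma q_binomial: "(\<Sum>k\<le>d. qb d k * z ^ k) = (\<Prod>r<d. 1 - z * P ^ Suc r)"
proof (induction d)
  case 0
  then show ?case by (simp add: qb_def)
next
  case (Suc d)
  have "(\<Sum>k\<le>Suc d. qb (Suc d) k * z ^ k) = 1 + (\<Sum>k\<le>d. qb (Suc d) (Suc k) * z ^ Suc k)"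
    by (simp only: sum.atMost_Suc_shift) (simp add: qb_def)
  also have "\<dots> = 1 + (\<Sum>k\<le>d. qb d (Suc k) * z ^ Suc k) - z * P ^ Suc d * (\<Sum>k\<le>d. qb d k * z ^ k)"
    unfolding qb_Suc by (simp add: sum_distrib_left sum_subtractf algebra_simps)
  also have "1 + (\<Sum>k\<le>d. qb d (Suc k) * z ^ Suc k) = (\<Sum>k\<le>Suc d. qb d k * z ^ k)"
    by (simp only: sum.atMost_Suc_shift) (simp add: qb_def)
  also have "\<dots> = (\<Sum>k\<le>d. qb d k * z ^ k)" by (simp add: qb_eq_0)
  finally show ?case unfolding Suc by (simp add: algebra_simps)
qed

text \<open>The product in the q-binomial theorem vanishes at z = T, T^2, ..., T^d. Taking z =
  T^(j+1) kills the contribution of the monomial of degree j.\<close>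

lemma q_binomial_orthogonal:
  assumes "degree f < d"
  shows "(\<Sum>k\<le>d. qb d k * T ^ k * poly f (T ^ k)) = 0"
proof -
  have "(\<Sum>k\<le>d. qb d k * (T ^ Suc j) ^ k) = 0" if "j < d" for j
  proof -
    have "1 - T ^ Suc j * P ^ Suc j = 0"
      using P_T_power[of "Suc j" "Suc j"] by (simp add: mult.commute)
    then show ?thesis unfolding q_binomial using that by (intro prod_zero) auto
  qed
  moreover have "(\<Sum>k\<le>d. qb d k * T ^ k * poly f (T ^ k)) =
      (\<Sum>j\<le>degree f. coeff f j * (\<Sum>k\<le>d. qb d k * (T ^ Suc j) ^ k))"
  proof -
    have "(\<Sum>k\<le>d. qb d k * T ^ k * poly f (T ^ k)) =
        (\<Sum>k\<le>d. \<Sum>j\<le>degree f. coeff f j * (qb d k * (T ^ Suc j) ^ k))"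
      unfolding poly_altdef sum_distrib_left
      by (intro sum.cong refl) (simp add: power_mult_distrib power_mult[symmetric] mult.commute mult.left_commute)
    also have "\<dots> = (\<Sum>j\<le>degree f. \<Sum>k\<le>d. coeff f j * (qb d k * (T ^ Suc j) ^ k))" by (rule sum.swap)
    finally show ?thesis by (simp add: sum_distrib_left)
  qed
  ultimately show ?thesis using assms by (simp add: sum.neutral)
qed

section \<open>Orthogonality and uniqueness of the Jacobi polynomials\<close>

definition jac :: "nat \<Rightarrow> nat \<Rightarrow> complex poly" where
  "jac b d = (\<Sum>k\<le>d. monom (of_real (ljac_coeff (n - 2) b d (q\<^sup>2) k)) k)"

lemma ljac_coeff_conv:
  "complex_of_real (ljac_coeff (n - 2) b d (q\<^sup>2) k) =
    qb d k * (qpc (T ^ (n - 1 + b + d)) k / qpc (T ^ (n - 1)) k) * T ^ k"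
proof -
  have "n - 2 + b + d + 1 = n - 1 + b + d" "n - 2 + 1 = n - 1" using n_ge_2 by simp_all
  then show ?thesis
    unfolding ljac_coeff_def qb_def
    by (simp only: of_real_mult of_real_divide qpc_of_real of_real_power T_real P_T)
      (simp add: inverse_eq_divide power_mult)
qed

text \<open>The k-th coefficient times its moment is a constant times qb d k T^k f(T^k) for a
  polynomial f of degree d - 1, so the sum vanishes by the q-binomial theorem.\<close>

lemma jac_orthogonal:
  assumes "i < d"
  shows "Mp (rho b * (monom 1 i * jac b d)) = 0"
proof -
  define A where "A = T ^ (n - 1)"
  \<comment> \<open>With (A y; T)_(b+d) as the common denominator, the moment cancels the b + 1
    factors with indices i, ..., i + b. The d - 1 factors that remain form f, and i < d guarantees
    that the cancelled ones are present.\<close>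
  define f where "f = (\<Prod>j<i. [:1, - (A * T ^ j):]) * (\<Prod>j<d - 1 - i. [:1, - (A * T ^ (i + Suc b) * T ^ j):])"
  have "degree f \<le> degree (\<Prod>j<i. [:1, - (A * T ^ j):]) + degree (\<Prod>j<d - 1 - i. [:1, - (A * T ^ (i + Suc b) * T ^ j):])"
    unfolding f_def by (rule degree_mult_le)
  also have "\<dots> \<le> (\<Sum>j<i. 1) + (\<Sum>j<d - 1 - i. 1)"
    by (intro add_mono order_trans[OF degree_prod_sum_le] sum_mono) auto
  finally have deg: "degree f < d" using assms by simp
  have f: "poly f y = qpc (A * y) i * qpc (A * y * T ^ (i + Suc b)) (d - 1 - i)" for y
    by (simp add: f_def poly_prod qpc_def mult_ac)
  have nz: "qpc A k \<noteq> 0" "qpc (A * T ^ j) k \<noteq> 0" for j k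
    unfolding A_def power_add[symmetric] using n_ge_2 by (auto intro!: qpc_T_nz)
  have summand: "complex_of_real (ljac_coeff (n - 2) b d (q\<^sup>2) k) * Mp (monom 1 (i + k) * rho b) =
      qpc T b / qpc A (b + d) * (qb d k * T ^ k * poly f (T ^ k))" for k
  proof -
    have bd: "b + d = i + (Suc b + (d - 1 - i))" using assms by simp
    have "qpc A (b + d) * qpc (A * T ^ (b + d)) k = qpc A k * qpc (A * T ^ k) (b + d)"
      unfolding qpc_add[symmetric] by (simp add: add.commute)
    also have "qpc (A * T ^ k) (b + d) = qpc (A * T ^ k) i *
        (qpc (A * T ^ k * T ^ i) (Suc b) * qpc (A * T ^ k * T ^ i * T ^ Suc b) (d - 1 - i))"
      by (simp only: bd qpc_add)
    also have "A * T ^ k * T ^ i * T ^ Suc b = A * T ^ k * T ^ (i + Suc b)"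
      by (simp only: power_add mult.assoc)
    also have "A * T ^ k * T ^ i = A * T ^ (k + i)" by (simp add: power_add mult.assoc)
    finally have "qpc A (b + d) * qpc (A * T ^ (b + d)) k =
        qpc A k * (qpc (A * T ^ (k + i)) (Suc b) * poly f (T ^ k))"
      unfolding f by (simp only: mult_ac)
    then have eq: "qpc (A * T ^ (b + d)) k / qpc A k / qpc (A * T ^ (k + i)) (Suc b) = poly f (T ^ k) / qpc A (b + d)"
      using nz(1)[of k] nz(1)[of "b + d"] nz(2)[of "k + i" "Suc b"] by (simp add: field_simps)
    have T1: "T ^ (n - 1 + b + d) = A * T ^ (b + d)" by (simp add: A_def power_add)
    have T2: "T ^ (i + k + n - 1) = A * T ^ (k + i)"
    proof -
      have "i + k + n - 1 = n - 1 + (k + i)" using n_ge_2 by simp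
      then show ?thesis by (simp only: A_def power_add)
    qed
    have "complex_of_real (ljac_coeff (n - 2) b d (q\<^sup>2) k) * Mp (monom 1 (i + k) * rho b) =
        qb d k * T ^ k * qpc T b * (qpc (A * T ^ (b + d)) k / qpc A k / qpc (A * T ^ (k + i)) (Suc b))"
      unfolding ljac_coeff_conv Mp_rho T1 T2 A_def[symmetric] by simp
    then show ?thesis unfolding eq by simp
  qed
  have "rho b * (monom 1 i * jac b d) =
      (\<Sum>k\<le>d. smult (of_real (ljac_coeff (n - 2) b d (q\<^sup>2) k)) (monom 1 (i + k) * rho b))"
    by (simp add: jac_def sum_distrib_left mult_monom mult.commute[of "rho b"] sum_distrib_right smult_monom flip: mult_smult_left)
  then have "Mp (rho b * (monom 1 i * jac b d)) =
      qpc T b / qpc A (b + d) * (\<Sum>k\<le>d. qb d k * T ^ k * poly f (T ^ k))"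
    by (simp only: Mp_sum Mp_smult summand sum_distrib_left)
  then show ?thesis using q_binomial_orthogonal[OF deg] by simp
qed

lemma jac_orthogonal_degree:
  assumes "degree p < d"
  shows "Mp (rho b * (p * jac b d)) = 0"
proof -
  have "Mp (rho b * (monom c i * jac b d)) = c * Mp (rho b * (monom 1 i * jac b d))" for c i
  proof -
    have "monom c i = smult c (monom 1 i)" by (simp add: smult_monom)
    then show ?thesis by (simp only: mult_smult_left mult_smult_right Mp_smult)
  qed
  then have "Mp (rho b * (monom c i * jac b d)) = 0" if "i < d" for c i
    using jac_orthogonal[OF that] by simp
  then have "Mp (rho b * ((\<Sum>i\<le>degree p. monom (coeff p i) i) * jac b d)) = 0"
    unfolding sum_distrib_left sum_distrib_right Mp_sum using assms by (intro sum.neutral) auto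
  then show ?thesis by (simp only: poly_as_sum_of_monoms)
qed

lemma coeff_jac: "coeff (jac b d) k = (if k \<le> d then of_real (ljac_coeff (n - 2) b d (q\<^sup>2) k) else 0)"
  by (simp add: jac_def coeff_sum)

lemma coeff_jac_0: "coeff (jac b d) 0 = 1"
  by (simp add: coeff_jac ljac_coeff_conv qb_def)

text \<open>P^d T^j = 1 only for j = d, so no factor with j < d vanishes and the degree is exactly
  d.\<close>

lemma coeff_jac_d: "coeff (jac b d) d \<noteq> 0"
proof -
  have "qpc (P ^ d) d \<noteq> 0" unfolding qpc_def using P_T_power by auto
  moreover have "qpc (T ^ (n - 1 + b + d)) d \<noteq> 0" "qpc (T ^ (n - 1)) d \<noteq> 0" "qpc T d \<noteq> 0"
    using n_ge_2 qpc_T_nz[of 1 d] by (auto intro!: qpc_T_nz)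
  ultimately show ?thesis unfolding coeff_jac ljac_coeff_conv qb_def by simp
qed

lemma degree_jac: "degree (jac b d) \<le> d"
  by (rule degree_le) (simp add: coeff_jac)

text \<open>The polynomial x^t pip(d-1-t) has lowest term x^t, so these d polynomials form a basis
  in degree below d. Subtracting p(0) times the one with t = 0 leaves a multiple of x, to which the
  induction hypothesis applies after division by x.\<close>

lemma pip_triangular:
  assumes "\<And>p r. K (p + r) = K p + (K r :: complex)" "\<And>c p. K (smult c p) = c * K p"
    and "\<And>t. t < d \<Longrightarrow> K (monom 1 t * pip (d - 1 - t)) = 0" and "degree p < d"
  shows "K p = 0"
  using assms
proof (induction d arbitrary: K p)
  case (Suc d)
  define r where "r = p - smult (poly p 0) (pip d)"
  have "poly (pip d) 0 = 1" by (simp add: pip_def poly_prod)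
  then have "poly r 0 = 0" by (simp add: r_def)
  then obtain p' where p': "r = pCons 0 p'" by (cases r) auto
  have "degree (pip d) \<le> (\<Sum>j<d. 1)"
    unfolding pip_def by (intro order_trans[OF degree_prod_sum_le] sum_mono) auto
  then have "degree r \<le> d" using Suc.prems(4)
    unfolding r_def by (intro degree_diff_le order_trans[OF degree_smult_le]) auto
  have "K (pCons 0 p') = 0"
  proof (cases "p' = 0")
    case True
    then show ?thesis using Suc.prems(2)[of 0 0] by simp
  next
    case False
    then have "degree p' < d" using \<open>degree r \<le> d\<close> p' by simp
    then show ?thesis
    proof (rule Suc.IH[of "\<lambda>p. K (pCons 0 p)", rotated 3])
      show "K (pCons 0 (p + r)) = K (pCons 0 p) + K (pCons 0 r)" for p r
        using Suc.prems(1)[of "pCons 0 p" "pCons 0 r"] by simp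
      show "K (pCons 0 (smult c p)) = c * K (pCons 0 p)" for c p
        using Suc.prems(2)[of c "pCons 0 p"] by simp
      show "K (pCons 0 (monom 1 t * pip (d - 1 - t))) = 0" if "t < d" for t
        using Suc.prems(3)[of "Suc t"] that by (simp add: monom_Suc)
    qed
  qed
  moreover have "K (pip d) = 0" using Suc.prems(3)[of 0] by (simp add: monom_0)
  moreover have "K p = K (pCons 0 p') + poly p 0 * K (pip d)"
    unfolding p'[symmetric] Suc.prems(1,2)[symmetric] by (simp add: r_def)
  ultimately show ?case by simp
qed simp

text \<open>On the orthogonal complement the functional is positive: it is a Jackson integral against
  the weight \<open>t^{k(n-1)} \<rho>(t^k)\<close>.\<close>

lemma Mp_rho_definite:
  assumes "Mp (rho b * (map_poly cnj r * r)) = 0"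
  shows "r = 0"
proof -
  define w where "w k = (q\<^sup>2) ^ (k * (n - 1)) * (\<Prod>j<b. 1 - (q\<^sup>2) ^ Suc j * (q\<^sup>2) ^ k)" for k
  have w: "0 < w k" for k
  proof -
    have "(q\<^sup>2) ^ Suc j * (q\<^sup>2) ^ k < 1" for j
      unfolding power_add[symmetric] using q_pos q_less_1
      by (intro power_Suc_less_one[of "q\<^sup>2" "j + k", simplified add_Suc[symmetric]])
        (auto simp: power_less_one_iff)
    then show ?thesis unfolding w_def using q_pos by (intro mult_pos_pos prod_pos) auto
  qed
  have eq: "T ^ (k * (n - 1)) * poly (rho b * (map_poly cnj r * r)) (T ^ k) =
      of_real (w k * (cmod (poly r (T ^ k)))\<^sup>2)" for k
  proof -
    \<comment> \<open>The nodes T^k are real, so conjugating the coefficients conjugates the values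
      there and the product becomes |r|^2.\<close>
    have "poly (map_poly cnj r) (T ^ k) = cnj (poly r (T ^ k))"
      using poly_cnj[of r "T ^ k"] by (simp add: T_real)
    then have "poly (map_poly cnj r * r) (T ^ k) = of_real ((cmod (poly r (T ^ k)))\<^sup>2)"
      by (simp only: poly_mult complex_norm_square mult.commute)
    moreover have "T ^ (k * (n - 1)) * poly (rho b) (T ^ k) = of_real (w k)"
      by (simp add: w_def rho_def poly_prod T_real mult.commute)
    moreover have "T ^ (k * (n - 1)) * poly (rho b * (map_poly cnj r * r)) (T ^ k) =
        (T ^ (k * (n - 1)) * poly (rho b) (T ^ k)) * poly (map_poly cnj r * r) (T ^ k)"
      by (simp only: poly_mult[of "rho b" "map_poly cnj r * r"] mult.assoc)
    ultimately show ?thesis by (simp only: of_real_mult)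
  qed
  have "(\<lambda>k. complex_of_real (w k * (cmod (poly r (T ^ k)))\<^sup>2)) sums of_real 0"
    using Mp_sums[of "rho b * (map_poly cnj r * r)"] assms unfolding eq by simp
  then have s: "(\<lambda>k. w k * (cmod (poly r (T ^ k)))\<^sup>2) sums 0"
    unfolding sums_of_real_iff .
  then have "\<forall>k. w k * (cmod (poly r (T ^ k)))\<^sup>2 = 0"
    using w by (subst suminf_eq_zero_iff[symmetric]) (auto simp: sums_iff less_imp_le)
  then have "poly r (T ^ k) = 0" for k using w[of k] by (auto dest: spec[of _ k])
  then have "range (\<lambda>k. T ^ k) \<subseteq> {x. poly r x = 0}" by auto
  moreover have "inj (\<lambda>k. T ^ k)" by (rule injI) (simp add: T_power)
  ultimately show "r = 0"
    using poly_roots_finite[of r] finite_subset range_inj_infinite by blast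
qed

text \<open>After subtraction of the multiple with the same top coefficient, the difference has
  degree below d. It is orthogonal to all such polynomials, in particular to its own conjugate, and
  definiteness makes it 0.\<close>

lemma jac_unique:
  assumes "degree g \<le> d"
    and "\<And>t. t < d \<Longrightarrow> Mp (rho b * (monom 1 t * pip (d - 1 - t) * g)) = 0"
  shows "\<exists>c. g = smult c (jac b d)"
proof -
  define c where "c = coeff g d / coeff (jac b d) d"
  define r where "r = g - smult c (jac b d)"
  have g0: "Mp (rho b * (p * g)) = 0" if "degree p < d" for p
    by (rule pip_triangular[of "\<lambda>p. Mp (rho b * (p * g))", OF _ _ _ that])
      (simp_all add: distrib_left distrib_right Mp_add Mp_smult assms(2)[simplified])
  have "r = 0"
  proof (rule ccontr)
    assume "r \<noteq> 0"
    have "degree r \<le> d" unfolding r_def using assms(1) degree_jac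
      by (intro degree_diff_le order_trans[OF degree_smult_le])
    moreover have "coeff r d = 0" using coeff_jac_d by (simp add: r_def c_def)
    ultimately have deg: "degree r < d"
      using \<open>r \<noteq> 0\<close> by (metis le_neq_implies_less leading_coeff_0_iff)
    have "degree (map_poly cnj r) < d"
      using deg by (simp add: degree_map_poly)
    then have "Mp (rho b * (map_poly cnj r * r)) = 0"
      using g0[of "map_poly cnj r"] jac_orthogonal_degree[of "map_poly cnj r"]
      by (simp add: r_def right_diff_distrib Mp_diff Mp_smult)
    then show False using Mp_rho_definite \<open>r \<noteq> 0\<close> by blast
  qed
  then show ?thesis by (auto simp: r_def)
qed

lemma jac_orthogonal_pip:
  assumes "t < d"
  shows "Mp (rho b * (monom 1 t * pip (d - 1 - t) * jac b d)) = 0"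
proof -
  let ?p = "monom 1 t * pip (d - 1 - t)"
  have "degree (pip (d - 1 - t)) \<le> (\<Sum>j<d - 1 - t. 1)"
    unfolding pip_def by (intro order_trans[OF degree_prod_sum_le] sum_mono) auto
  then have deg: "degree ?p < d"
    using degree_mult_le[of "monom 1 t" "pip (d - 1 - t)"] degree_monom_le[of "1::complex" t] assms by simp
  then show ?thesis by (rule jac_orthogonal_degree)
qed

section \<open>The functional \<open>h_n\<close>\<close>

definition hw :: "(nat \<Rightarrow> nat) \<Rightarrow> complex" where
  "hw mu = of_real (hweight n q mu)"

definition inc :: "(nat \<Rightarrow> nat) \<Rightarrow> nat \<Rightarrow> nat \<Rightarrow> nat" where
  "inc mu k = mu(k := Suc (mu k))"

definition tail :: "nat \<Rightarrow> (nat \<Rightarrow> nat) \<Rightarrow> nat \<Rightarrow> nat" where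
  "tail N mu k = (\<Sum>j\<in>{k<..N}. mu j)"

lemma inc_adm: "mu \<in> adm n \<Longrightarrow> 1 \<le> k \<Longrightarrow> k \<le> n \<Longrightarrow> inc mu k \<in> adm n"
  unfolding inc_def by (rule adm_upd)

lemma absl_inc: "1 \<le> k \<Longrightarrow> k \<le> n \<Longrightarrow> absl n (inc mu k) = Suc (absl n mu)"
  unfolding absl_def inc_def by (subst (1 2) sum.remove[of _ k]) (auto intro!: sum.cong)

lemma tail_pred: "1 \<le> k \<Longrightarrow> k \<le> N \<Longrightarrow> tail N mu (k - 1) = mu k + tail N mu k"
proof -
  assume "1 \<le> k" "k \<le> N"
  then have "{k - 1<..N} = insert k {k<..N}" by auto
  then show ?thesis by (simp add: tail_def)
qed

lemma bm_inc:
  assumes "1 \<le> k" "k \<le> n"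
  shows "bm (inc mu k) x = bm mu x * (x k - P ^ mu k * x (k - 1))"
proof -
  have "(\<Prod>i\<in>{1..n} - {k}. wfac x i 0 (inc mu k i)) = (\<Prod>i\<in>{1..n} - {k}. wfac x i 0 (mu i))"
    by (rule prod.cong) (auto simp: inc_def)
  moreover have "wfac x k 0 (inc mu k k) = wfac x k 0 (mu k) * (x k - P ^ mu k * x (k - 1))"
    by (simp add: inc_def wfac_fac fac_Suc)
  ultimately show ?thesis
    unfolding bm_def using assms by (subst (1 2) prod.remove[of _ k]) (auto simp: mult_ac)
qed

lemma sum_telescope:
  fixes f :: "nat \<Rightarrow> complex"
  shows "(\<Sum>k\<in>{1..N}. f k - f (k - 1)) = f N - f 0"
  by (induction N) simp_all

text \<open>Multiplication by Q_N in terms of the B_mu. The powers of P are chosen so that the lower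
  part of each factor x_k - P^mu_k x_(k-1) cancels against the preceding term; the sum telescopes to
  x_N.\<close>

lemma bm_raise:
  assumes "N \<le> n" "x 0 = 0"
  shows "x N * bm mu x = (\<Sum>k\<in>{1..N}. P ^ tail N mu k * bm (inc mu k) x)"
proof -
  have "(\<Sum>k\<in>{1..N}. P ^ tail N mu k * bm (inc mu k) x) =
      (\<Sum>k\<in>{1..N}. bm mu x * (P ^ tail N mu k * x k - P ^ tail N mu (k - 1) * x (k - 1)))"
    using assms by (intro sum.cong refl) (simp add: bm_inc tail_pred[simplified] power_add algebra_simps)
  also have "\<dots> = bm mu x * (P ^ tail N mu N * x N - P ^ tail N mu 0 * x 0)"
    unfolding sum_distrib_left[symmetric] by (rule arg_cong[OF sum_telescope])
  finally show ?thesis using assms by (simp add: tail_def)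
qed

section \<open>The weights of the functional\<close>

definition ppoch :: "nat \<Rightarrow> complex" where
  "ppoch k = (\<Prod>j<k. 1 - P ^ Suc j)"

lemma P_power_eq_1_iff [simp]: "P ^ k = 1 \<longleftrightarrow> k = 0" "1 = P ^ k \<longleftrightarrow> k = 0"
  unfolding P_power by auto

lemma ppoch_Suc: "ppoch (Suc k) = ppoch k * (1 - P ^ Suc k)"
  by (simp add: ppoch_def)

lemma ppoch_nz [simp]: "ppoch k \<noteq> 0"
  unfolding ppoch_def using P_power_eq_1_iff(2) by (auto simp del: power_Suc)

lemma hw_conv:
  "hw mu = P ^ (\<Sum>i\<in>{1..n}. (n - i) * mu i) * (\<Prod>i\<in>{1..n}. ppoch (mu i)) * ppoch (n - 1)
    / ppoch (absl n mu + n - 1)"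
proof -
  have p: "complex_of_real (qpoch (1 / q^2) (1 / q^2) k) = ppoch k" for k
    by (simp add: qpoch_def ppoch_def P_eq)
  have "{1..n} = insert n {1..n - 1}" using n_ge_2 by auto
  then have "(\<Sum>i\<in>{1..n}. (n - i) * mu i) = (\<Sum>i\<in>{1..n - 1}. (n - i) * mu i)" 
    using n_ge_2 by simp
  then show ?thesis
    unfolding hw_def hweight_def
    by (simp only: of_real_mult of_real_divide of_real_prod p of_real_power) (simp add: P_eq)
qed

lemma hw_nz [simp]: "hw mu \<noteq> 0"
  by (simp add: hw_conv)

lemma hw_inc:
  assumes "1 \<le> k" "k \<le> n"
  shows "hw (inc mu k) = hw mu * (P ^ (n - k) * (1 - P ^ Suc (mu k)) / (1 - P ^ (absl n mu + n)))"
proof -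
  have 1: "(\<Sum>i\<in>{1..n}. (n - i) * inc mu k i) = (\<Sum>i\<in>{1..n}. (n - i) * mu i) + (n - k)"
    unfolding inc_def using assms
    by (subst (1 2) sum.remove[of _ k]) (auto intro!: sum.cong)
  have 2: "(\<Prod>i\<in>{1..n}. ppoch (inc mu k i)) = (\<Prod>i\<in>{1..n}. ppoch (mu i)) * (1 - P ^ Suc (mu k))"
  proof -
    have "(\<Prod>i\<in>{1..n} - {k}. ppoch (inc mu k i)) = (\<Prod>i\<in>{1..n} - {k}. ppoch (mu i))"
      by (rule prod.cong) (auto simp: inc_def)
    then show ?thesis using assms
      by (subst (1 2) prod.remove[of _ k]) (auto simp: inc_def ppoch_Suc mult_ac)
  qed
  have "Suc (absl n mu) + n - 1 = Suc (absl n mu + n - 1)" "Suc (absl n mu + n - 1) = absl n mu + n"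
    using n_ge_2 by simp_all
  then have 3: "ppoch (absl n (inc mu k) + n - 1) = ppoch (absl n mu + n - 1) * (1 - P ^ (absl n mu + n))"
    unfolding absl_inc[OF assms] by (metis ppoch_Suc)
  show ?thesis unfolding hw_conv 1 2 3 by (simp add: power_add)
qed

text \<open>The counterpart of \<open>bm_raise\<close> for the values of h_n. For N = n the quotient
  is 1, which expresses that h_n respects Q_n = 1; for N = n - 1 it drives the recursion for powers
  of x_(n-1).\<close>

lemma hw_raise:
  assumes "N \<le> n" "mu \<in> adm n" "\<And>i. N < i \<Longrightarrow> mu i = 0"
  shows "(\<Sum>k\<in>{1..N}. P ^ tail N mu k * hw (inc mu k)) =
    hw mu * ((P ^ (n - N) - P ^ (absl n mu + n)) / (1 - P ^ (absl n mu + n)))"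
proof -
  \<comment> \<open>The factor 1 - P^(mu_k + 1) of \<open>hw_inc\<close> is what turns the k-th
    summand into the difference S k - S (k - 1).\<close>
  define S where "S k = P ^ tail N mu k * P ^ (n - k)" for k
  have S: "S k * P ^ Suc (mu k) = S (k - 1)" if "k \<in> {1..N}" for k
  proof -
    have "tail N mu k + (n - k) + Suc (mu k) = tail N mu (k - 1) + (n - (k - 1))"
      using that assms(1) tail_pred[of k N mu] by auto
    then show ?thesis unfolding S_def power_add[symmetric] by (rule arg_cong)
  qed
  have "P ^ tail N mu k * hw (inc mu k) = hw mu / (1 - P ^ (absl n mu + n)) * (S k - S (k - 1))"
    if "k \<in> {1..N}" for k
  proof -
    have "P ^ tail N mu k * hw (inc mu k) = hw mu / (1 - P ^ (absl n mu + n)) * (S k * (1 - P ^ Suc (mu k)))"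
      using that assms(1) by (simp add: hw_inc S_def del: power_Suc)
    then show ?thesis unfolding right_diff_distrib[of "S k"] S[OF that] by simp
  qed
  then have "(\<Sum>k\<in>{1..N}. P ^ tail N mu k * hw (inc mu k)) = hw mu / (1 - P ^ (absl n mu + n)) * (S N - S 0)"
    unfolding sum_telescope[symmetric] sum_distrib_left by (intro sum.cong) auto
  moreover have "tail N mu 0 = absl n mu"
    unfolding tail_def absl_def using assms by (intro sum.mono_neutral_left) auto
  ultimately show ?thesis by (simp add: S_def tail_def[of N mu N] power_add)
qed

text \<open>\<open>rep (adm n) G s\<close> determines \<open>s\<close> from the restriction of \<open>G\<close> to \<open>x_n = 1\<close>, so \<open>h_n\<close> can be computed
  from the evaluation alone.\<close>

definition rep :: "(nat \<Rightarrow> nat) set \<Rightarrow> ((nat \<Rightarrow> complex) \<Rightarrow> complex) \<Rightarrow> complex \<Rightarrow> bool" where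
  "rep A G s \<longleftrightarrow> (\<exists>D d. finite D \<and> D \<subseteq> A \<and>
    (\<forall>x. good0 n x \<longrightarrow> x n = 1 \<longrightarrow> G x = (\<Sum>mu\<in>D. d mu * bm mu x)) \<and> s = (\<Sum>mu\<in>D. d mu * hw mu))"

lemma rep_cong: "rep A G s \<Longrightarrow> (\<And>x. good0 n x \<Longrightarrow> x n = 1 \<Longrightarrow> G' x = G x) \<Longrightarrow> rep A G' s"
  unfolding rep_def by auto

lemma rep_bm: "mu \<in> A \<Longrightarrow> rep A (bm mu) (hw mu)"
  unfolding rep_def by (intro exI[of _ "{mu}"] exI[of _ "\<lambda>_. 1"]) auto

lemma rep_zero: "rep A (\<lambda>_. 0) 0"
  unfolding rep_def by (intro exI[of _ "{}"]) auto

lemma rep_scale: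
  assumes "rep A G s"
  shows "rep A (\<lambda>x. c * G x) (c * s)"
proof -
  obtain D d where "finite D" "D \<subseteq> A" "s = (\<Sum>mu\<in>D. d mu * hw mu)"
    "\<forall>x. good0 n x \<longrightarrow> x n = 1 \<longrightarrow> G x = (\<Sum>mu\<in>D. d mu * bm mu x)"
    using assms unfolding rep_def by blast
  then show ?thesis unfolding rep_def
    by (intro exI[of _ D] exI[of _ "\<lambda>mu. c * d mu"]) (simp add: sum_distrib_left mult.assoc)
qed

lemma rep_add:
  assumes "rep A G s" "rep A G' s'"
  shows "rep A (\<lambda>x. G x + G' x) (s + s')"
proof -
  obtain D d where 1: "finite D" "D \<subseteq> A" "s = (\<Sum>mu\<in>D. d mu * hw mu)"
    "\<forall>x. good0 n x \<longrightarrow> x n = 1 \<longrightarrow> G x = (\<Sum>mu\<in>D. d mu * bm mu x)"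
    using assms unfolding rep_def by blast
  obtain D' d' where 2: "finite D'" "D' \<subseteq> A" "s' = (\<Sum>mu\<in>D'. d' mu * hw mu)"
    "\<forall>x. good0 n x \<longrightarrow> x n = 1 \<longrightarrow> G' x = (\<Sum>mu\<in>D'. d' mu * bm mu x)"
    using assms unfolding rep_def by blast
  define e where "e mu = (if mu \<in> D then d mu else 0) + (if mu \<in> D' then d' mu else 0)" for mu
  have "(\<Sum>mu\<in>D. d mu * f mu) + (\<Sum>mu\<in>D'. d' mu * f mu) = (\<Sum>mu\<in>D \<union> D'. e mu * f mu)"
    for f :: "(nat \<Rightarrow> nat) \<Rightarrow> complex"
  proof -
    have "(\<Sum>mu\<in>D. d mu * f mu) = (\<Sum>mu\<in>D \<union> D'. (if mu \<in> D then d mu else 0) * f mu)"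
      "(\<Sum>mu\<in>D'. d' mu * f mu) = (\<Sum>mu\<in>D \<union> D'. (if mu \<in> D' then d' mu else 0) * f mu)"
      using 1(1) 2(1) by (auto intro!: sum.mono_neutral_cong_left)
    then show ?thesis by (simp add: e_def distrib_right sum.distrib)
  qed
  then show ?thesis using 1 2 unfolding rep_def
    by (intro exI[of _ "D \<union> D'"] exI[of _ e]) auto
qed

lemma rep_sum:
  assumes "finite S" "\<And>i. i \<in> S \<Longrightarrow> rep A (G i) (s i)"
  shows "rep A (\<lambda>x. \<Sum>i\<in>S. c i * G i x) (\<Sum>i\<in>S. c i * s i)"
  using assms
proof (induction S rule: finite_induct)
  case (insert i S)
  then have "rep A (\<lambda>x. c i * G i x + (\<Sum>i\<in>S. c i * G i x)) (c i * s i + (\<Sum>i\<in>S. c i * s i))"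
    by (intro rep_add rep_scale) auto
  then show ?case using insert.hyps by simp
qed (simp add: rep_zero)

text \<open>On x_n = 1 one may multiply B_mu by x_n freely. Each raising step with N = n keeps the
  represented value, so any larger size can be reached.\<close>

lemma rep_homogenize:
  assumes "mu \<in> adm n"
  shows "rep {nu \<in> adm n. absl n nu = absl n mu + j} (bm mu) (hw mu)"
  using assms
proof (induction j arbitrary: mu)
  case 0
  then show ?case by (intro rep_bm) simp
next
  case (Suc j)
  let ?A = "{nu \<in> adm n. absl n nu = absl n mu + Suc j}"
  have "rep ?A (\<lambda>x. \<Sum>k\<in>{1..n}. P ^ tail n mu k * bm (inc mu k) x) (\<Sum>k\<in>{1..n}. P ^ tail n mu k * hw (inc mu k))"
  proof (rule rep_sum)
    fix k assume "k \<in> {1..n}"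
    then show "rep ?A (bm (inc mu k)) (hw (inc mu k))"
      using Suc.IH[of "inc mu k"] Suc.prems by (simp add: inc_adm absl_inc)
  qed simp
  moreover have "(\<Sum>k\<in>{1..n}. P ^ tail n mu k * hw (inc mu k)) = hw mu"
    using hw_raise[of n mu] Suc.prems n_ge_2 by (simp add: adm_def)
  ultimately have "rep ?A (\<lambda>x. \<Sum>k\<in>{1..n}. P ^ tail n mu k * bm (inc mu k) x) (hw mu)" by (simp only:)
  then show ?case
  proof (rule rep_cong)
    fix x assume "good0 n x" "x n = 1"
    then show "bm mu x = (\<Sum>k\<in>{1..n}. P ^ tail n mu k * bm (inc mu k) x)"
      using bm_raise[of n x mu] by (simp add: good0_def)
  qed
qed

text \<open>Two representations of one function may involve B_mu of different degrees, which are
  dependent on x_n = 1. Raising everything to the common size N first brings the case within reach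
  of \<open>bm_independent\<close>.\<close>

lemma rep_unique_zero:
  assumes "rep (adm n) (\<lambda>_. 0) s"
  shows "s = 0"
proof -
  obtain D d where D: "finite D" "D \<subseteq> adm n" "s = (\<Sum>mu\<in>D. d mu * hw mu)"
    "\<forall>x. good0 n x \<longrightarrow> x n = 1 \<longrightarrow> 0 = (\<Sum>mu\<in>D. d mu * bm mu x)"
    using assms unfolding rep_def by blast
  define N where "N = Max (absl n ` D)"
  let ?A = "{nu \<in> adm n. absl n nu = N}"
  have "rep ?A (\<lambda>x. \<Sum>mu\<in>D. d mu * bm mu x) s"
    unfolding D(3)
  proof (rule rep_sum[OF D(1)])
    fix mu assume "mu \<in> D"
    then have "absl n mu \<le> N" "mu \<in> adm n" unfolding N_def using D by auto
    then show "rep ?A (bm mu) (hw mu)" using rep_homogenize[of mu "N - absl n mu"] by simp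
  qed
  then have "rep ?A (\<lambda>_. 0) s"
    by (rule rep_cong) (use D(4) in auto)
  then obtain E e where E: "finite E" "E \<subseteq> ?A" "s = (\<Sum>mu\<in>E. e mu * hw mu)"
    "\<forall>x. good0 n x \<longrightarrow> x n = 1 \<longrightarrow> 0 = (\<Sum>mu\<in>E. e mu * bm mu x)"
    unfolding rep_def by blast
  then have "e mu = 0" if "mu \<in> E" for mu
    using that by (intro bm_independent[of E N e]) auto
  then show ?thesis using E(3) by simp
qed

lemma rep_unique:
  assumes "rep (adm n) G s" "rep (adm n) G s'"
  shows "s = s'"
proof -
  have "rep (adm n) (\<lambda>x. G x + (- 1) * G x) (s + (- 1) * s')"
    by (intro rep_add rep_scale assms)
  then have "rep (adm n) (\<lambda>_. 0) (s - s')" by simp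
  then show ?thesis using rep_unique_zero by fastforce
qed

section \<open>Computing the functional from evaluations\<close>

abbreviation zw :: "nat \<Rightarrow> int" where "zw \<equiv> (\<lambda>_. 0)"

lemma bil_zw: "bil zw m = 0"
  by (simp add: bil_def)

text \<open>Only monomials with \<lambda> = \<mu> have weight 0, and those are the ones on which h_n
  lives; there the power of q from \<open>bil\<close> is trivial.\<close>

lemma rep_hn:
  assumes "f \<in> felem n"
  shows "rep (adm n) (\<lambda>x. ev x f zw) (hn n q f)"
proof -
  define c where "c = coords n q f"
  have c: "c \<in> cfams n" "finite (csupp c)" using coords[OF assms] by (auto simp: c_def cfams_def)
  define a where "a p = (if fst p = snd p then c p else 0)" for p
  have "rep (adm n) (\<lambda>x. \<Sum>p\<in>csupp c. a p * bm (fst p) x) (\<Sum>p\<in>csupp c. a p * hw (fst p))"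
    using c by (intro rep_sum rep_bm) (auto simp: cfams_def)
  moreover have "(\<Sum>p\<in>csupp c. a p * hw (fst p)) = hn n q f"
    unfolding hn_def c_def[symmetric] by (intro sum.cong) (auto simp: a_def hw_def)
  moreover have "ev x f zw = (\<Sum>p\<in>csupp c. a p * bm (fst p) x)" if "x 0 = 0" for x
  proof -
    have "zw = wt (fst p) (snd p) \<longleftrightarrow> fst p = snd p" for p :: "(nat \<Rightarrow> nat) \<times> (nat \<Rightarrow> nat)"
      by (auto simp: wt_def fun_eq_iff)
    then have "ev x (lin n c) zw = (\<Sum>p\<in>csupp c. a p * bm (fst p) x)"
      unfolding ev_lin[OF c(1)] by (intro sum.cong) (auto simp: a_def bil_zw)
    then show ?thesis using ev_coords[OF assms, of x zw] that by (simp add: c_def)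
  qed
  ultimately show ?thesis by (auto intro: rep_cong simp: good0_def)
qed

lemma hn_eqI: "f \<in> felem n \<Longrightarrow> rep (adm n) (\<lambda>x. ev x f zw) s \<Longrightarrow> hn n q f = s"
  using rep_unique rep_hn by blast

text \<open>Each factor x_(n-1) is absorbed by raising with N = n - 1, which keeps the last exponent
  0. One step costs (1 - T^(M-1)) / (1 - T^M) for M = |lam| + n, so the quotients telescope.\<close>

lemma rep_power_bm:
  assumes "lam \<in> adm n" "lam n = 0"
  shows "rep (adm n) (\<lambda>x. x (n - 1) ^ j * bm lam x)
    (hw lam * (1 - T ^ (absl n lam + n - 1)) / (1 - T ^ (absl n lam + j + n - 1)))"
  using assms
proof (induction j arbitrary: lam)
  case 0
  have "1 - T ^ (absl n lam + n - 1) \<noteq> 0" using n_ge_2 by simp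
  then show ?case using rep_bm[OF 0(1)] by simp
next
  case (Suc j)
  define M where "M = absl n lam + n"
  have M: "M - 1 = absl n lam + n - 1" "Suc (absl n lam) + n - 1 = M" "M = Suc (M - 1)"
    "Suc (absl n lam) + j + n - 1 = absl n lam + Suc j + n - 1"
    using n_ge_2 by (simp_all add: M_def)
  let ?D = "1 - T ^ (absl n lam + Suc j + n - 1)"
  have "rep (adm n) (\<lambda>x. \<Sum>k\<in>{1..n - 1}. P ^ tail (n - 1) lam k * (x (n - 1) ^ j * bm (inc lam k) x))
      (\<Sum>k\<in>{1..n - 1}. P ^ tail (n - 1) lam k * (hw (inc lam k) * (1 - T ^ M) / ?D))"
  proof (rule rep_sum)
    fix k assume k: "k \<in> {1..n - 1}"
    then have "inc lam k n = 0" "absl n (inc lam k) = Suc (absl n lam)" "inc lam k \<in> adm n"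
      using Suc.prems n_ge_2 by (auto simp: inc_def[of lam k] absl_inc[unfolded inc_def] intro!: adm_upd)
    then show "rep (adm n) (\<lambda>x. x (n - 1) ^ j * bm (inc lam k) x) (hw (inc lam k) * (1 - T ^ M) / ?D)"
      using Suc.IH[of "inc lam k"] by (simp only: M(2,4))
  qed simp
  moreover have "(\<Sum>k\<in>{1..n - 1}. P ^ tail (n - 1) lam k * (hw (inc lam k) * (1 - T ^ M) / ?D)) =
      hw lam * (1 - T ^ (absl n lam + n - 1)) / ?D"
  proof -
    have zero: "lam i = 0" if "n - 1 < i" for i
      using Suc.prems that by (cases "i = n") (auto simp: adm_def)
    have nn: "n - (n - 1) = 1" using n_ge_2 by simp
    have "(\<Sum>k\<in>{1..n - 1}. P ^ tail (n - 1) lam k * (hw (inc lam k) * (1 - T ^ M) / ?D)) =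
        (\<Sum>k\<in>{1..n - 1}. P ^ tail (n - 1) lam k * hw (inc lam k)) * ((1 - T ^ M) / ?D)"
      unfolding sum_distrib_right by (intro sum.cong) auto
    also have "\<dots> = hw lam * ((P - P ^ M) / (1 - P ^ M)) * ((1 - T ^ M) / ?D)"
      using hw_raise[of "n - 1" lam] Suc.prems zero unfolding nn by (simp add: M_def)
    also have "(P - P ^ M) / (1 - P ^ M) = (1 - T ^ (M - 1)) / (1 - T ^ M)"
    proof -
      obtain K where K: "M = Suc K" by (rule that[OF M(3)])
      have 1: "P * T ^ M = T ^ (M - 1)" unfolding K by (simp add: P_T)
      have 2: "T ^ (M - 1) * P ^ M = P" unfolding K using P_T_power[of K K] by (simp add: mult_ac)
      have 3: "P ^ M * T ^ M = 1" using P_T_power by blast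
      have "(P - P ^ M) * (1 - T ^ M) = (1 - T ^ (M - 1)) * (1 - P ^ M)"
        unfolding left_diff_distrib right_diff_distrib mult_1_left mult_1_right 1 2 3 by simp
      moreover have nz: "1 - P ^ M \<noteq> 0" "1 - T ^ M \<noteq> 0" using M_def n_ge_2 by simp_all
      ultimately show ?thesis using frac_eq_eq[OF nz] by blast
    qed
    also have "hw lam * ((1 - T ^ (M - 1)) / (1 - T ^ M)) * ((1 - T ^ M) / ?D) =
        hw lam * (1 - T ^ (M - 1)) / ?D"
    proof -
      have "1 - T ^ M \<noteq> 0" using M_def n_ge_2 by simp
      then show ?thesis by (simp add: mult.assoc)
    qed
    finally show ?thesis unfolding M(1) .
  qed
  ultimately have "rep (adm n) (\<lambda>x. \<Sum>k\<in>{1..n - 1}. P ^ tail (n - 1) lam k * (x (n - 1) ^ j * bm (inc lam k) x))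
      (hw lam * (1 - T ^ (absl n lam + n - 1)) / ?D)" by (simp only:)
  then show ?case
  proof (rule rep_cong)
    fix x assume "good0 n x"
    then have "x (n - 1) * bm lam x = (\<Sum>k\<in>{1..n - 1}. P ^ tail (n - 1) lam k * bm (inc lam k) x)"
      by (intro bm_raise) (auto simp: good0_def)
    then have "x (n - 1) ^ j * (x (n - 1) * bm lam x) =
        (\<Sum>k\<in>{1..n - 1}. P ^ tail (n - 1) lam k * (x (n - 1) ^ j * bm (inc lam k) x))"
      by (simp add: sum_distrib_left mult.left_commute)
    then show "x (n - 1) ^ Suc j * bm lam x =
        (\<Sum>k\<in>{1..n - 1}. P ^ tail (n - 1) lam k * (x (n - 1) ^ j * bm (inc lam k) x))"
      by (simp add: mult_ac)
  qed
qed

text \<open>The values for powers of x_(n-1) are proportional to the moments of \<open>Mp\<close>,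
  so h_n becomes a Jackson integral with an additional x^|lam|.\<close>

lemma rep_poly_bm:
  assumes "lam \<in> adm n" "lam n = 0"
  shows "rep (adm n) (\<lambda>x. poly p (x (n - 1)) * bm lam x)
    (hw lam * (1 - T ^ (absl n lam + n - 1)) * Mp (monom 1 (absl n lam) * p))"
proof -
  let ?C = "hw lam * (1 - T ^ (absl n lam + n - 1))"
  have "rep (adm n) (\<lambda>x. \<Sum>j\<le>degree p. coeff p j * (x (n - 1) ^ j * bm lam x))
      (\<Sum>j\<le>degree p. coeff p j * (?C / (1 - T ^ (absl n lam + j + n - 1))))"
    by (intro rep_sum rep_power_bm assms) simp
  moreover have "(\<Sum>j\<le>degree p. coeff p j * (?C / (1 - T ^ (absl n lam + j + n - 1)))) =
      ?C * Mp (monom 1 (absl n lam) * (\<Sum>j\<le>degree p. monom (coeff p j) j))"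
    by (simp add: sum_distrib_left mult_monom Mp_sum Mp_monom mult_ac)
  ultimately show ?thesis
    by (simp add: poly_as_sum_of_monoms) (erule rep_cong, simp add: poly_altdef sum_distrib_right mult.assoc)
qed

end

text \<open>The polynomial takes one value along an orbit of u -> c u, which is infinite because c
  is no root of unity. The exceptional point v reflects that the invariance will be known only after
  division by x_k - x_(k+1).\<close>

lemma poly_scale_invariant_const:
  fixes p :: "complex poly"
  assumes inv: "\<And>u. u \<noteq> v \<Longrightarrow> poly p (c * u) = poly p u"
    and c: "\<And>k. 0 < k \<Longrightarrow> c ^ k \<noteq> 1" and "c \<noteq> 0"
  shows "poly p u = poly p u'"
proof -
  \<comment> \<open>Starting at c v, the forward orbit never meets v: a return would make a positive
    power of c equal to 1. For v = 0 any nonzero start will do.\<close>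
  define u0 where "u0 = (if v = 0 then 1 else c * v)"
  have u0: "u0 \<noteq> 0" using \<open>c \<noteq> 0\<close> by (simp add: u0_def)
  have ne: "c ^ k * u0 \<noteq> v" for k
    using c[of "Suc k"] \<open>c \<noteq> 0\<close> by (auto simp: u0_def mult.assoc[symmetric] power_Suc2 simp del: power_Suc)
  have const: "poly p (c ^ k * u0) = poly p u0" for k
    by (induction k) (use inv[OF ne] in \<open>simp_all add: mult.assoc\<close>)
  have "inj (\<lambda>k. c ^ k * u0)"
  proof (rule injI)
    have *: "i = j" if "c ^ i = c ^ j" "i \<le> j" for i j
    proof -
      have "c ^ j = c ^ i * c ^ (j - i)" using that(2) by (simp flip: power_add)
      then have "c ^ (j - i) = 1" using that(1) \<open>c \<noteq> 0\<close> by simp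
      then show ?thesis using c[of "j - i"] that(2) by (cases "j - i") auto
    qed
    fix i j assume "c ^ i * u0 = c ^ j * u0"
    then show "i = j" using u0 *[of i j] *[of j i] by (cases "i \<le> j") auto
  qed
  moreover have "range (\<lambda>k. c ^ k * u0) \<subseteq> {x. poly (p - [:poly p u0:]) x = 0}"
    using const by auto
  ultimately have "p - [:poly p u0:] = 0"
    using poly_roots_finite[of "p - [:poly p u0:]"] finite_subset range_inj_infinite by blast
  then have "p = [:poly p u0:]" by simp
  then show ?thesis by (metis add.right_neutral mult_zero_right poly_0 poly_pCons)
qed

locale qsphere_bideg = qsphere +
  fixes l m :: nat
begin

text \<open>Truncated subtraction leaves at least one of \<open>a\<close> and \<open>b\<close> equal
  to 0, so z_n^a p(Q_(n-1)) w_n^b covers both cases of the spherical element.\<close>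

definition a :: nat where "a = l - m"
definition b :: nat where "b = m - l"
definition d :: nat where "d = min l m"

lemma abd: "a = 0 \<or> b = 0" "l = d + a" "m = d + b"
  by (auto simp: a_def b_def d_def)

definition hs :: "nat \<Rightarrow> int" where
  "hs = (\<lambda>i. if i = n then int a - int b else 0)"

text \<open>The shift by \<open>P^b\<close> comes from moving a polynomial in \<open>Q_{n-1}\<close> past \<open>w_n^b\<close>.\<close>

definition zonal :: "complex poly \<Rightarrow> fa \<Rightarrow> bool" where
  "zonal g f \<longleftrightarrow> (\<forall>x h. x 0 = 0 \<longrightarrow> x n = 1 \<longrightarrow> ev x f h =
    (if h = hs then poly (pip b) (x (n - 1)) * poly g (P ^ b * x (n - 1)) else 0))"

lemma zonalD: "zonal g f \<Longrightarrow> x 0 = 0 \<Longrightarrow> x n = 1 \<Longrightarrow> ev x f h =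
    (if h = hs then poly (pip b) (x (n - 1)) * poly g (P ^ b * x (n - 1)) else 0)"
  unfolding zonal_def by blast

section \<open>Evaluation of the spherical element\<close>

lemma fone_fmul: "fmul fone f = f"
proof
  fix w
  have "fmul (\<lambda>u. 0) f w = 0" for w by (simp add: fmul_def)
  then show "fmul fone f w = f w"
    by (cases w) (simp_all add: fmul_Nil fmul_Cons fone_def)
qed

lemma fpow_fgen: "fpow (fgen g) k = wd (replicate k g)"
  by (induction k) (simp_all add: fone_wd fgen_wd fmul_wd)

abbreviation cf :: "nat \<Rightarrow> complex" where
  "cf k \<equiv> of_real (ljac_coeff (n - 2) (a + b) d (q\<^sup>2) k)"

abbreviation Qz :: fa where "Qz \<equiv> Qel (n - Suc 0)"
abbreviation zna :: fa where "zna \<equiv> fpow (fgen (Zg n)) a"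
abbreviation wnb :: fa where "wnb \<equiv> fpow (fgen (Wg n)) b"

lemma Rel_conv: "Rel n q l m = (\<lambda>w. \<Sum>k\<le>d. cf k * fmul zna (fmul (fpow Qz k) wnb) w)"
proof -
  let ?L = "\<lambda>w. \<Sum>k\<le>d. cf k * fpow Qz k w"
  have "Rel n q l m = fmul zna (fmul ?L wnb)"
  proof (cases "m \<le> l")
    case True
    then have "d = m" "b = 0" by (auto simp: d_def b_def)
    then show ?thesis using True by (simp add: Rel_def ljacP_def fmul_fone a_def b_def)
  next
    case False
    then have "d = l" "a = 0" by (auto simp: d_def a_def)
    then show ?thesis using False by (simp add: Rel_def ljacP_def fone_fmul a_def b_def)
  qed
  then show ?thesis by (simp only: fmul_sum_left fmul_sum_right)
qed

lemma felems: "zna \<in> felem n" "wnb \<in> felem n" "fpow Qz k \<in> felem n" "fpow (Qel n) j \<in> felem n"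
  using n_ge_2 by (auto intro!: felem_fpow felem_fgen felem_Qel)

lemma felem_Rel: "Rel n q l m \<in> felem n"
  unfolding Rel_conv by (intro felem_sum felem_fmul felems) simp

lemma aop_fpow_Qel:
  assumes "i \<le> n" "x 0 = 0"
  shows "aop x (fpow (Qel i) k) F h = (qp (2 * hi i h) * x i) ^ k * F h"
proof (induction k arbitrary: h)
  case 0
  then show ?case by (simp add: fone_wd)
next
  case (Suc k)
  have "aop x (fpow (Qel i) (Suc k)) F h = aop x (Qel i) (aop x (fpow (Qel i) k) F) h"
    using assms(1) by (simp add: aop_fmul felem_ffin[of _ n] felem_Qel felem_fpow)
  then show ?case using assms by (simp add: aop_Qel Suc)
qed

text \<open>w_n^b acts first and brings the exponent of S_n to -b; on such a term Q_(n-1) acts by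
  q^(-2b) x_(n-1).\<close>

lemma ev_summand:
  assumes x: "x 0 = 0" "x n = 1"
  shows "ev x (fmul zna (fmul (fpow Qz k) wnb)) h =
    (if h = hs then poly (pip b) (x (n - 1)) * (P ^ b * x (n - 1)) ^ k else 0)"
proof -
  define h' where "h' = h(n := h n - int a)"
  have "ev x (fmul zna (fmul (fpow Qz k) wnb)) h =
      qp (- (int a * lo n h)) * ((qp (2 * hi (n - 1) h') * x (n - 1)) ^ k *
      (qp (int b * (lo n h' + 2 * hi n h')) * wfac x n (h' n + int b) b * vac (h'(n := h' n + int b))))"
    unfolding ev_def using x n_ge_2
    by (simp add: aop_fmul felem_ffin[of _ n] felem_fmul felems)
      (simp add: aop_fpow_Qel h'_def[symmetric] fpow_fgen act_replicate_Zg act_replicate_Wg)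
  moreover have "vac (h'(n := h' n + int b)) = (if h = hs then 1 else 0)"
    unfolding vac_def h'_def hs_def by (auto simp: fun_eq_iff)
  moreover have "lo n hs = 0" by (simp add: lo_def hs_def)
  moreover have "lo n h' = 0" if "h = hs" using that by (simp add: lo_def h'_def hs_def)
  moreover have "hi n h' = 0" by (simp add: hi_def)
  moreover have "h' n + int b = 0" if "h = hs" using that by (simp add: h'_def hs_def)
  moreover have "hi (n - 1) h' = - int b" if "h = hs"
    using that n_ge_2 hi_Suc[of n h'] by (simp add: h'_def hs_def hi_def)
  moreover have "qp (2 * - int b) = P ^ b" by (simp add: P_power)
  moreover have "wfac x n 0 b = poly (pip b) (x (n - 1))"
    using x by (simp add: wfac_fac fac_def pip_def poly_prod mult.commute)
  ultimately show ?thesis by (cases "h = hs") simp_all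
qed

lemma zonal_Rel: "zonal (jac (a + b) d) (Rel n q l m)"
  unfolding zonal_def
proof (intro allI impI)
  fix x :: "nat \<Rightarrow> complex" and h assume x: "x 0 = 0" "x n = 1"
  let ?Y = "P ^ b * x (n - 1)"
  have "ev x (Rel n q l m) h =
      (\<Sum>k\<le>d. cf k * (if h = hs then poly (pip b) (x (n - 1)) * ?Y ^ k else 0))"
    unfolding ev_def Rel_conv
    by (subst aop_sum) (auto simp: felem_ffin[of _ n] felem_fmul felems ev_summand[OF x, unfolded ev_def])
  also have "\<dots> = (if h = hs then poly (pip b) (x (n - 1)) * (\<Sum>k\<le>d. cf k * ?Y ^ k) else 0)"
    by (simp add: sum_distrib_left mult.left_commute)
  also have "(\<Sum>k\<le>d. cf k * ?Y ^ k) = poly (jac (a + b) d) ?Y"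
    by (simp add: jac_def poly_sum poly_monom)
  finally show "ev x (Rel n q l m) h = (if h = hs then poly (pip b) (x (n - 1)) * poly (jac (a + b) d) ?Y else 0)" .
qed

lemma Rel_not_Jz: "Rel n q l m \<notin> Jz n q"
proof
  assume J: "Rel n q l m \<in> Jz n q"
  \<comment> \<open>At x_(n-1) = 0 both the Jacobi polynomial and \<open>pip b\<close> take the
    value 1.\<close>
  define x :: "nat \<Rightarrow> complex" where "x i = (if i = n then 1 else 0)" for i
  have x: "x 0 = 0" "x n = 1" "x (n - 1) = 0" using n_ge_2 by (auto simp: x_def)
  have "ev x (Rel n q l m) hs = 0" unfolding ev_def using J x by (intro aop_Jz)
  moreover have "poly (pip b) 0 = 1" by (simp add: pip_def poly_prod)
  moreover have "poly (jac (a + b) d) 0 = 1" by (simp add: poly_0_coeff_0 coeff_jac_0)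
  ultimately show False using zonalD[OF zonal_Rel x(1,2), of hs] x(3) by simp
qed

text \<open>The summands have different bidegrees. Padding the k-th one with Q_n^(d-k) gives a
  congruent element that is bihomogeneous of bidegree (l, m).\<close>

lemma inZt_Rel: "inZt n q l m (Rel n q l m)"
proof -
  define g where "g k = fmul zna (fmul (fmul (fpow Qz k) (fpow (Qel n) (d - k))) wnb)" for k
  define G where "G = (\<lambda>w. \<Sum>k\<le>d. cf k * g k w)"
  have hom: "g k \<in> fhom l m" if "k \<le> d" for k
  proof -
    have "fgen (Zg n) \<in> fhom 1 0" "fgen (Wg n) \<in> fhom 0 1"
      unfolding fgen_wd using n_ge_2 by (auto intro!: fhom_wd)
    then have "g k \<in> fhom (a * 1 + (k * 1 + (d - k) * 1 + b * 0)) (a * 0 + (k * 1 + (d - k) * 1 + b * 1))"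
      unfolding g_def by (intro fhom_fmul fhom_fpow fhom_Qel) auto
    moreover have "a * 1 + (k * 1 + (d - k) * 1 + b * 0) = l" "a * 0 + (k * 1 + (d - k) * 1 + b * 1) = m"
      using that abd by auto
    ultimately show ?thesis by (simp only:)
  qed
  then have "G \<in> fhom l m" unfolding G_def by (intro fhom_sum) auto
  then obtain c where c: "c \<in> cfams n" "\<forall>p\<in>csupp c. bideg l m p" "fsub G (lin n c) \<in> Iz n q"
    using fhom_spanned unfolding spanned_def by blast
  have Gfe: "G \<in> felem n" using \<open>G \<in> fhom l m\<close> fhom_felem by blast
  have "ev x (Rel n q l m) h = ev x (lin n c) h" if "good0 n x" "x n = 1" for x h
  proof -
    have x: "x 0 = 0" using that by (simp add: good0_def)
    have Qn: "aop x (fpow (Qel n) j) F = F" for j F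
      using aop_fpow_Qel[of n x j F] x that by (auto simp: hi_def)
    have "aop x (g k) vac h = aop x (fmul zna (fmul (fpow Qz k) wnb)) vac h" for k
      unfolding g_def by (simp add: aop_fmul felem_ffin[of _ n] felem_fmul felems Qn)
    moreover have "g k \<in> ffin" for k
      unfolding g_def by (intro felem_ffin[of _ n] felem_fmul felems)
    ultimately have "ev x G h = ev x (Rel n q l m) h"
      unfolding ev_def G_def Rel_conv
      by (subst (1 2) aop_sum) (auto simp: felem_ffin[of _ n] felem_fmul felems)
    moreover have "ev x G h = ev x (lin n c) h"
      unfolding ev_def using c Gfe x by (intro ev_cong_Iz felem_lin)
    ultimately show ?thesis by simp
  qed
  then have "fsub (Rel n q l m) (lin n c) \<in> Jz n q"
    using c felem_Rel felem_lin[of c n]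
    by (subst Jz_iff) (auto simp: felem_fsub ev_def aop_fsub felem_ffin[of _ n])
  then show ?thesis unfolding inZt_def using c by blast
qed

text \<open>The evaluation lives on a weight that vanishes below n and depends on x_(n-1) only,
  while e_k and f_k with k \<le> n - 2 scale x_k. Both values in the q-difference formula agree, and
  their coefficients cancel on this weight.\<close>

lemma invariant_Rel: "invariant n q 1 (Rel n q l m)"
proof -
  let ?R = "Rel n q l m"
  have qeps: "fsub (opapp n q (qeps_b n q i) ?R) ?R \<in> Jz n q" if "1 \<le> i" "i \<le> n - 1" for i
  proof -
    have fe: "opapp n q (qeps_b n q i) ?R \<in> felem n"
      by (intro felem_opapp qeps_b_felem felem_Rel)
    have "ev x (fsub (opapp n q (qeps_b n q i) ?R) ?R) h = 0" if x: "good0 n x" "x n = 1" for x h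
    proof -
      have "ev x (fsub (opapp n q (qeps_b n q i) ?R) ?R) h = (qp (h i) - 1) * ev x ?R h"
        using fe felem_Rel ev_qeps[OF felem_Rel, of x i h] x
        by (simp add: ev_def aop_fsub felem_ffin[of _ n] good0_def algebra_simps)
      moreover have "hs i = 0" using that(2) \<open>i \<le> n - 1\<close> n_ge_2 by (auto simp: hs_def)
      ultimately show ?thesis using zonalD[OF zonal_Rel, of x h] x by (auto simp: good0_def)
    qed
    then show ?thesis using fe by (subst Jz_iff) (auto intro: felem_fsub felem_Rel)
  qed
  have ef: "opapp n q (e_b n q k) ?R \<in> Jz n q" "opapp n q (f_b n q k) ?R \<in> Jz n q"
    if k: "1 \<le> k" "k \<le> n - 1 - 1" for k
  proof -
    have k': "1 \<le> k" "k < n" "Suc k \<noteq> n" "k \<noteq> n - 1" "k \<noteq> n" using k n_ge_2 by auto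
    have hsk: "hs k = 0" "hs (Suc k) = 0" using k' by (auto simp: hs_def)
    have "ev x (opapp n q (e_b n q k) ?R) h' = 0" if x: "good0 n x" "x n = 1" for x h'
    proof -
      have x0: "x 0 = 0" "x k \<noteq> 0" using x k' by (auto simp: good0_def)
      define h where "h = h'(k := h' k - 1, Suc k := h' (Suc k) + 1)"
      have "ev (x(k := P * x k)) ?R h = ev x ?R h"
        using zonalD[OF zonal_Rel, of "x(k := P * x k)" h] zonalD[OF zonal_Rel, of x h] x0 x k' by simp
      then have "(1 - P) * x k * ev x (opapp n q (e_b n q k) ?R) h' =
          qp (h k) * (x k * (1 - qp (- 2 * h (Suc k)))) * ev x ?R h"
        unfolding ev_e[where x = x, OF k'(1,2) felem_Rel x0(1) h_def] by (simp add: algebra_simps)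
      moreover have "ev x ?R h = 0 \<or> h (Suc k) = 0"
        using zonalD[OF zonal_Rel, of x h] x0 x hsk by auto
      ultimately show ?thesis using x0 by auto
    qed
    then show "opapp n q (e_b n q k) ?R \<in> Jz n q"
      by (subst Jz_iff) (auto intro!: felem_opapp e_b_felem felem_Rel)
    have "ev x (opapp n q (f_b n q k) ?R) h' = 0" if x: "good0 n x" "x n = 1" for x h'
    proof -
      have x0: "x 0 = 0" "x k \<noteq> 0" using x k' by (auto simp: good0_def)
      define h where "h = h'(k := h' k + 1, Suc k := h' (Suc k) - 1)"
      have "ev (x(k := x k / P)) ?R h = ev x ?R h"
        using zonalD[OF zonal_Rel, of "x(k := x k / P)" h] zonalD[OF zonal_Rel, of x h] x0 x k' by simp
      then have "(1 - P) * x k * ev x (opapp n q (f_b n q k) ?R) h' =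
          qp (h (Suc k)) * (x k * (1 - qp (- 2 * h k))) * ev x ?R h"
        unfolding ev_f[where x = x, OF k'(1,2) felem_Rel x0(1) h_def] by (simp add: algebra_simps)
      moreover have "ev x ?R h = 0 \<or> h k = 0"
        using zonalD[OF zonal_Rel, of x h] x0 x hsk by auto
      ultimately show ?thesis using x0 by auto
    qed
    then show "opapp n q (f_b n q k) ?R \<in> Jz n q"
      by (subst Jz_iff) (auto intro!: felem_opapp f_b_felem felem_Rel)
  qed
  show ?thesis unfolding invariant_def using qeps ef by blast
qed

section \<open>Inner products\<close>

text \<open>This is the contribution of w_n^(a+c) acting on a term with S_n-exponent a - b at x_n =
  1. The first a factors carry positive powers of T and form \<open>rho a\<close>; the others form
  \<open>pip c\<close>.\<close>

lemma rho_pip_shift: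
  "(\<Prod>r<a + c. 1 - qp (2 * (int a - int b - int r)) * y) = poly (rho a * pip c) (P ^ b * y)"
proof -
  let ?Y = "P ^ b * y"
  have t: "qp (2 * (int a - int b - int r)) * y = qp (2 * (int a - int r)) * ?Y" for r
  proof -
    have "2 * (int a - int b - int r) = 2 * (int a - int r) + - (2 * int b)" by simp
    then show ?thesis unfolding P_power by (simp only: qp_add mult.assoc)
  qed
  have "(\<Prod>r<a + c. 1 - qp (2 * (int a - int r)) * ?Y) =
      (\<Prod>r<a. 1 - qp (2 * (int a - int r)) * ?Y) * (\<Prod>r<c. 1 - qp (2 * (int a - int (a + r))) * ?Y)"
    by (induction c) (simp_all add: mult.assoc)
  also have "(\<Prod>r<a. 1 - qp (2 * (int a - int r)) * ?Y) = (\<Prod>j<a. 1 - T ^ Suc j * ?Y)"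
    by (rule prod.reindex_bij_witness[of _ "\<lambda>j. a - Suc j" "\<lambda>r. a - Suc r"])
      (auto simp: T_power of_nat_diff simp del: power_Suc)
  also have "(\<Prod>r<c. 1 - qp (2 * (int a - int (a + r))) * ?Y) = (\<Prod>r<c. 1 - P ^ r * ?Y)"
    by (simp add: P_power)
  finally show ?thesis unfolding t by (simp add: rho_def pip_def poly_prod mult.commute)
qed

text \<open>\<open>mono n mu lam\<close> is the star of \<open>mono n lam mu\<close>, so this is the
  inner product of f with a monomial of bidegree (l - 1, m - 1). Unless the weights agree, the
  product has no part of weight 0. If they agree, the coordinates below n give a B_L of size t,
  coordinate n gives \<open>rho a\<close> and \<open>pip (d - 1 - t)\<close>, and the functional
  integrates out the rest.\<close>

lemma hn_mono_zonal:
  assumes f: "f \<in> felem n" "zonal g f" and adm: "lam \<in> adm n" "mu \<in> adm n"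
    and deg: "Suc (absl n lam) = l" "Suc (absl n mu) = m"
  defines "t \<equiv> absl n (lam(n := 0))"
  shows "if wt lam mu = hs
    then t < d \<and> (\<exists>K. K \<noteq> 0 \<and> hn n q (fmul (mono n mu lam) f) =
      K * Mp (rho (a + b) * (monom 1 t * pip (d - 1 - t) * g)))
    else hn n q (fmul (mono n mu lam) f) = 0"
proof -
  let ?z = "fmul (mono n mu lam) f"
  have zfe: "?z \<in> felem n" using f by (intro felem_fmul felem_mono)
  have g: "(\<lambda>i. zw i - int (mu i) + int (lam i)) = wt lam mu" by (auto simp: wt_def)
  have g': "zw i - int (mu i) + int (lam i) = wt lam mu i" for i by (simp add: wt_def)
  define E where "E = - (\<Sum>i\<in>{1..n}. int (mu i) * lo i (\<lambda>i. zw i - int (mu i))) +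
      (\<Sum>i\<in>{1..n}. int (lam i) * (lo i (\<lambda>i. zw i - int (mu i)) + 2 * hi i (wt lam mu)))"
  have ez: "ev x ?z zw = qp E * (\<Prod>i\<in>{1..n}. wfac x i (wt lam mu i) (lam i)) * ev x f (wt lam mu)" for x
  proof -
    have "ev x ?z zw = act x (monow n mu lam) (ev x f) zw"
      unfolding ev_def using f by (simp add: aop_fmul felem_ffin[of _ n] felem_mono) (simp add: mono_wd)
    then show ?thesis unfolding act_monow[OF adm(2,1)] Let_def g g' E_def .
  qed
  show ?thesis
  proof (cases "wt lam mu = hs")
    case False
    have "rep (adm n) (\<lambda>x. ev x ?z zw) 0"
      by (rule rep_cong[OF rep_zero]) (use zonalD[OF f(2)] False in \<open>simp add: ez good0_def\<close>)
    then show ?thesis using hn_eqI[OF zfe] False by simp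
  next
    case True
    define L where "L = lam(n := 0)"
    have lam': "L \<in> adm n" "L n = 0" using adm n_ge_2 by (auto simp: L_def intro!: adm_upd)
    have split: "absl n nu = absl n (nu(n := 0)) + nu n" for nu :: "nat \<Rightarrow> nat"
      unfolding absl_def using n_ge_2 by (subst (1 2) sum.remove[of _ n]) auto
    have lm: "lam(n := 0) = mu(n := 0)" "int (lam n) - int (mu n) = int a - int b"
      using True unfolding wt_def hs_def by (auto simp: fun_eq_iff split: if_splits)
    \<comment> \<open>Counting degrees: \<lambda> and \<mu> agree below n with common size t, and
      the 1 is the drop from (l, m) to (l - 1, m - 1).\<close>
    have "t + lam n + 1 = d + a" using split[of lam] deg abd(2) by (simp add: t_def)
    moreover have "t + mu n + 1 = d + b" using split[of mu] deg abd(3) lm(1) by (simp add: t_def)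
    ultimately have td: "t < d" and ln: "lam n = a + (d - 1 - t)" using abd(1) by auto
    define c where "c = d - 1 - t"
    define p where "p = pip b * pcompose (rho a * pip c * g) [:0, P ^ b:]"
    have zp: "ev x ?z zw = qp E * (poly p (x (n - 1)) * bm L x)" if "good0 n x" "x n = 1" for x
    proof -
      have ins: "{1..n} = insert n {1..<n}" using n_ge_2 by auto
      have "(\<Prod>i\<in>{1..n}. wfac x i (wt lam mu i) (lam i)) =
          wfac x n (int a - int b) (a + c) * (\<Prod>i\<in>{1..<n}. wfac x i 0 (lam i))"
        unfolding ins True using ln by (simp add: hs_def c_def)
      also have "(\<Prod>i\<in>{1..<n}. wfac x i 0 (lam i)) = bm L x"
        unfolding bm_def ins L_def by (simp add: wfac_def)
      also have "wfac x n (int a - int b) (a + c) = poly (rho a * pip c) (P ^ b * x (n - 1))"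
        unfolding wfac_def that(2) by (rule rho_pip_shift)
      finally show ?thesis
        using zonalD[OF f(2), of x hs] that
        by (simp add: ez True good0_def p_def poly_pcompose) (simp add: mult_ac)
    qed
    let ?K0 = "qp E * (hw L * (1 - T ^ (t + n - 1)))"
    have "rep (adm n) (\<lambda>x. qp E * (poly p (x (n - 1)) * bm L x))
        (qp E * (hw L * (1 - T ^ (t + n - 1)) * Mp (monom 1 t * p)))"
      unfolding t_def L_def[symmetric] by (intro rep_scale rep_poly_bm lam')
    then have "rep (adm n) (\<lambda>x. ev x ?z zw) (qp E * (hw L * (1 - T ^ (t + n - 1)) * Mp (monom 1 t * p)))"
      by (rule rep_cong) (rule zp)
    then have hn: "hn n q ?z = ?K0 * Mp (monom 1 t * p)" using hn_eqI[OF zfe] by (simp add: mult.assoc)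
    have K0: "?K0 \<noteq> 0" using n_ge_2 by simp
    have tt: "T ^ (b * t) * P ^ (b * t) = 1" using P_T_power by (simp add: mult.commute)
    have "smult (T ^ (b * t)) (pip b * pcompose (monom 1 t * (rho a * pip c * g)) [:0, P ^ b:]) = monom 1 t * p"
    proof -
      have "pcompose (monom 1 t) [:0, P ^ b:] = monom (P ^ (b * t)) t"
        by (simp add: pcompose_monom_scale power_mult)
      then have "pip b * pcompose (monom 1 t * (rho a * pip c * g)) [:0, P ^ b:] = monom (P ^ (b * t)) t * p"
        by (simp add: pcompose_mult p_def mult_ac)
      moreover have "smult (T ^ (b * t)) (monom (P ^ (b * t)) t * p) = monom 1 t * p"
        unfolding mult_smult_left[symmetric] smult_monom tt ..
      ultimately show ?thesis by (simp only:)
    qed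
    then have "Mp (monom 1 t * p) =
        Mp (smult (T ^ (b * t)) (pip b * pcompose (monom 1 t * (rho a * pip c * g)) [:0, P ^ b:]))"
      by (simp only:)
    then have "Mp (monom 1 t * p) = T ^ (b * t) * (T ^ (b * (n - 1)) * Mp (rho b * (monom 1 t * (rho a * pip c * g))))"
      by (simp only: Mp_smult Mp_pip_pcompose)
    \<comment> \<open>\<open>rho\<close> is not multiplicative in its index; the equation holds
      because a or b is 0 and \<open>rho 0\<close> is 1.\<close>
    moreover have "rho b * (monom 1 t * (rho a * pip c * g)) = rho (a + b) * (monom 1 t * pip c * g)"
      using abd(1) by (auto simp: rho_def[of 0] mult_ac)
    ultimately have "hn n q ?z = (?K0 * T ^ (b * t) * T ^ (b * (n - 1))) * Mp (rho (a + b) * (monom 1 t * pip (d - 1 - t) * g))"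
      unfolding hn c_def by (simp only: mult.assoc)
    moreover have "?K0 * T ^ (b * t) * T ^ (b * (n - 1)) \<noteq> 0" using K0 by simp
    ultimately have "\<exists>K. K \<noteq> 0 \<and> hn n q ?z =
        K * Mp (rho (a + b) * (monom 1 t * pip (d - 1 - t) * g))" by blast
    then show ?thesis using True td by simp
  qed
qed

lemma fstar_mono: "fstar (mono n lam mu) = mono n mu lam"
  by (simp add: mono_wd fstar_wd monow_conv rev_map comp_def)

text \<open>The second argument matters only modulo \<open>Jz\<close>: the involution preserves the
  ideal, and h_n is determined by evaluations at x_n = 1. So y may be expanded in any way into
  monomials.\<close>

lemma ip_conv:
  assumes f: "f \<in> felem n" and c: "c \<in> cfams n" "fsub y (lin n c) \<in> Jz n q" and y: "y \<in> felem n"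
  shows "ip n q f y = (\<Sum>p\<in>csupp c. cnj (c p) * hn n q (fmul (mono n (snd p) (fst p)) f))"
proof -
  have fin: "finite (csupp c)" using c by (simp add: cfams_def)
  have star: "fstar (lin n c) = (\<lambda>w. \<Sum>p\<in>csupp c. cnj (c p) * mono n (snd p) (fst p) w)"
    unfolding lin_def by (simp add: fstar_sum fstar_mono)
  have fe: "fstar (lin n c) \<in> felem n" "fstar y \<in> felem n"
    using c y by (auto intro!: felem_fstar felem_lin)
  have J: "fsub (fstar y) (fstar (lin n c)) \<in> Jz n q"
    using fstar_Jz[OF c(2)] by (simp add: fstar_lin)
  have "rep (adm n) (\<lambda>x. \<Sum>p\<in>csupp c. cnj (c p) * ev x (fmul (mono n (snd p) (fst p)) f) zw)
      (\<Sum>p\<in>csupp c. cnj (c p) * hn n q (fmul (mono n (snd p) (fst p)) f))"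
    using fin f by (intro rep_sum rep_hn felem_fmul felem_mono)
  then have "rep (adm n) (\<lambda>x. ev x (fmul (fstar y) f) zw)
      (\<Sum>p\<in>csupp c. cnj (c p) * hn n q (fmul (mono n (snd p) (fst p)) f))"
  proof (rule rep_cong)
    fix x assume x: "good0 n x" "x n = 1"
    have "ev x (fmul (fstar y) f) zw = aop x (fstar y) (ev x f) zw"
      unfolding ev_def using f fe by (simp add: aop_fmul felem_ffin[of _ n])
    also have "\<dots> = aop x (fstar (lin n c)) (ev x f) zw"
      using J fe x by (intro ev_cong_Jz) (auto simp: good0_def)
    also have "\<dots> = (\<Sum>p\<in>csupp c. cnj (c p) * aop x (mono n (snd p) (fst p)) (ev x f) zw)"
      unfolding star using fin by (subst aop_sum) (auto simp: mono_wd wd_ffin)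
    also have "\<dots> = (\<Sum>p\<in>csupp c. cnj (c p) * ev x (fmul (mono n (snd p) (fst p)) f) zw)"
      unfolding ev_def using f by (simp add: aop_fmul felem_ffin[of _ n] felem_mono)
    finally show "ev x (fmul (fstar y) f) zw =
        (\<Sum>p\<in>csupp c. cnj (c p) * ev x (fmul (mono n (snd p) (fst p)) f) zw)" .
  qed
  then show ?thesis unfolding ip_def using f fe by (intro hn_eqI felem_fmul)
qed

lemma inZt_felem:
  assumes "inZt n q l' m' y"
  shows "y \<in> felem n"
proof -
  obtain c where c: "c \<in> cfams n" "fsub y (lin n c) \<in> Jz n q" using assms by (auto simp: inZt_def)
  then have "fadd (fsub y (lin n c)) (lin n c) \<in> felem n"
    by (intro felem_fadd felem_lin) (auto dest: Jz_felem)
  then show ?thesis by (simp add: fadd_def fsub_def)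
qed

lemma inHt_Rel: "inHt n q l m (Rel n q l m)"
  unfolding inHt_def
proof (intro conjI inZt_Rel impI allI)
  fix y assume lm: "1 \<le> l \<and> 1 \<le> m" and y: "inZt n q (l - 1) (m - 1) y"
  obtain c where c: "c \<in> cfams n" "\<forall>p\<in>csupp c. absl n (fst p) = l - 1 \<and> absl n (snd p) = m - 1"
    "fsub y (lin n c) \<in> Jz n q" using y by (auto simp: inZt_def)
  have "hn n q (fmul (mono n (snd p) (fst p)) (Rel n q l m)) = 0" if p: "p \<in> csupp c" for p
  proof -
    have "fst p \<in> adm n" "snd p \<in> adm n" "Suc (absl n (fst p)) = l" "Suc (absl n (snd p)) = m"
      using c p lm by (auto simp: cfams_def)
    from hn_mono_zonal[OF felem_Rel zonal_Rel this] show ?thesis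
      using jac_orthogonal_pip[of _ d "a + b"] by (auto split: if_splits)
  qed
  then show "ip n q (Rel n q l m) y = 0"
    using ip_conv[OF felem_Rel c(1,3) inZt_felem[OF y]] by simp
qed

text \<open>Orthogonality to one suitable monomial for each t < d already yields all the conditions
  that \<open>jac_unique\<close> asks for.\<close>

lemma ip_zonal_unique:
  assumes f: "inHt n q l m f" "f \<in> felem n" "zonal g f" "degree g \<le> d"
  shows "\<exists>c. g = smult c (jac (a + b) d)"
proof (rule jac_unique[OF f(4)])
  fix t assume t: "t < d"
  then have lm: "1 \<le> l" "1 \<le> m" by (auto simp: d_def)
  \<comment> \<open>The test monomial uses coordinates 1 and n only, which are distinct as n \<ge>
    2: exponent t at 1, and at n whatever gives bidegree (l - 1, m - 1). Its weight is then
    \<open>hs\<close>.\<close>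
  define lam where "lam = (\<lambda>i. if i = 1 then t else if i = n then l - 1 - t else 0)"
  define mu where "mu = (\<lambda>i. if i = 1 then t else if i = n then m - 1 - t else 0)"
  have adm: "lam \<in> adm n" "mu \<in> adm n" using n_ge_2 by (auto simp: lam_def mu_def adm_def)
  have ab: "absl n (\<lambda>i. if i = 1 then t else if i = n then k else 0) = t + k" for k
  proof -
    have "absl n (\<lambda>i. if i = 1 then t else if i = n then k else 0) =
        (\<Sum>i\<in>{1, n}. if i = 1 then t else if i = n then k else 0)"
      unfolding absl_def using n_ge_2 by (intro sum.mono_neutral_right) auto
    then show ?thesis using n_ge_2 by simp
  qed
  have deg: "Suc (absl n lam) = l" "Suc (absl n mu) = m"
    unfolding lam_def mu_def ab using t by (auto simp: d_def)
  have wt: "wt lam mu = hs"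
    using t n_ge_2 by (auto simp: wt_def hs_def lam_def mu_def fun_eq_iff a_def b_def d_def)
  have "lam(n := 0) = (\<lambda>i. if i = 1 then t else if i = n then 0 else 0)"
    using n_ge_2 by (auto simp: lam_def)
  then have tl: "absl n (lam(n := 0)) = t" using ab[of 0] by simp
  have y: "inZt n q (l - 1) (m - 1) (mono n lam mu)"
    unfolding inZt_def using deg
    by (intro bexI[of _ "delta lam mu"])
      (auto simp: csupp_delta lin_delta Jz_def gideal_refl intro: cfams_delta adm)
  then have "ip n q f (mono n lam mu) = 0" using f(1) lm unfolding inHt_def by blast
  moreover have "ip n q f (mono n lam mu) = hn n q (fmul (mono n mu lam) f)"
    using ip_conv[OF f(2) cfams_delta[OF adm], of "mono n lam mu"]
    by (simp add: csupp_delta lin_delta Jz_def gideal_refl felem_mono) (simp add: delta_def)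
  ultimately show "Mp (rho (a + b) * (monom 1 t * pip (d - 1 - t) * g)) = 0"
    using hn_mono_zonal[OF f(2,3) adm deg] wt tl by auto
qed

section \<open>Invariant elements\<close>

lemma pip_add: "poly (pip (b + r)) y = poly (pip b) y * poly (pip r) (P ^ b * y)"
  by (induction r) (simp_all add: pip_Suc power_add algebra_simps, simp add: pip_def)

text \<open>Polynomial dependence on a single coordinate is what the scaling argument for x_k
  requires.\<close>

lemma bm_poly: "\<exists>p. \<forall>u. bm mu (x(k := u)) = poly p u"
proof -
  have "\<exists>p. \<forall>u. (x(k := u)) i = poly p u" for i
  proof (cases "i = k")
    case True
    then show ?thesis by (intro exI[of _ "[:0, 1:]"]) simp
  next
    case False
    then show ?thesis by (intro exI[of _ "[:x i:]"]) simp
  qed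
  then obtain X where X: "\<And>i u. (x(k := u)) i = poly (X i) u" by metis
  have "bm mu (x(k := u)) =
      poly (\<Prod>i\<in>{1..n}. \<Prod>r<mu i. X i - smult (qp (2 * (0 - int r))) (X (i - 1))) u" for u
    unfolding bm_def wfac_def X by (simp add: poly_prod)
  then show ?thesis by blast
qed

text \<open>The q^\<epsilon>_i kill all weights below n and the bidegree fixes the last one. The e_k
  make the coefficient constant in x_1, ..., x_(n-2), so these may be set to 0, where each B_mu is
  explicit and shows both the factor \<open>pip b\<close> and the bound d.\<close>

lemma zonal_of_invariant:
  assumes f: "inZt n q l m f" "invariant n q 1 f"
  shows "\<exists>g. degree g \<le> d \<and> zonal g f"
proof -
  have fe: "f \<in> felem n" using f(1) by (rule inZt_felem)
  obtain c where c: "c \<in> cfams n" "\<forall>p\<in>csupp c. absl n (fst p) = l \<and> absl n (snd p) = m"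
    "fsub f (lin n c) \<in> Jz n q" using f(1) by (auto simp: inZt_def)
  have fin: "finite (csupp c)" using c by (simp add: cfams_def)
  have ev_f: "ev x f h = ev x (lin n c) h" if "x 0 = 0" "x n = 1" for x h
    unfolding ev_def using c fe that by (intro ev_cong_Jz felem_lin)
  have weight: "h = hs" if x: "x 0 = 0" "x n = 1" and nz: "ev x f h \<noteq> 0" for x h
  proof
    fix i
    obtain p where p: "p \<in> csupp c" "h = wt (fst p) (snd p)"
    proof -
      have "(\<Sum>p\<in>csupp c. c p * (if h = wt (fst p) (snd p) then qp (bil h (snd p)) * bm (snd p) x else 0)) \<noteq> 0"
        using nz ev_f[OF x] ev_lin[OF c(1)] by simp
      then obtain p where "p \<in> csupp c" "c p * (if h = wt (fst p) (snd p) then qp (bil h (snd p)) * bm (snd p) x else 0) \<noteq> 0"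
        by (rule sum.not_neutral_contains_not_neutral)
      then show ?thesis using that by (auto split: if_splits)
    qed
    have pa: "fst p \<in> adm n" "snd p \<in> adm n" using p c by (auto simp: cfams_def)
    have zero: "h i = 0" if "1 \<le> i" "i \<le> n - 1" for i
    proof -
      have "fsub (opapp n q (qeps_b n q i) f) f \<in> Jz n q" using f(2) that by (simp add: invariant_def)
      then have "ev x (fsub (opapp n q (qeps_b n q i) f) f) h = 0" unfolding ev_def using x by (intro aop_Jz)
      moreover have "opapp n q (qeps_b n q i) f \<in> felem n" by (intro felem_opapp qeps_b_felem fe)
      ultimately have "qp (h i) * ev x f h = ev x f h"
        using ev_qeps[of f x i h] x(1) fe by (simp add: ev_def aop_fsub felem_ffin[of _ n])
      then show ?thesis using nz by simp
    qed
    have "(\<Sum>i\<in>{1..n}. h i) = int l - int m"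
      using p c(2) by (auto simp: wt_def sum_subtractf absl_def)
    moreover have "(\<Sum>i\<in>{1..n}. h i) = (\<Sum>i\<in>{n}. h i)"
    proof (rule sum.mono_neutral_right)
      show "\<forall>i\<in>{1..n} - {n}. h i = 0" by (intro ballI zero) auto
    qed (use n_ge_2 in auto)
    ultimately have "h n = int a - int b" using abd by simp
    moreover have "h i = 0" if "i = 0 \<or> n < i" using that p(2) pa by (auto simp: wt_def adm_def)
    moreover have "i = 0 \<or> n < i \<or> i = n \<or> 1 \<le> i \<and> i \<le> n - 1" by auto
    ultimately show "h i = hs i" using zero n_ge_2 by (auto simp: hs_def)
  qed
  define F where "F x = ev x (lin n c) hs" for x
  \<comment> \<open>On this weight e_k f = 0 reads (x_k - x_(k+1)) times the difference of F at x_k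
    and at P x_k; the first factor has to be divided out.\<close>
  have shift: "F x = F (x(k := P * x k))"
    if k: "1 \<le> k" "k \<le> n - 1 - 1" and x: "x 0 = 0" "x n = 1" "x k \<noteq> x (Suc k)" for k x
  proof -
    have k': "k < n" "Suc k \<noteq> n" "k \<noteq> n" using k n_ge_2 by auto
    \<comment> \<open>The weight at which e_k f has to be read so that exactly the coefficient of f
      at \<open>hs\<close> enters.\<close>
    define h' where "h' = hs(k := 1, Suc k := - 1)"
    have hk: "hs k = 0" "hs (Suc k) = 0" using k' by (auto simp: hs_def)
    then have h: "hs = h'(k := h' k - 1, Suc k := h' (Suc k) + 1)" by (auto simp: h'_def fun_eq_iff)
    have "opapp n q (e_b n q k) f \<in> Jz n q" using f(2) k by (simp add: invariant_def)
    then have "ev x (opapp n q (e_b n q k) f) h' = 0" unfolding ev_def using x by (intro aop_Jz)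
    then have "(x k - x (Suc k)) * ev x f hs + (x (Suc k) - x k) * ev (x(k := P * x k)) f hs = 0"
      using ev_e[where x = x, OF k(1) k'(1) fe x(1) h] by (simp add: hk)
    then have "(x k - x (Suc k)) * (ev x f hs - ev (x(k := P * x k)) f hs) = 0"
      by (simp add: algebra_simps)
    then have "ev x f hs = ev (x(k := P * x k)) f hs" using x(3) by simp
    then show ?thesis using ev_f[of x hs] ev_f[of "x(k := P * x k)" hs] x k k' by (simp add: F_def)
  qed
  have const: "F (x(k := u)) = F x" if k: "1 \<le> k" "k \<le> n - 1 - 1" and x: "x 0 = 0" "x n = 1" for k x u
  proof -
    have "\<forall>mu. \<exists>r. \<forall>u. bm mu (x(k := u)) = poly r u"
      using bm_poly by blast
    then obtain B where B: "\<forall>mu. \<forall>u. bm mu (x(k := u)) = poly (B mu) u"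
      by (rule choice[THEN exE])
    define r where "r = (\<Sum>p\<in>csupp c. smult (c p * (if hs = wt (fst p) (snd p) then qp (bil hs (snd p)) else 0)) (B (snd p)))"
    have r: "F (x(k := u)) = poly r u" for u
      unfolding F_def ev_lin[OF c(1)] r_def using B by (auto simp: poly_sum intro!: sum.cong)
    have k': "k \<noteq> n" "0 < k" using k by auto
    have "poly r u = poly r (x k)"
    proof (rule poly_scale_invariant_const[of "x (Suc k)" r P])
      fix u assume "u \<noteq> x (Suc k)"
      then show "poly r (P * u) = poly r u"
        using shift[OF k, of "x(k := u)"] x k' by (simp add: r[symmetric])
    qed auto
    then show ?thesis using r[of u] r[of "x k"] by simp
  qed
  \<comment> \<open>The coordinates 1, ..., n - 2 are set to 0 one at a time; for n = 2 there are
    none.\<close>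
  have F_zero: "F x = F (\<lambda>i. if i \<le> j then 0 else x i)"
    if "j \<le> n - 1 - 1" "x 0 = 0" "x n = 1" for j x
    using that(1)
  proof (induction j)
    case 0
    have "(\<lambda>i. if i \<le> 0 then 0 else x i) = x" using that(2) by auto
    then show ?case by simp
  next
    case (Suc j)
    have "(\<lambda>i. if i \<le> Suc j then 0 else x i) = (\<lambda>i. if i \<le> j then 0 else x i)(Suc j := 0)" by auto
    then have "F (\<lambda>i. if i \<le> Suc j then 0 else x i) = F (\<lambda>i. if i \<le> j then 0 else x i)"
      using const[of "Suc j" "\<lambda>i. if i \<le> j then 0 else x i" 0] Suc.prems that by simp
    then show ?case using Suc by simp
  qed
  define S where "S = {p \<in> csupp c. wt (fst p) (snd p) = hs}"
  \<comment> \<open>At such a point the coordinates up to n - 2 give powers of 0, coordinate n - 1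
    gives the pure power x_(n-1)^s, and coordinate n gives \<open>pip (b + e)\<close>, which
    contains \<open>pip b\<close>.\<close>
  have Sp: "\<exists>r. degree r \<le> d \<and> (\<forall>x. x n = 1 \<longrightarrow>
      bm (snd p) (\<lambda>i. if i \<le> n - 1 - 1 then 0 else x i) = poly (pip b) (x (n - 1)) * poly r (P ^ b * x (n - 1)))"
    if p: "p \<in> S" for p
  proof -
    define lam mu where "lam = fst p" and "mu = snd p"
    have lm: "lam i = mu i" if "i \<noteq> n" for i
      using p that unfolding S_def wt_def hs_def lam_def mu_def by (auto simp: fun_eq_iff split: if_splits)
    have "wt lam mu n = hs n" using p by (simp add: S_def lam_def mu_def)
    then have lmn: "int (lam n) - int (mu n) = int a - int b" by (simp add: wt_def hs_def)
    define e where "e = min (lam n) (mu n)"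
    have mun: "mu n = b + e" and lan: "lam n = a + e" using lmn abd(1) by (auto simp: e_def)
    define s where "s = mu (n - 1)"
    obtain k where k: "n = Suc (Suc k)"
    proof -
      have "n = Suc (Suc (n - 2))" using n_ge_2 by simp
      then show ?thesis by (rule that)
    qed
    have split: "(\<Prod>i\<in>{1..n}. f i) = f n * (f (n - 1) * (\<Prod>i\<in>{1..n - 1 - 1}. f i))"
      for f :: "nat \<Rightarrow> complex"
      unfolding k by (simp add: mult_ac)
    have "s + mu n \<le> absl n mu" unfolding absl_def s_def k by simp
    moreover have "absl n mu = m" using c(2) p unfolding S_def mu_def by blast
    ultimately have "s + e \<le> d" using mun abd(3) by linarith
    define z where "z = (\<Prod>i\<in>{1..n - 1 - 1}. (0::complex) ^ mu i)"
    \<comment> \<open>The power of T undoes the P^(b s) that x^s acquires from the argument P^b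
      x_(n-1).\<close>
    define r where "r = smult (z * T ^ (b * s)) (monom 1 s * pip e)"
    have "degree (pip e) \<le> (\<Sum>j<e. 1)"
      unfolding pip_def by (intro order_trans[OF degree_prod_sum_le] sum_mono) auto
    then have "degree r \<le> d"
      using \<open>s + e \<le> d\<close> degree_mult_le[of "monom 1 s" "pip e"] degree_monom_le[of "1::complex" s]
      unfolding r_def by (intro order_trans[OF degree_smult_le]) simp
    moreover have "bm mu (\<lambda>i. if i \<le> n - 1 - 1 then 0 else x i) = poly (pip b) (x (n - 1)) * poly r (P ^ b * x (n - 1))"
      if x: "x n = 1" for x
    proof -
      let ?x = "\<lambda>i. if i \<le> n - 1 - 1 then 0 else x i"
      have "(\<Prod>i\<in>{1..n - 1 - 1}. wfac ?x i 0 (mu i)) = z"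
        unfolding z_def wfac_def by (intro prod.cong refl) auto
      moreover have "wfac ?x (n - 1) 0 (mu (n - 1)) = x (n - 1) ^ s"
        unfolding wfac_def s_def k by simp
      moreover have "wfac ?x n 0 (mu n) = poly (pip (b + e)) (x (n - 1))"
        using x mun unfolding k by (simp add: wfac_fac fac_def pip_def poly_prod mult.commute)
      ultimately have "bm mu ?x = poly (pip (b + e)) (x (n - 1)) * (x (n - 1) ^ s * z)"
        unfolding bm_def split by (simp only:)
      moreover have "T ^ (b * s) * (P ^ b * x (n - 1)) ^ s = x (n - 1) ^ s"
      proof -
        have "T ^ (b * s) * P ^ (b * s) = 1" using P_T_power by (simp add: mult.commute)
        then show ?thesis by (simp add: power_mult_distrib mult.assoc[symmetric] power_mult[symmetric])
      qed
      ultimately show ?thesis unfolding pip_add r_def by (simp add: poly_monom mult_ac)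
    qed
    ultimately show ?thesis unfolding mu_def by blast
  qed
  then have "\<forall>p\<in>S. \<exists>r. degree r \<le> d \<and> (\<forall>x. x n = 1 \<longrightarrow>
      bm (snd p) (\<lambda>i. if i \<le> n - 1 - 1 then 0 else x i) = poly (pip b) (x (n - 1)) * poly r (P ^ b * x (n - 1)))"
    by (intro ballI)
  then obtain R where R': "\<forall>p\<in>S. degree (R p) \<le> d \<and> (\<forall>x. x n = 1 \<longrightarrow>
      bm (snd p) (\<lambda>i. if i \<le> n - 1 - 1 then 0 else x i) = poly (pip b) (x (n - 1)) * poly (R p) (P ^ b * x (n - 1)))"
    by (rule bchoice[THEN exE])
  then have R: "\<And>p. p \<in> S \<Longrightarrow> degree (R p) \<le> d"
    "\<And>p x. p \<in> S \<Longrightarrow> x n = 1 \<Longrightarrow> bm (snd p) (\<lambda>i. if i \<le> n - 1 - 1 then 0 else x i) =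
      poly (pip b) (x (n - 1)) * poly (R p) (P ^ b * x (n - 1))" by simp_all
  define g where "g = (\<Sum>p\<in>S. smult (c p * qp (bil hs (snd p))) (R p))"
  have "degree g \<le> d"
    unfolding g_def
  proof (rule degree_sum_le)
    show "finite S" using fin by (simp add: S_def)
    show "degree (smult (c p * qp (bil hs (snd p))) (R p)) \<le> d" if "p \<in> S" for p
      using order_trans[OF degree_smult_le R(1)[OF that]] .
  qed
  moreover have "zonal g f"
    unfolding zonal_def
  proof (intro allI impI)
    fix x :: "nat \<Rightarrow> complex" and h assume x: "x 0 = 0" "x n = 1"
    let ?x = "\<lambda>i. if i \<le> n - 1 - 1 then 0 else x i"
    have "ev x f hs = F ?x" using F_zero[OF order_refl x] ev_f[OF x] by (simp add: F_def)
    also have "\<dots> = (\<Sum>p\<in>S. c p * qp (bil hs (snd p)) * bm (snd p) ?x)"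
      unfolding F_def ev_lin[OF c(1)] S_def using fin by (intro sum.mono_neutral_cong_right) auto
    also have "\<dots> = (\<Sum>p\<in>S. c p * qp (bil hs (snd p)) * (poly (pip b) (x (n - 1)) * poly (R p) (P ^ b * x (n - 1))))"
      using R(2)[of _ x] x(2) by (intro sum.cong refl) simp
    also have "\<dots> = poly (pip b) (x (n - 1)) * poly g (P ^ b * x (n - 1))"
      unfolding g_def poly_sum sum_distrib_left by (intro sum.cong refl) simp
    finally show "ev x f h = (if h = hs then poly (pip b) (x (n - 1)) * poly g (P ^ b * x (n - 1)) else 0)"
      using weight[OF x, of h] by auto
  qed
  ultimately show ?thesis by blast
qed

text \<open>An element is determined modulo the ideal by its evaluations, and these depend linearly
  on the polynomial g, which is a multiple of the Jacobi polynomial.\<close>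

lemma invariant_unique:
  assumes "inHt n q l m f" "invariant n q 1 f"
  shows "\<exists>c. fsub f (fsc c (Rel n q l m)) \<in> Jz n q"
proof -
  have Z: "inZt n q l m f" using assms(1) by (simp add: inHt_def)
  then have fe: "f \<in> felem n" by (rule inZt_felem)
  obtain g where g: "degree g \<le> d" "zonal g f" using zonal_of_invariant[OF Z assms(2)] by blast
  obtain c where c: "g = smult c (jac (a + b) d)"
    using ip_zonal_unique[OF assms(1) fe g(2,1)] by blast
  have "ev x (fsub f (fsc c (Rel n q l m))) h = 0" if "good0 n x" "x n = 1" for x h
    using zonalD[OF g(2), of x h] zonalD[OF zonal_Rel, of x h] that fe felem_Rel
    by (simp add: ev_def aop_fsub aop_fsc felem_ffin[of _ n] felem_fsc c good0_def)
  then show ?thesis using fe felem_Rel by (intro exI[of _ c], subst Jz_iff) (auto intro: felem_fsub felem_fsc)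
qed

end

theorem theorem3p3p1:
  fixes n l m :: nat and q :: real
  assumes "0 < q" and "q < 1" and "2 \<le> n"
  shows "Rel n q l m \<notin> Jz n q
       \<and> inHt n q l m (Rel n q l m) \<and> invariant n q 1 (Rel n q l m)
       \<and> (\<forall>x. inHt n q l m x \<and> invariant n q 1 x \<longrightarrow>
              (\<exists>c::complex. fsub x (fsc c (Rel n q l m)) \<in> Jz n q))"
proof -
  interpret qsphere_bideg n q l m by unfold_locales (use assms in auto)
  show ?thesis using Rel_not_Jz inHt_Rel invariant_Rel invariant_unique by blast
qed

end
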